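(* Let $a\in\mathbb N^n$ be a weak composition and $C$ a connected component of the directed edge-colored graph on $\mathrm{SSKD}(a)$ with an $i$-edge $T\to e_i(T)$ whenever $e_i(T)\ne0$. Then $C$ is an extremal subcrystal of a normal crystal: there exist a partition $\lambda$ with $n$ parts and a weight-preserving bijection $\Phi$ from $C$ onto an extremal subset $X\subseteq\mathcal B(\lambda)$ such that for all $T,T'\in C$ and all $i$, $e_i(T)=T'$ if and only if $e_i(\Phi(T))=\Phi(T')$.
   Context: The diagram of $a$ has cells $(r,c)$ (row $r$ from the bottom, column $c$ from the left) with $1\le c\le a_r$, augmented (following Haglund–Haiman–Loehr) by a basement column $0$ whose cell $(r,0)$ contains $r$, basement cells being included in the conditions below (row lengths compared without basement). Fillings have entries in $\{1,\dots,n\}$. Cells attack if in the same column, or in adjacent columns with the left cell strictly higher; non-attacking: attacking cells have different entries. A triple: cells $(r,c),(r,c+1)$ with entries $i,j$ and a third with entry $k$, either $(s,c)$, $s>r$, row $r$ strictly longer than row $s$, or $(s,c+1)$, $s<r$, row $r$ weakly longer than row $s$; co-inversion if $i<j<k$, $j<k<i$ or $k<i<j$. $\mathrm{SSKD}(a)$: non-attacking fillings with no co-inversion triples; $\mathrm{wt}(T)_m$ = number of entries $m$. $i$-pairing: pair an $i$ and an $i+1$ in the same column, then iteratively pair an unpaired $i+1$ with an unpaired $i$ to its left whenever all entries $i,i+1$ between them are paired. Raising $e_i$: $0$ if no unpaired $i+1$; otherwise change the rightmost unpaired $i+1$ to $i$, swap $i,i+1$ in each of the consecutive columns immediately to its left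 having an $i+1$ in the same row and an $i$ above, and in each of the consecutive columns immediately to its right having an $i+1$ in the same row and an $i$ below. $\mathcal B(\lambda)$ is the connected normal $\mathfrak{gl}_n$-crystal of highest weight $\lambda$ with operators $e_i,f_i$ and highest weight element $u_\lambda$. $X\subseteq\mathcal B(\lambda)$ is extremal if (1) $u_\lambda\in X$; (2) $x\in X$, $e_i(x)\ne0$ implies $e_i(x)\in X$; (3) if $x\in X$, $f_i(x)\ne0$ and $f_i(x)\notin X$ then $e_i(x)\notin X$. *)

theory Defs
  imports Main "HOL-Library.FuncSet"
begin

section \<open>Crystals\<close>

text \<open>
  A crystal operator indexed by \<open>i\<close> is a function into an option type; \<^term>\<open>None\<close> plays the role
  of the value \<open>0\<close>.
\<close>

definition edges :: "'b set \<Rightarrow> 'i set \<Rightarrow> ('i \<Rightarrow> 'b \<Rightarrow> 'b option) \<Rightarrow> ('b \<times> 'b) set" where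
  "edges V I e = {(x, y) \<in> V \<times> V. \<exists>i\<in>I. e i x = Some y}"

text \<open>Components are those of the underlying undirected graph.\<close>

definition component :: "'b set \<Rightarrow> 'i set \<Rightarrow> ('i \<Rightarrow> 'b \<Rightarrow> 'b option) \<Rightarrow> 'b \<Rightarrow> 'b set" where
  "component V I e x = ((edges V I e \<union> (edges V I e)\<inverse>)\<^sup>*) `` {x}"

definition components :: "'b set \<Rightarrow> 'i set \<Rightarrow> ('i \<Rightarrow> 'b \<Rightarrow> 'b option) \<Rightarrow> 'b set set" where
  "components V I e = component V I e ` V"

definition extremal ::
  "'i set \<Rightarrow> 'b set \<Rightarrow> ('i \<Rightarrow> 'b \<Rightarrow> 'b option) \<Rightarrow> ('i \<Rightarrow> 'b \<Rightarrow> 'b option) \<Rightarrow> 'b \<Rightarrow> 'b set \<Rightarrow> bool" where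
  "extremal I B e f u X \<longleftrightarrow>
     X \<subseteq> B \<and>
     u \<in> X \<and>
     (\<forall>i\<in>I. \<forall>x\<in>X. \<forall>y. e i x = Some y \<longrightarrow> y \<in> X) \<and>
     (\<forall>i\<in>I. \<forall>x\<in>X. \<forall>y. f i x = Some y \<and> y \<notin> X \<longrightarrow> \<not> (\<exists>z\<in>X. e i x = Some z))"


section \<open>The normal crystals \<open>B(\<lambda>)\<close>\<close>

text \<open>The standard \<open>gl\<^sub>n\<close>-crystal \<open>1 \<rightarrow> 2 \<rightarrow> \<dots> \<rightarrow> n\<close>, with \<open>i\<close>-arrow \<open>i \<rightarrow> i + 1\<close> for \<open>1 \<le> i < n\<close>.\<close>

definition letter_raise :: "nat \<Rightarrow> nat \<Rightarrow> nat option" where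
  "letter_raise i x = (if x = i + 1 then Some i else None)"

definition letter_lower :: "nat \<Rightarrow> nat \<Rightarrow> nat option" where
  "letter_lower i x = (if x = i then Some (i + 1) else None)"

definition letter_eps :: "nat \<Rightarrow> nat \<Rightarrow> nat" where
  "letter_eps i x = (if x = i + 1 then 1 else 0)"

definition letter_phi :: "nat \<Rightarrow> nat \<Rightarrow> nat" where
  "letter_phi i x = (if x = i then 1 else 0)"

text \<open>
  The word \<open>[x\<^sub>1, \<dots>, x\<^sub>k]\<close> stands for \<open>x\<^sub>1 \<otimes> \<dots> \<otimes> x\<^sub>k\<close> in the \<open>k\<close>-th tensor power of the standard
  crystal. Kashiwara's tensor product rule is applied to \<open>x \<otimes> w\<close>:
  \<open>e\<^sub>i\<close> acts on \<open>x\<close> if \<open>\<phi>\<^sub>i(x) \<ge> \<epsilon>\<^sub>i(w)\<close> and on \<open>w\<close> otherwise,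
  \<open>f\<^sub>i\<close> acts on \<open>x\<close> if \<open>\<phi>\<^sub>i(x) > \<epsilon>\<^sub>i(w)\<close> and on \<open>w\<close> otherwise,
  \<open>\<epsilon>\<^sub>i(x \<otimes> w) = \<epsilon>\<^sub>i(x) + max 0 (\<epsilon>\<^sub>i(w) - \<phi>\<^sub>i(x))\<close> (subtraction on \<^typ>\<open>nat\<close> truncates).
\<close>

fun word_eps :: "nat \<Rightarrow> nat list \<Rightarrow> nat" where
  "word_eps i [] = 0"
| "word_eps i (x # w) = letter_eps i x + (word_eps i w - letter_phi i x)"

fun word_raise :: "nat \<Rightarrow> nat list \<Rightarrow> nat list option" where
  "word_raise i [] = None"
| "word_raise i (x # w) =
     (if letter_phi i x \<ge> word_eps i w
      then map_option (\<lambda>y. y # w) (letter_raise i x)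
      else map_option (\<lambda>v. x # v) (word_raise i w))"

fun word_lower :: "nat \<Rightarrow> nat list \<Rightarrow> nat list option" where
  "word_lower i [] = None"
| "word_lower i (x # w) =
     (if letter_phi i x > word_eps i w
      then map_option (\<lambda>y. y # w) (letter_lower i x)
      else map_option (\<lambda>v. x # v) (word_lower i w))"

text \<open>
  Compositions and partitions are functions of which only the values at \<open>1, \<dots>, n\<close> are used.
  Parts may be zero.
\<close>

definition is_partition :: "nat \<Rightarrow> (nat \<Rightarrow> nat) \<Rightarrow> bool" where
  "is_partition n lam \<longleftrightarrow> (\<forall>i\<in>{1..n}. \<forall>j\<in>{1..n}. i \<le> j \<longrightarrow> lam j \<le> lam i)"

text \<open>\<open>1\<^sup>\<lambda>\<^sup>1 2\<^sup>\<lambda>\<^sup>2 \<dots> n\<^sup>\<lambda>\<^sup>n\<close>, a word of weight \<open>\<lambda>\<close> annihilated by all \<open>e\<^sub>i\<close> when \<open>\<lambda>\<close> is a partition\<close>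

definition highest_word :: "nat \<Rightarrow> (nat \<Rightarrow> nat) \<Rightarrow> nat list" where
  "highest_word n lam = concat (map (\<lambda>i. replicate (lam i) i) [1..<n + 1])"

text \<open>
  The connected normal crystals are, up to isomorphism, the connected components of the tensor
  powers of the standard crystal, and such a component is determined up to isomorphism by the
  weight of its highest weight element. \<open>B(\<lambda>)\<close> is realized as the component of
  \<^term>\<open>highest_word n lam\<close>, which is its highest weight element \<open>u\<^sub>\<lambda>\<close>.
\<close>

definition normal_crystal :: "nat \<Rightarrow> (nat \<Rightarrow> nat) \<Rightarrow> nat list set" where
  "normal_crystal n lam = component (lists {1..n}) {1..<n} word_raise (highest_word n lam)"

definition word_wt :: "nat list \<Rightarrow> nat \<Rightarrow> nat" where
  "word_wt w m = count_list w m"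


section \<open>Semistandard key tabloids\<close>

text \<open>The cell \<open>(r, c)\<close> lies in row \<open>r\<close> (from the bottom) and column \<open>c\<close> (from the left).\<close>

type_synonym cell = "nat \<times> nat"
type_synonym filling = "cell \<Rightarrow> nat"

definition diagram :: "nat \<Rightarrow> (nat \<Rightarrow> nat) \<Rightarrow> cell set" where
  "diagram n a = {(r, c). 1 \<le> r \<and> r \<le> n \<and> 1 \<le> c \<and> c \<le> a r}"

definition aug_diagram :: "nat \<Rightarrow> (nat \<Rightarrow> nat) \<Rightarrow> cell set" where
  "aug_diagram n a = diagram n a \<union> {1..n} \<times> {0}"

text \<open>
  A filling only assigns entries to the cells of the diagram (it is \<^term>\<open>undefined\<close> elsewhere);
  \<open>aug T\<close> adds the basement.
\<close>

definition fillings :: "nat \<Rightarrow> (nat \<Rightarrow> nat) \<Rightarrow> filling set" where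
  "fillings n a = diagram n a \<rightarrow>\<^sub>E {1..n}"

definition aug :: "filling \<Rightarrow> filling" where
  "aug T = (\<lambda>(r, c). if c = 0 then r else T (r, c))"

text \<open>Only one orientation of the symmetric attacking relation in adjacent columns is listed.\<close>

definition attacks :: "cell \<Rightarrow> cell \<Rightarrow> bool" where
  "attacks x y \<longleftrightarrow>
     (snd x = snd y \<and> fst x \<noteq> fst y) \<or> (snd y = snd x + 1 \<and> fst x > fst y)"

definition non_attacking :: "nat \<Rightarrow> (nat \<Rightarrow> nat) \<Rightarrow> filling \<Rightarrow> bool" where
  "non_attacking n a T \<longleftrightarrow>
     (\<forall>x\<in>aug_diagram n a. \<forall>y\<in>aug_diagram n a. attacks x y \<longrightarrow> aug T x \<noteq> aug T y)"

text \<open>\<open>triple n a x y z\<close>: \<open>x\<close> and \<open>y\<close> are the left and right cells of the horizontal pair.\<close>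

definition triple :: "nat \<Rightarrow> (nat \<Rightarrow> nat) \<Rightarrow> cell \<Rightarrow> cell \<Rightarrow> cell \<Rightarrow> bool" where
  "triple n a x y z \<longleftrightarrow>
     {x, y, z} \<subseteq> aug_diagram n a \<and>
     (\<exists>r c s. x = (r, c) \<and> y = (r, c + 1) \<and>
        (z = (s, c) \<and> s > r \<and> a r > a s \<or>
         z = (s, c + 1) \<and> s < r \<and> a r \<ge> a s))"

definition co_inversion :: "nat \<Rightarrow> nat \<Rightarrow> nat \<Rightarrow> bool" where
  "co_inversion i j k \<longleftrightarrow> i < j \<and> j < k \<or> j < k \<and> k < i \<or> k < i \<and> i < j"

definition SSKD :: "nat \<Rightarrow> (nat \<Rightarrow> nat) \<Rightarrow> filling set" where
  "SSKD n a = {T \<in> fillings n a. non_attacking n a T \<and>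
     (\<forall>x y z. triple n a x y z \<longrightarrow> \<not> co_inversion (aug T x) (aug T y) (aug T z))}"

definition key_wt :: "nat \<Rightarrow> (nat \<Rightarrow> nat) \<Rightarrow> filling \<Rightarrow> nat \<Rightarrow> nat" where
  "key_wt n a T m = card {x \<in> diagram n a. T x = m}"


subsection \<open>Pairing and raising operators\<close>

definition cells_of :: "nat \<Rightarrow> (nat \<Rightarrow> nat) \<Rightarrow> filling \<Rightarrow> nat \<Rightarrow> cell set" where
  "cells_of n a T m = {x \<in> diagram n a. T x = m}"

text \<open>
  The stages of the iterative pairing process, as sets of pairs (cell with entry \<open>i\<close>, cell with
  entry \<open>i + 1\<close>); a cell is paired at stage \<open>P\<close> iff it lies in \<^term>\<open>Field P\<close>.
\<close>

inductive pairing_stage :: "nat \<Rightarrow> (nat \<Rightarrow> nat) \<Rightarrow> filling \<Rightarrow> nat \<Rightarrow> cell rel \<Rightarrow> bool"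
  for n a T i where
  column: "pairing_stage n a T i
     {(x, y). x \<in> cells_of n a T i \<and> y \<in> cells_of n a T (i + 1) \<and> snd x = snd y}"
| step: "pairing_stage n a T i (insert (x, y) P)"
    if "pairing_stage n a T i P"
      and "x \<in> cells_of n a T i" and "y \<in> cells_of n a T (i + 1)"
      and "x \<notin> Field P" and "y \<notin> Field P"
      and "snd x < snd y"
      and "\<forall>z \<in> cells_of n a T i \<union> cells_of n a T (i + 1).
             snd x < snd z \<and> snd z < snd y \<longrightarrow> z \<in> Field P"

text \<open>The cells with entry \<open>i + 1\<close> that never get paired\<close>

definition unpaired_upper :: "nat \<Rightarrow> (nat \<Rightarrow> nat) \<Rightarrow> filling \<Rightarrow> nat \<Rightarrow> cell set" where
  "unpaired_upper n a T i =
     {y \<in> cells_of n a T (i + 1). \<forall>P. pairing_stage n a T i P \<longrightarrow> y \<notin> Field P}"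

text \<open>
  The maximal runs of consecutive columns immediately to the left, respectively right, of the
  column \<open>c\<close> of the changed cell \<open>(r, c)\<close> in which \<open>i\<close> and \<open>i + 1\<close> are swapped.
\<close>

definition left_run :: "nat \<Rightarrow> (nat \<Rightarrow> nat) \<Rightarrow> filling \<Rightarrow> nat \<Rightarrow> cell \<Rightarrow> nat set" where
  "left_run n a T i = (\<lambda>(r, c). {d. d < c \<and>
     (\<forall>d'. d \<le> d' \<and> d' < c \<longrightarrow>
        (r, d') \<in> cells_of n a T (i + 1) \<and> (\<exists>s>r. (s, d') \<in> cells_of n a T i))})"

definition right_run :: "nat \<Rightarrow> (nat \<Rightarrow> nat) \<Rightarrow> filling \<Rightarrow> nat \<Rightarrow> cell \<Rightarrow> nat set" where
  "right_run n a T i = (\<lambda>(r, c). {d. c < d \<and>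
     (\<forall>d'. c < d' \<and> d' \<le> d \<longrightarrow>
        (r, d') \<in> cells_of n a T (i + 1) \<and> (\<exists>s<r. (s, d') \<in> cells_of n a T i))})"

definition swap_entry :: "nat \<Rightarrow> nat \<Rightarrow> nat" where
  "swap_entry i m = (if m = i then i + 1 else if m = i + 1 then i else m)"

definition raise_at :: "nat \<Rightarrow> (nat \<Rightarrow> nat) \<Rightarrow> filling \<Rightarrow> nat \<Rightarrow> cell \<Rightarrow> filling" where
  "raise_at n a T i y = (\<lambda>x \<in> diagram n a.
     if x = y then i
     else if snd x \<in> left_run n a T i y \<union> right_run n a T i y then swap_entry i (T x)
     else T x)"

text \<open>
  In a non-attacking filling no column contains two entries \<open>i + 1\<close>, so there is exactly one
  rightmost unpaired \<open>i + 1\<close> as soon as there is any.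
\<close>

definition key_raise :: "nat \<Rightarrow> (nat \<Rightarrow> nat) \<Rightarrow> nat \<Rightarrow> filling \<Rightarrow> filling option" where
  "key_raise n a i T =
     (if unpaired_upper n a T i = {} then None
      else Some (raise_at n a T i
        (THE y. y \<in> unpaired_upper n a T i \<and> (\<forall>z \<in> unpaired_upper n a T i. snd z \<le> snd y))))"

end

theory Submission
  imports Defs
begin

text \<open>
  Read column by column, row \<open>r\<close> of a tabloid is a particle that starts at \<open>r\<close> on the cycle
  \<open>1, \<dots>, n\<close> and, when its turn comes (rows move from bottom to top in each column step), travels
  cyclically downwards; \<open>co_inversion i j k\<close> says that the move from \<open>i\<close> to \<open>j\<close> jumps over \<open>k\<close>. A
  tabloid is a motion in which no particle lands on another one or jumps over one that will be
  removed earlier.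

  The swaps performed by \<open>e\<^sub>i\<close> do not change the sets of column entries, so the word that lists the
  columns from left to right, each in increasing order, intertwines \<open>e\<^sub>i\<close> with the operator on words.
  The particle picture shows that \<open>e\<^sub>i\<close> preserves tabloids, that \<open>f\<^sub>i\<close> does so as well on tabloids with
  \<open>e\<^sub>i \<noteq> 0\<close> (the unpaired \<open>i + 1\<close> keeps the swaps away from the basement), and that the column sets
  determine the tabloid: exchanging adjacent rows \<open>a\<^sub>i > a\<^sub>i\<^sub>+\<^sub>1\<close> embeds the tabloids of shape \<open>a\<close> in those
  of the exchanged shape with the same column sets, and for weakly increasing shapes every column
  determines the next one.

  The word component of a highest weight word depends only on its weight, because Stembridge's local
  relations between the \<open>e\<^sub>i\<close> hold for words and force any two such components to agree rank by rank.
\<close>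

section \<open>Tabloids as motion on a circle\<close>

text \<open>The word forgets the rows, so the fact that column sets determine a tabloid is needed
  twice: for injectivity of the map and for extremality. The tabloid obtained by lowering is known
  only through its word; raising it gives back the word of the original tabloid, hence that tabloid
  itself, so both lie in the same component. The highest word of a component need not be
  \<open>highest_word n lam\<close>, only a word of the same weight, so the column word alone does
  not land in the prescribed copy of the crystal. An isomorphism of word components has to follow.
  Carrying it from rank to rank takes relations among lowering operators too, and these come from
  reversing and complementing words. The delicate places for the swaps are the two ends of the
  swapped block, where only part of a triple is changed. What protects them is the position of the
  changed column on the path that counts \<open>i + 1\<close> against \<open>i\<close>: raising acts
  at its first maximum, lowering just after its last one. Both positions have the same consequence
  for neighbouring columns, so one list of dangerous configurations serves both.\<close>

lemma swap_entry_inject [simp]: "swap_entry p x = swap_entry p y \<longleftrightarrow> x = y"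
  by (auto simp: swap_entry_def)

lemma swap_entry_eqD: "swap_entry p x = y \<Longrightarrow> x \<noteq> y \<Longrightarrow> x = p + 1 \<and> y = p \<or> x = p \<and> y = p + 1"
  by (auto simp: swap_entry_def split: if_splits)

lemma co_inversion_same [simp]: "\<not> co_inversion x x k"
  by (auto simp: co_inversion_def)

text \<open>Relabelling by an adjacent transposition preserves the cyclic order of three labels
  unless \<open>p\<close> and \<open>p + 1\<close> are both among them. The conclusion keeps the
  placements of the two labels that turn an allowed step into a jump.\<close>

lemma co_inversion_swap_all:
  assumes "co_inversion (swap_entry p l) (swap_entry p m) (swap_entry p k)"
    and "\<not> co_inversion l m k" "k \<noteq> l" "k \<noteq> m"
  shows "l = p \<and> k = p + 1 \<or> m = p + 1 \<and> k = p \<or> l = p + 1 \<and> m = p"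
  using assms unfolding co_inversion_def swap_entry_def by (auto split: if_splits)

text \<open>At an end of the swapped block only some of the three entries are relabelled. This and
  the next three lemmas cover the two kinds of triples at the left and at the right end. New here is
  a step that waits at \<open>p\<close> or at \<open>p + 1\<close>: it becomes an almost full
  turn.\<close>

lemma co_inversion_swap_target:
  assumes "co_inversion l (swap_entry p m) k" "\<not> co_inversion l m k" "k \<noteq> m"
  shows "l = p \<and> m = p"
  using assms unfolding co_inversion_def swap_entry_def by (auto split: if_splits)

lemma co_inversion_swap_target_third:
  assumes "co_inversion l (swap_entry p m) (swap_entry p k)" "\<not> co_inversion l m k" "k \<noteq> m"
  shows "l = p \<and> m = p \<or> m = p + 1 \<and> k = p \<or> l = p + 1 \<and> k = p + 1"
  using assms unfolding co_inversion_def swap_entry_def by (auto split: if_splits)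

lemma co_inversion_swap_source_third:
  assumes "co_inversion (swap_entry p l) m (swap_entry p k)" "\<not> co_inversion l m k" "k \<noteq> l"
  shows "l = p + 1 \<and> m = p + 1 \<or> l = p \<and> k = p + 1 \<or> m = p \<and> k = p"
  using assms unfolding co_inversion_def swap_entry_def by (auto split: if_splits)

lemma co_inversion_swap_source:
  assumes "co_inversion (swap_entry p l) m k" "\<not> co_inversion l m k" "k \<noteq> m" "k \<noteq> l"
  shows "l = p + 1 \<and> m = p + 1"
  using assms unfolding co_inversion_def swap_entry_def by (auto split: if_splits)

text \<open>No label lies between \<open>p + 1\<close> and \<open>p\<close>, so a downward move
  ending in \<open>p\<close> jumps over \<open>p + 1\<close> unless it starts at one of the two.
  \<open>co_inversion_from\<close> is the counterpart for moves starting at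
  \<open>p + 1\<close>.\<close>

lemma co_inversion_to: "\<not> co_inversion l m k \<Longrightarrow> m = p \<Longrightarrow> k = p + 1 \<Longrightarrow> l = p \<or> l = p + 1"
  unfolding co_inversion_def by auto

lemma co_inversion_from: "\<not> co_inversion l m k \<Longrightarrow> l = p + 1 \<Longrightarrow> k = p \<Longrightarrow> m = p \<or> m = p + 1"
  unfolding co_inversion_def by auto

text \<open>The tabloid conditions in coordinates, with the basement as column 0. In
  \<open>up\<close> and \<open>low\<close> the length comparison already guarantees that all three
  cells of the triple exist; values of \<open>A\<close> outside the cells are arbitrary.\<close>

locale key_filling =
  fixes n :: nat and a :: "nat \<Rightarrow> nat" and A :: "nat \<Rightarrow> nat \<Rightarrow> nat"
  assumes base: "r \<in> {1..n} \<Longrightarrow> A r 0 = r"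
    and range: "r \<in> {1..n} \<Longrightarrow> c \<le> a r \<Longrightarrow> A r c \<in> {1..n}"
    and inj: "\<lbrakk>r \<in> {1..n}; s \<in> {1..n}; c \<le> a r; c \<le> a s; A r c = A s c\<rbrakk> \<Longrightarrow> r = s"
    and att: "\<lbrakk>r \<in> {1..n}; s \<in> {1..n}; s < r; c \<le> a r; Suc c \<le> a s\<rbrakk> \<Longrightarrow> A r c \<noteq> A s (Suc c)"
    and up: "\<lbrakk>r \<in> {1..n}; s \<in> {1..n}; r < s; a s < a r; c \<le> a s\<rbrakk>
      \<Longrightarrow> \<not> co_inversion (A r c) (A r (Suc c)) (A s c)"
    and low: "\<lbrakk>r \<in> {1..n}; s \<in> {1..n}; s < r; a s \<le> a r; Suc c \<le> a s\<rbrakk>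
      \<Longrightarrow> \<not> co_inversion (A r c) (A r (Suc c)) (A s (Suc c))"
begin

definition occ :: "nat \<Rightarrow> nat \<Rightarrow> nat \<Rightarrow> bool" where
  "occ v d s \<longleftrightarrow> s \<in> {1..n} \<and> d \<le> a s \<and> A s d = v"

lemma occ_unique: "occ v d s \<Longrightarrow> occ v d t \<Longrightarrow> s = t"
  unfolding occ_def using inj by blast

lemma occ_value: "occ v d s \<Longrightarrow> occ w d s \<Longrightarrow> v = w"
  unfolding occ_def by blast

text \<open>Attacks point from a cell to the lower cells of the next column, so an entry that
  persists can only climb.\<close>

lemma occ_att: "occ v d r \<Longrightarrow> occ v (Suc d) s \<Longrightarrow> r \<le> s"
  unfolding occ_def using att by (metis not_le_imp_less)

end

text \<open>What is kept of the position of \<open>c\<close> on the height path. A lone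
  \<open>p\<close> before \<open>c\<close>, or a lone \<open>p + 1\<close> after \<open>c\<close>,
  separated from \<open>c\<close> only by columns with both entries, would make the path too high
  there for \<open>c\<close> to be the place of a first maximum or the step after a last
  one.\<close>

locale key_balanced = key_filling +
  fixes p c :: nat
  assumes p: "p \<in> {1..<n}"
    and left_bal: "\<lbrakk>d < c; occ p d s; \<And>e. d < e \<Longrightarrow> e < c \<Longrightarrow> Ex (occ p e) \<and> Ex (occ (p + 1) e)\<rbrakk>
      \<Longrightarrow> Ex (occ (p + 1) d)"
    and right_bal: "\<lbrakk>c < d; occ (p + 1) d s; \<And>e. c < e \<Longrightarrow> e < d \<Longrightarrow> Ex (occ p e) \<and> Ex (occ (p + 1) e)\<rbrakk>
      \<Longrightarrow> Ex (occ p d)"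
begin

text \<open>Such a configuration would reproduce itself to the left until it contradicts the basement.\<close>

lemma no_left_nest:
  assumes "d < c" "\<And>e. d \<le> e \<Longrightarrow> e < c \<Longrightarrow> Ex (occ p e) \<and> Ex (occ (p + 1) e)"
    and "occ (p + 1) d q" "occ p d s" "q < s" "a q \<le> a s"
  shows False
  using assms
proof (induction d arbitrary: q)
  case 0
  then show ?case using base unfolding occ_def by auto
next
  case (Suc d)
  note q = Suc.prems(3) and s = Suc.prems(4)
  have r: "q \<in> {1..n}" "s \<in> {1..n}" "Suc d \<le> a q" "Suc d \<le> a s" "A q (Suc d) = p + 1" "A s (Suc d) = p"
    using q s unfolding occ_def by auto
  \<comment> \<open>Row \<open>s\<close> is long enough to have to respect row \<open>q\<close>, so
    it can reach \<open>p\<close> only from \<open>p\<close> or \<open>p + 1\<close>; the latter is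
    excluded because \<open>(s, d)\<close> attacks \<open>(q, Suc d)\<close>.\<close>
  have "\<not> co_inversion (A s d) p (p + 1)"
    using low[of s q d] r Suc.prems by simp
  moreover have "A s d \<noteq> p + 1"
    using att[of s q d] r Suc.prems by simp
  ultimately have sd: "A s d = p" using co_inversion_to[of _ p "p + 1" p] by blast
  then have os: "occ p d s" using r unfolding occ_def by simp
  then obtain t where t: "occ (p + 1) d t"
    using left_bal[of d s] Suc.prems by (metis Suc_lessD Suc_leI)
  have both: "Ex (occ p e) \<and> Ex (occ (p + 1) e)" if "d \<le> e" "e < c" for e
    using that Suc.prems(2)[of e] os t by (cases "e = d") auto
  have "t \<le> q" using occ_att t q by blast
  then have ts: "t < s" using Suc.prems by simp
  have t': "t \<in> {1..n}" "d \<le> a t" "A t d = p + 1" using t unfolding occ_def by auto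
  \<comment> \<open>A longer row \<open>t\<close> would have to respect row \<open>s\<close> and
    move from \<open>p + 1\<close> to \<open>p\<close> or \<open>p + 1\<close>. These values are
    held in column \<open>Suc d\<close> by \<open>s\<close> and \<open>q\<close>, and
    \<open>q\<close> is not longer than \<open>s\<close>.\<close>
  have "a t \<le> a s"
  proof (rule ccontr)
    assume "\<not> a t \<le> a s"
    then have l: "a s < a t" by simp
    have "\<not> co_inversion (A t d) (A t (Suc d)) (A s d)"
      using up[of t s d] t' r ts l by simp
    then have "A t (Suc d) = p \<or> A t (Suc d) = p + 1"
      by (rule co_inversion_from) (use t' sd in auto)
    moreover have "Suc d \<le> a t" using l r by simp
    ultimately have "t = s \<or> t = q" using r t' inj by metis
    then show False using ts l Suc.prems by auto
  qed
  then show ?case using Suc.IH[OF _ both t os ts] Suc.prems by simp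
qed

text \<open>Such a configuration would reproduce itself to the right forever.\<close>

lemma no_right_nest:
  assumes "c < d" "\<And>e. c < e \<Longrightarrow> e \<le> d \<Longrightarrow> Ex (occ p e) \<and> Ex (occ (p + 1) e)"
    and "occ (p + 1) d x" "occ p d y" "x < y" "a y < a x"
  shows False
  using assms
\<comment> \<open>Row \<open>x\<close> stays the same and has one column less ahead of it each time,
  while its partner carrying \<open>p\<close> changes.\<close>
proof (induction "a x - d" arbitrary: d y rule: less_induct)
  case less
  have r: "x \<in> {1..n}" "y \<in> {1..n}" "d \<le> a x" "d \<le> a y" "A x d = p + 1" "A y d = p"
    using less.prems unfolding occ_def by auto
  have sx: "Suc d \<le> a x" using r less.prems by simp
  have "\<not> co_inversion (p + 1) (A x (Suc d)) p" using up[of x y d] r less.prems by simp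
  moreover have "A x (Suc d) \<noteq> p" using att[of y x d] r sx less.prems by metis
  ultimately have "A x (Suc d) = p + 1" using co_inversion_from[of "p + 1" _ p p] by blast
  then have ox: "occ (p + 1) (Suc d) x" using r sx unfolding occ_def by simp
  obtain z where z: "occ p (Suc d) z"
    using right_bal[OF _ ox] less.prems by (metis less_SucI less_Suc_eq_le)
  have both: "Ex (occ p e) \<and> Ex (occ (p + 1) e)" if "c < e" "e \<le> Suc d" for e
    using that less.prems(2)[of e] ox z by (cases "e = Suc d") auto
  have "y \<le> z" using occ_att less.prems z by blast
  then have xz: "x < z" using less.prems by simp
  have z': "z \<in> {1..n}" "Suc d \<le> a z" "A z (Suc d) = p" using z unfolding occ_def by auto
  have "a z < a x"
  proof (rule ccontr)
    assume l: "\<not> a z < a x"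
    have "\<not> co_inversion (A z d) p (p + 1)"
      using low[of z x d] r z' xz l sx \<open>A x (Suc d) = p + 1\<close> by simp
    then have "A z d = p \<or> A z d = p + 1" by (rule co_inversion_to) auto
    then have "z = y \<or> z = x" using r z' inj by (metis Suc_leD)
    then show False using xz l less.prems by auto
  qed
  moreover have "a x - Suc d < a x - d" using sx by linarith
  ultimately show ?case using less.hyps[of "Suc d" z] both ox z xz less.prems by simp
qed

end

text \<open>\<open>D\<close> is the block of columns, around the column \<open>c\<close> of the changed entry, in which \<open>p\<close> and \<open>p + 1\<close> are
  interchanged. Row \<open>r\<close> has the entry \<open>u\<close> throughout \<open>D\<close>; raising is the case \<open>u = p + 1\<close>, lowering the
  case \<open>u = p\<close>.\<close>

locale swap_region = key_balanced +
  fixes r u v :: nat and D :: "nat set"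
  assumes uv: "u = p \<and> v = p + 1 \<or> u = p + 1 \<and> v = p"
    and cr: "occ u c r" and cv: "\<not> occ v c s" and cD: "c \<in> D" and D0: "0 \<notin> D"
    and DL: "d \<in> D \<Longrightarrow> d < c \<Longrightarrow> Suc d \<in> D \<and> occ u d r \<and> (\<exists>s>r. occ v d s)"
    and DR: "d \<in> D \<Longrightarrow> c < d \<Longrightarrow> d - 1 \<in> D \<and> occ u d r \<and> (\<exists>s<r. occ v d s)"
    and DLb: "Suc d \<in> D \<Longrightarrow> d \<notin> D \<Longrightarrow> d < c \<Longrightarrow> occ u d r \<Longrightarrow> occ v d s \<Longrightarrow> s \<le> r"
    and DRb: "d \<in> D \<Longrightarrow> Suc d \<notin> D \<Longrightarrow> c \<le> d \<Longrightarrow> occ u (Suc d) r \<Longrightarrow> occ v (Suc d) s \<Longrightarrow> r \<le> s"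
begin

lemma Dr: "d \<in> D \<Longrightarrow> occ u d r"
  using cr DL DR by (metis linorder_neqE_nat)

lemma below: "d \<in> D \<Longrightarrow> d \<le> c \<Longrightarrow> occ v d s \<Longrightarrow> d < c \<and> r < s"
  using DL[of d] cv occ_unique by (metis le_neq_implies_less)

lemma above: "d \<in> D \<Longrightarrow> c \<le> d \<Longrightarrow> occ v d s \<Longrightarrow> c < d \<and> s < r"
  using DR[of d] cv occ_unique by (metis le_neq_implies_less)

lemma left_end: "d \<notin> D \<Longrightarrow> Suc d \<in> D \<Longrightarrow> Suc d \<le> c"
  using cD DR[of "Suc d"] by (metis diff_Suc_1 not_less_eq_eq not_le)

lemma right_end: "d \<in> D \<Longrightarrow> Suc d \<notin> D \<Longrightarrow> c \<le> d"
  using DL[of d] by (metis not_le)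

lemma bothL:
  assumes "d \<in> D" "d \<le> e" "e < c"
  shows "Ex (occ p e) \<and> Ex (occ (p + 1) e)"
proof -
  have "e \<in> D" using assms(2,1,3) by (induction e rule: dec_induct) (use DL in auto)
  then show ?thesis using DL[of e] assms(3) uv by auto
qed

lemma bothR:
  assumes "d \<in> D" "c < e" "e \<le> d"
  shows "Ex (occ p e) \<and> Ex (occ (p + 1) e)"
proof -
  have "e \<in> D"
    using assms(3,1,2)
  proof (induction e rule: inc_induct)
    case (step e)
    then show ?case using DR[of "Suc e"] by auto
  qed
  then show ?thesis using DR[of e] assms(2) uv by auto
qed

text \<open>Adjacent labels behave alike towards all others, so a condition can fail only in six
  situations: a row with \<open>v\<close> inside the block that must not jump over row
  \<open>r\<close> (\<open>right\<close>, \<open>left\<close>), a \<open>v\<close> next to the block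
  that would attack or be attacked by row \<open>r\<close> (\<open>enter\<close>,
  \<open>leave\<close>), and a row that waits across an end of the block and would be sent almost
  around the circle (\<open>wait_left\<close>, \<open>wait_right\<close>).\<close>

lemma swap_key_filling:
  assumes right: "\<And>d x. d \<in> D \<Longrightarrow> c \<le> d \<Longrightarrow> occ v d x \<Longrightarrow> x < r \<Longrightarrow> a r < a x \<Longrightarrow> False"
    and left: "\<And>d x. d \<in> D \<Longrightarrow> d \<le> c \<Longrightarrow> occ v d x \<Longrightarrow> r < x \<Longrightarrow> a r \<le> a x \<Longrightarrow> False"
    and enter: "\<And>d x. d \<notin> D \<Longrightarrow> Suc d \<in> D \<Longrightarrow> Suc d \<le> c \<Longrightarrow> r < x \<Longrightarrow> occ v d x \<Longrightarrow> False"
    and leave: "\<And>d x. d \<in> D \<Longrightarrow> Suc d \<notin> D \<Longrightarrow> c \<le> d \<Longrightarrow> x < r \<Longrightarrow> occ v (Suc d) x \<Longrightarrow> False"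
    and wait_left: "\<And>d x. d \<notin> D \<Longrightarrow> Suc d \<in> D \<Longrightarrow> Suc d \<le> c \<Longrightarrow> occ p d x \<Longrightarrow> occ p (Suc d) x \<Longrightarrow> False"
    and wait_right: "\<And>d x. d \<in> D \<Longrightarrow> Suc d \<notin> D \<Longrightarrow> c \<le> d \<Longrightarrow> occ (p + 1) d x \<Longrightarrow> occ (p + 1) (Suc d) x \<Longrightarrow> False"
  shows "key_filling n a (\<lambda>r d. if d \<in> D then swap_entry p (A r d) else A r d)"
proof (unfold_locales, goal_cases)
  case (1 x)
  then show ?case using D0 base by simp
next
  case (2 x d)
  then have "A x d \<in> {1..n}" using range by blast
  then show ?case using p unfolding swap_entry_def by auto
next
  case (3 x y d)
  then show ?case using inj[of x y d] by (auto split: if_splits)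
next
  case (4 x y d)
  have at: "A x d \<noteq> A y (Suc d)" using att[of x y d] 4 by blast
  have o: "occ (A x d) d x" "occ (A y (Suc d)) (Suc d) y" using 4 unfolding occ_def by auto
  have sw: "w = u \<and> z = v \<or> w = v \<and> z = u" if "swap_entry p w = z" "w \<noteq> z" for w z
    using swap_entry_eqD[OF that] uv by auto
  consider "d \<in> D \<longleftrightarrow> Suc d \<in> D" | "d \<notin> D" "Suc d \<in> D" | "d \<in> D" "Suc d \<notin> D" by blast
  then show ?case
  proof cases
    case 1
    then show ?thesis using at by auto
  next
    case 2
    note dc = left_end[OF 2] and r = Dr[OF 2(2)]
    have "swap_entry p (A y (Suc d)) \<noteq> A x d"
    proof
      assume "swap_entry p (A y (Suc d)) = A x d"
      from sw[OF this at[symmetric]] show False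
      proof (elim disjE conjE)
        assume "A y (Suc d) = u" "A x d = v"
        then have "y = r" "occ v d x" using occ_unique[OF r, of y] o by auto
        then show False using enter[OF 2 dc, of x] 4 by simp
      next
        assume "A y (Suc d) = v" "A x d = u"
        then have "r < y" "x \<le> r" using below[OF 2(2) dc, of y] occ_att[of u d x r] r o by auto
        then show False using 4 by simp
      qed
    qed
    then show ?thesis using 2 by simp
  next
    case 3
    note dc = right_end[OF 3] and r = Dr[OF 3(1)]
    have "swap_entry p (A x d) \<noteq> A y (Suc d)"
    proof
      assume "swap_entry p (A x d) = A y (Suc d)"
      from sw[OF this at] show False
      proof (elim disjE conjE)
        assume "A x d = u" "A y (Suc d) = v"
        then have "x = r" "occ v (Suc d) y" using occ_unique[OF r, of x] o by auto
        then show False using leave[OF 3 dc, of y] 4 by simp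
      next
        assume "A x d = v" "A y (Suc d) = u"
        then have "x < r" "r \<le> y" using above[OF 3(1) dc, of x] occ_att[of u d r y] r o by auto
        then show False using 4 by simp
      qed
    qed
    then show ?thesis using 3 by simp
  qed
next
  case (5 x y d)
  have nc: "\<not> co_inversion (A x d) (A x (Suc d)) (A y d)" using up[of x y d] 5 by blast
  have ne: "A y d \<noteq> A x d" "A y d \<noteq> A x (Suc d)"
    using inj[of x y d] att[of y x d] 5 by auto
  have o: "occ (A x d) d x" "occ (A x (Suc d)) (Suc d) x" "occ (A y d) d y"
    using 5 unfolding occ_def by auto
  show ?case
  proof
    assume c': "co_inversion (if d \<in> D then swap_entry p (A x d) else A x d)
       (if Suc d \<in> D then swap_entry p (A x (Suc d)) else A x (Suc d))
       (if d \<in> D then swap_entry p (A y d) else A y d)"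
    consider "d \<in> D" "Suc d \<in> D" | "d \<notin> D" "Suc d \<notin> D" | "d \<notin> D" "Suc d \<in> D" | "d \<in> D" "Suc d \<notin> D" by blast
    then show False
    proof cases
      case 1
      note r = Dr[OF 1(1)] Dr[OF 1(2)]
      have c'': "co_inversion (swap_entry p (A x d)) (swap_entry p (A x (Suc d))) (swap_entry p (A y d))"
        using c' 1 by simp
      have xr: "x \<noteq> r"
      proof
        assume "x = r"
        then have "A x d = A x (Suc d)" using r unfolding occ_def by simp
        then show False using c'' by simp
      qed
      have nr: "A x d \<noteq> u" "A x (Suc d) \<noteq> u" using xr o r occ_unique by metis+
      from co_inversion_swap_all[OF c'' nc ne] nr uv
      have "y = r \<and> (occ v d x \<or> occ v (Suc d) x)"
        using o occ_unique[OF r(1), of y] by auto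
      then show False
        using right[OF 1(1) _ _, of x] right[OF 1(2) _ _, of x] below[OF 1(1), of x] below[OF 1(2), of x] 5
        by (metis less_asym nat_le_linear)
    next
      case 2
      then show False using c' nc by simp
    next
      case 3
      have "A x d = p \<and> A x (Suc d) = p"
        using co_inversion_swap_target[of "A x d" p "A x (Suc d)" "A y d"] c' 3 nc ne by simp
      then show False using wait_left[OF 3 left_end[OF 3], of x] o by simp
    next
      case 4
      note dc = right_end[OF 4] and r = Dr[OF 4(1)]
      consider "A x d = p + 1" "A x (Suc d) = p + 1" | "A x d = p" "A y d = p + 1" | "A x (Suc d) = p" "A y d = p"
        using co_inversion_swap_source_third[of p "A x d" "A x (Suc d)" "A y d"] c' 4 nc ne by auto
      then show False
      proof cases
        case 1
        then show False using wait_right[OF 4 dc, of x] o by simp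
      next
        case 2
        then have "y = r \<and> occ v d x \<or> x = r \<and> occ v d y"
          using uv o occ_unique[OF r, of x] occ_unique[OF r, of y] by auto
        then show False using right[OF 4(1) dc, of x] above[OF 4(1) dc, of y] 5 by auto
      next
        case 3
        then show False using ne by simp
      qed
    qed
  qed
next
  case (6 x y d)
  have nc: "\<not> co_inversion (A x d) (A x (Suc d)) (A y (Suc d))" using low[of x y d] 6 by blast
  have ne: "A y (Suc d) \<noteq> A x d" "A y (Suc d) \<noteq> A x (Suc d)"
    using inj[of x y "Suc d"] att[of x y d] 6 by auto
  have o: "occ (A x d) d x" "occ (A x (Suc d)) (Suc d) x" "occ (A y (Suc d)) (Suc d) y"
    using 6 unfolding occ_def by auto
  show ?case
  proof
    assume c': "co_inversion (if d \<in> D then swap_entry p (A x d) else A x d)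
       (if Suc d \<in> D then swap_entry p (A x (Suc d)) else A x (Suc d))
       (if Suc d \<in> D then swap_entry p (A y (Suc d)) else A y (Suc d))"
    consider "d \<in> D" "Suc d \<in> D" | "d \<notin> D" "Suc d \<notin> D" | "d \<notin> D" "Suc d \<in> D" | "d \<in> D" "Suc d \<notin> D" by blast
    then show False
    proof cases
      case 1
      note r = Dr[OF 1(1)] Dr[OF 1(2)]
      have c'': "co_inversion (swap_entry p (A x d)) (swap_entry p (A x (Suc d))) (swap_entry p (A y (Suc d)))"
        using c' 1 by simp
      have xr: "x \<noteq> r"
      proof
        assume "x = r"
        then have "A x d = A x (Suc d)" using r unfolding occ_def by simp
        then show False using c'' by simp
      qed
      have nr: "A x d \<noteq> u" "A x (Suc d) \<noteq> u" using xr o r occ_unique by metis+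
      from co_inversion_swap_all[OF c'' nc ne] nr uv
      have "y = r \<and> (occ v d x \<or> occ v (Suc d) x)"
        using o occ_unique[OF r(2), of y] by auto
      then show False
        using left[OF 1(1) _ _, of x] left[OF 1(2) _ _, of x] above[OF 1(1), of x] above[OF 1(2), of x] 6
        by (metis less_asym nat_le_linear)
    next
      case 2
      then show False using c' nc by simp
    next
      case 3
      note dc = left_end[OF 3] and r = Dr[OF 3(2)]
      consider "A x d = p" "A x (Suc d) = p" | "A x (Suc d) = p + 1" "A y (Suc d) = p" | "A x d = p + 1" "A y (Suc d) = p + 1"
        using co_inversion_swap_target_third[of "A x d" p "A x (Suc d)" "A y (Suc d)"] c' 3 nc ne by auto
      then show False
      proof cases
        case 1
        then show False using wait_left[OF 3 dc, of x] o by simp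
      next
        case 2
        then have "y = r \<and> occ v (Suc d) x \<or> x = r \<and> occ v (Suc d) y"
          using uv o occ_unique[OF r, of x] occ_unique[OF r, of y] by auto
        then show False using left[OF 3(2) dc, of x] below[OF 3(2) dc, of y] 6 by auto
      next
        case 3
        then show False using ne by simp
      qed
    next
      case 4
      have "A x d = p + 1 \<and> A x (Suc d) = p + 1"
        using co_inversion_swap_source[of p "A x d" "A x (Suc d)" "A y (Suc d)"] c' 4 nc ne by auto
      then show False using wait_right[OF 4 right_end[OF 4], of x] o by simp
    qed
  qed
qed

lemma raise_key_filling:
  assumes u: "u = p + 1"
  shows "key_filling n a (\<lambda>r d. if d \<in> D then swap_entry p (A r d) else A r d)"
proof -
  have v: "v = p" using uv u by simp
  note Dr = Dr[unfolded u] and below = below[unfolded v] and above = above[unfolded v]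
    and DLb = DLb[unfolded u v] and DRb = DRb[unfolded u v] and cp = cv[unfolded v]
  \<comment> \<open>The longer row \<open>s\<close> must not jump over row \<open>r\<close>, which
    holds \<open>p + 1\<close>, so it reached \<open>p\<close> only from \<open>p\<close>. Tracing
    it back ends in column \<open>c\<close>, where there is no \<open>p\<close>.\<close>
  have stay: False if "d \<in> D" "c \<le> d" "occ p d s" "s < r" "a r < a s" for d s
    using that(2,1,3)
  proof (induction d rule: dec_induct)
    case base
    then show ?case using cp by blast
  next
    case (step d)
    then have d: "d \<in> D" using DR[of "Suc d"] by auto
    have "\<not> co_inversion (A s d) (A s (Suc d)) (A r d)"
      using up[of s r d] that Dr[OF d] step.prems unfolding occ_def by auto
    moreover have "A s (Suc d) = p" "A r d = p + 1" using step.prems Dr[OF d] unfolding occ_def by auto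
    moreover have "A s d \<noteq> p + 1"
      using occ_unique[of "p + 1" d s r] Dr[OF d] step.prems that unfolding occ_def by auto
    ultimately have "A s d = p" using co_inversion_to by blast
    then show ?case using step.IH d step.prems unfolding occ_def by auto
  qed
  \<comment> \<open>Just left of the block such a \<open>p\<close> comes with a
    \<open>p + 1\<close>, which maximality of the run keeps out of row \<open>r\<close> and
    non-attacking puts below it. This is the nest excluded to the left.\<close>
  have La: False if "d \<notin> D" "Suc d \<in> D" "Suc d \<le> c" "r < v" "occ p d v" for d v
  proof -
    have "Ex (occ (p + 1) d)"
      by (rule left_bal[of d v]) (use that bothL[of "Suc d"] in auto)
    then obtain q where q: "occ (p + 1) d q" ..
    have "q \<le> r" using occ_att[OF q Dr[OF that(2)]] .
    moreover have "q \<noteq> r" using DLb[of d v] that q by auto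
    ultimately have qr: "q < r" by simp
    have "a q \<le> a v"
    proof (rule ccontr)
      assume l: "\<not> a q \<le> a v"
      then have "\<not> co_inversion (A q d) (A q (Suc d)) (A v d)"
        using up[of q v d] q that qr unfolding occ_def by auto
      then have "A q (Suc d) = p \<or> A q (Suc d) = p + 1"
        by (rule co_inversion_from) (use q that in \<open>auto simp: occ_def\<close>)
      then have "occ p (Suc d) q \<or> occ (p + 1) (Suc d) q"
        using l q that unfolding occ_def by auto
      then show False using below[of "Suc d" q] that qr Dr[OF that(2)] occ_unique by (metis less_asym less_irrefl)
    qed
    moreover have "Ex (occ p e) \<and> Ex (occ (p + 1) e)" if "d \<le> e" "e < c" for e
      using bothL[of "Suc d" e] that \<open>Suc d \<in> D\<close> q \<open>occ p d v\<close> by (cases "e = d") auto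
    ultimately show False using no_left_nest[of d q v] q that qr by auto
  qed
  \<comment> \<open>A \<open>p + 1\<close> continuing in row \<open>r\<close> past the right end
    calls for a \<open>p\<close> in that column, above row \<open>r\<close> by maximality of the
    run. This is the nest excluded to the right.\<close>
  have Rc: False if "d \<in> D" "Suc d \<notin> D" "c \<le> d" "occ (p + 1) (Suc d) r" for d
  proof -
    have "Ex (occ p (Suc d))"
      by (rule right_bal[of "Suc d" r]) (use that bothR[of d] in auto)
    then obtain s where s: "occ p (Suc d) s" ..
    then have "r \<le> s" using DRb[of d s] that by auto
    moreover have "r \<noteq> s" using occ_value[OF s] that by fastforce
    ultimately have rs: "r < s" by simp
    have "a s < a r"
    proof (rule ccontr)
      assume l: "\<not> a s < a r"
      then have "\<not> co_inversion (A s d) (A s (Suc d)) (A r (Suc d))"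
        using low[of s r d] s that rs unfolding occ_def by auto
      then have "A s d = p \<or> A s d = p + 1"
        by (rule co_inversion_to) (use s that in \<open>auto simp: occ_def\<close>)
      then have "occ p d s \<or> occ (p + 1) d s" using s unfolding occ_def by auto
      then show False using above[of d s] that rs Dr[OF that(1)] occ_unique by (metis less_asym less_irrefl)
    qed
    moreover have "Ex (occ p e) \<and> Ex (occ (p + 1) e)" if "c < e" "e \<le> Suc d" for e
      using bothR[of d e] that \<open>d \<in> D\<close> s \<open>occ (p + 1) (Suc d) r\<close> by (cases "e = Suc d") auto
    ultimately show False using no_right_nest[of "Suc d" r s] s that rs by auto
  qed
  \<comment> \<open>One of the rows \<open>r\<close> and \<open>y\<close> must respect the other:
    either row \<open>r\<close> has to continue with \<open>p\<close> or \<open>p + 1\<close>, or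
    row \<open>y\<close> has to come from one of them. All four possibilities are already
    excluded.\<close>
  have Ra: False if d: "d \<in> D" "Suc d \<notin> D" "c \<le> d" and y: "y < r" "occ p (Suc d) y" for d y
  proof (cases "a y \<le> a r")
    case True
    then have "\<not> co_inversion (A r d) (A r (Suc d)) (A y (Suc d))"
      using low[of r y d] Dr[OF d(1)] y unfolding occ_def by auto
    then have "A r (Suc d) = p \<or> A r (Suc d) = p + 1"
      by (rule co_inversion_from) (use Dr[OF d(1)] y in \<open>auto simp: occ_def\<close>)
    then have "occ p (Suc d) r \<or> occ (p + 1) (Suc d) r"
      using True Dr[OF d(1)] y unfolding occ_def by auto
    then show False using Rc[OF d] occ_unique y by (metis less_irrefl)
  next
    case False
    then have "\<not> co_inversion (A y d) (A y (Suc d)) (A r d)"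
      using up[of y r d] Dr[OF d(1)] y unfolding occ_def by auto
    then have "A y d = p \<or> A y d = p + 1"
      by (rule co_inversion_to) (use Dr[OF d(1)] y in \<open>auto simp: occ_def\<close>)
    then have "occ p d y \<or> occ (p + 1) d y" using y unfolding occ_def by auto
    then show False using stay[of d y] occ_unique[OF Dr[OF d(1)], of y] d y False by auto
  qed
  show ?thesis
  proof (rule swap_key_filling, unfold v)
    show False if "d \<in> D" "c \<le> d" "occ p d x" "x < r" "a r < a x" for d x
      using stay that by blast
    show False if "d \<in> D" "d \<le> c" "occ p d x" "r < x" "a r \<le> a x" for d x
      using no_left_nest[of d r x] bothL[OF that(1)] below[OF that(1-3)] Dr[OF that(1)] that by auto
    show False if "d \<notin> D" "Suc d \<in> D" "Suc d \<le> c" "r < x" "occ p d x" for d x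
      using La that by blast
    show False if "d \<in> D" "Suc d \<notin> D" "c \<le> d" "x < r" "occ p (Suc d) x" for d x
      using Ra that by blast
    show False if "d \<notin> D" "Suc d \<in> D" "Suc d \<le> c" "occ p d x" "occ p (Suc d) x" for d x
      using La[OF that(1-3) _ that(4)] below[OF that(2,3,5)] by blast
    show False if "d \<in> D" "Suc d \<notin> D" "c \<le> d" "occ (p + 1) d x" "occ (p + 1) (Suc d) x" for d x
      using Rc[OF that(1-3)] occ_unique[OF Dr[OF that(1)] that(4)] that(5) by simp
  qed
qed

text \<open>A mirror image of raising: column \<open>c\<close> now lacks \<open>p + 1\<close>, so
  inside the block a row is traced towards \<open>c\<close> from the left, and the nest argument
  takes over on the right.\<close>

lemma lower_key_filling:
  assumes u: "u = p"
  shows "key_filling n a (\<lambda>r d. if d \<in> D then swap_entry p (A r d) else A r d)"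
proof -
  have v: "v = p + 1" using uv u by simp
  note Dr = Dr[unfolded u] and below = below[unfolded v] and above = above[unfolded v]
    and DLb = DLb[unfolded u v] and DRb = DRb[unfolded u v] and cp = cv[unfolded v]
  have stay: False if "d \<in> D" "d \<le> c" "occ (p + 1) d s" "r < s" "a r \<le> a s" for d s
    using that(2,1,3)
  proof (induction d rule: inc_induct)
    case base
    then show ?case using cp by blast
  next
    case (step d)
    then have d: "Suc d \<in> D" using DL[of d] by auto
    have "\<not> co_inversion (A s d) (A s (Suc d)) (A r (Suc d))"
      using low[of s r d] that Dr[OF d] step.prems unfolding occ_def by auto
    then have "A s (Suc d) = p \<or> A s (Suc d) = p + 1"
      by (rule co_inversion_from) (use step.prems Dr[OF d] in \<open>auto simp: occ_def\<close>)
    moreover have "A s (Suc d) \<noteq> p"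
      using occ_unique[of p "Suc d" s r] Dr[OF d] step.prems that unfolding occ_def by auto
    ultimately have "A s (Suc d) = p + 1" by blast
    then show ?case using step.IH d step.prems that(5) Dr[OF d] unfolding occ_def by auto
  qed
  \<comment> \<open>Row \<open>r\<close> cannot arrive from \<open>p\<close>, as the run would then
    extend, nor from \<open>p + 1\<close>, which row \<open>v\<close> holds. So row \<open>v\<close>
    is at least as long and is forced onto \<open>p\<close> or \<open>p + 1\<close> inside the
    block.\<close>
  have Fa: False if "d \<notin> D" "Suc d \<in> D" "Suc d \<le> c" "r < v" "occ (p + 1) d v" for d v
  proof -
    note r = Dr[OF that(2)]
    have ne: "A r d \<noteq> p" using DLb[of d v] that r unfolding occ_def by auto
    have ne': "A r d \<noteq> p + 1" using occ_unique[OF that(5), of r] that r unfolding occ_def by auto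
    have l: "a r \<le> a v"
    proof (rule ccontr)
      assume l: "\<not> a r \<le> a v"
      then have "\<not> co_inversion (A r d) (A r (Suc d)) (A v d)"
        using up[of r v d] r that unfolding occ_def by auto
      then have "A r d = p \<or> A r d = p + 1"
        by (rule co_inversion_to) (use r that in \<open>auto simp: occ_def\<close>)
      then show False using ne ne' by blast
    qed
    then have "\<not> co_inversion (A v d) (A v (Suc d)) (A r (Suc d))"
      using low[of v r d] r that unfolding occ_def by auto
    then have "A v (Suc d) = p \<or> A v (Suc d) = p + 1"
      by (rule co_inversion_from) (use r that in \<open>auto simp: occ_def\<close>)
    then have "occ p (Suc d) v \<or> occ (p + 1) (Suc d) v"
      using l r that unfolding occ_def by auto
    then show False using stay[of "Suc d" v] that l occ_unique[OF r, of v] by auto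
  qed
  have Fc: False if "d \<notin> D" "Suc d \<in> D" "Suc d \<le> c" "occ p d r" for d
  proof -
    have "Ex (occ (p + 1) d)"
      by (rule left_bal[of d r]) (use that bothL[of "Suc d"] in auto)
    then obtain q where q: "occ (p + 1) d q" ..
    then have "q \<le> r" using DLb[of d q] that by auto
    moreover have "q \<noteq> r" using occ_value[OF q] that by fastforce
    ultimately have qr: "q < r" by simp
    have "a q \<le> a r"
    proof (rule ccontr)
      assume l: "\<not> a q \<le> a r"
      then have "\<not> co_inversion (A q d) (A q (Suc d)) (A r d)"
        using up[of q r d] q that qr unfolding occ_def by auto
      then have "A q (Suc d) = p \<or> A q (Suc d) = p + 1"
        by (rule co_inversion_from) (use q that in \<open>auto simp: occ_def\<close>)
      then have "occ p (Suc d) q \<or> occ (p + 1) (Suc d) q"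
        using l q that unfolding occ_def by auto
      then show False using below[of "Suc d" q] that qr occ_unique[OF Dr[OF that(2)], of q] by auto
    qed
    moreover have "Ex (occ p e) \<and> Ex (occ (p + 1) e)" if "d \<le> e" "e < c" for e
      using bothL[of "Suc d" e] that \<open>Suc d \<in> D\<close> q \<open>occ p d r\<close> by (cases "e = d") auto
    ultimately show False using no_left_nest[of d q r] q that qr by auto
  qed
  \<comment> \<open>The \<open>p + 1\<close> below row \<open>r\<close> needs a \<open>p\<close> in
    its column. Maximality of the run and non-attacking place that \<open>p\<close> above row
    \<open>r\<close>, and the nest excluded to the right appears.\<close>
  have Fb: False if d: "d \<in> D" "Suc d \<notin> D" "c \<le> d" and u: "u < r" "occ (p + 1) (Suc d) u" for d u
  proof -
    have nr: "\<not> occ p (Suc d) r" using DRb[of d u] d u by auto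
    have "Ex (occ p (Suc d))"
      by (rule right_bal[of "Suc d" u]) (use d u bothR[of d] in auto)
    then obtain v where v: "occ p (Suc d) v" ..
    have "r \<le> v" using occ_att[OF Dr[OF d(1)] v] .
    then have rv: "r < v" using nr v by (metis le_neq_implies_less)
    have "a v < a u"
    proof (rule ccontr)
      assume l: "\<not> a v < a u"
      then have "\<not> co_inversion (A v d) (A v (Suc d)) (A u (Suc d))"
        using low[of v u d] v u rv unfolding occ_def by auto
      then have "A v d = p \<or> A v d = p + 1"
        by (rule co_inversion_to) (use v u in \<open>auto simp: occ_def\<close>)
      then have "occ p d v \<or> occ (p + 1) d v" using v unfolding occ_def by auto
      then show False using above[of d v] d rv occ_unique[OF Dr[OF d(1)], of v] by auto
    qed
    moreover have "Ex (occ p e) \<and> Ex (occ (p + 1) e)" if "c < e" "e \<le> Suc d" for e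
      using bothR[of d e] that \<open>d \<in> D\<close> v u by (cases "e = Suc d") auto
    ultimately show False using no_right_nest[of "Suc d" u v] u v rv d by auto
  qed
  show ?thesis
  proof (rule swap_key_filling, unfold v)
    show False if "d \<in> D" "c \<le> d" "occ (p + 1) d x" "x < r" "a r < a x" for d x
      using no_right_nest[of d x r] bothR[OF that(1)] above[OF that(1-3)] Dr[OF that(1)] that by auto
    show False if "d \<in> D" "d \<le> c" "occ (p + 1) d x" "r < x" "a r \<le> a x" for d x
      using stay that by blast
    show False if "d \<notin> D" "Suc d \<in> D" "Suc d \<le> c" "r < x" "occ (p + 1) d x" for d x
      using Fa that by blast
    show False if "d \<in> D" "Suc d \<notin> D" "c \<le> d" "x < r" "occ (p + 1) (Suc d) x" for d x
      using Fb that by blast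
    show False if "d \<notin> D" "Suc d \<in> D" "Suc d \<le> c" "occ p d x" "occ p (Suc d) x" for d x
      using Fc[OF that(1-3)] occ_unique[OF Dr[OF that(2)] that(5)] that(4) by simp
    show False if "d \<in> D" "Suc d \<notin> D" "c \<le> d" "occ (p + 1) d x" "occ (p + 1) (Suc d) x" for d x
      using Fb[OF that(1-3) _ that(5)] above[OF that(1,3,4)] by blast
  qed
qed

end

section \<open>Column sets determine the tabloid\<close>

text \<open>Let row \<open>i\<close> be longer than row \<open>i + 1\<close>. Exchanging the two lengths turns a tabloid into one with
  the same column sets, in which the new short row follows the old long one at column \<open>c\<close> exactly if
  \<^term>\<open>crossed i A c\<close>: a step of the old short row over the other one, which is forbidden to
  the new long row, toggles this state.\<close>

primrec crossed :: "nat \<Rightarrow> (nat \<Rightarrow> nat \<Rightarrow> nat) \<Rightarrow> nat \<Rightarrow> bool" where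
  "crossed i A 0 = True"
| "crossed i A (Suc c) =
     (if crossed i A c then \<not> co_inversion (A (Suc i) c) (A (Suc i) (Suc c)) (A i (Suc c))
      else A (Suc i) (Suc c) = A i c \<or> co_inversion (A i c) (A i (Suc c)) (A (Suc i) (Suc c)))"

definition exchange_rows :: "(nat \<Rightarrow> nat) \<Rightarrow> nat \<Rightarrow> (nat \<Rightarrow> nat \<Rightarrow> nat) \<Rightarrow> nat \<Rightarrow> nat \<Rightarrow> nat" where
  "exchange_rows a i A r c =
     (if r = i then (if crossed i A c then A i c else A (Suc i) c)
      else if r = Suc i then (if c \<le> a (Suc i) \<and> crossed i A c then A (Suc i) c else A i c)
      else A r c)"

text \<open>\<open>px\<close>, \<open>qx\<close> are the positions of the long row before and after
  its step, \<open>py\<close>, \<open>qy\<close> those of the short row, and \<open>z\<close> is a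
  third particle. The lemmas decide which arcs and which moves with exchanged targets stay free of
  \<open>z\<close>.\<close>

context
  fixes px py qx qy z :: nat
  assumes d: "px \<noteq> py" "py \<noteq> qx" "z \<noteq> px" "z \<noteq> py" "z \<noteq> qx"
    and x: "\<not> co_inversion px qx py"
begin

lemma arc_before_second: "\<not> co_inversion px qx z \<Longrightarrow> \<not> co_inversion py px z \<Longrightarrow> \<not> co_inversion py qx z"
  using d x [[smt_nat_as_int]] unfolding co_inversion_def by (smt (verit))

lemma arc_stays_crossed:
  assumes "qx \<noteq> qy" "z \<noteq> qy" "\<not> co_inversion px qx z" "\<not> co_inversion py px z" "\<not> co_inversion py qy qx"
  shows "\<not> co_inversion qy qx z" "\<not> co_inversion py qy z"
  using d x assms [[smt_nat_as_int]] unfolding co_inversion_def by (smt (verit))+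

lemma arc_becomes_crossed:
  assumes "qx \<noteq> qy" "z \<noteq> qy" "\<not> co_inversion px qx z" "qy = px \<or> co_inversion px qx qy"
  shows "\<not> co_inversion qy qx z" "\<not> co_inversion px qy z"
  using d x assms [[smt_nat_as_int]] unfolding co_inversion_def by (smt (verit))+

lemma mover_uncrossing:
  assumes "qx \<noteq> qy" "z \<noteq> qy" "\<not> co_inversion px qx z" "\<not> co_inversion py qy z" "co_inversion py qy qx"
  shows "\<not> co_inversion px qy z" "\<not> co_inversion py qx z"
  using d x assms [[smt_nat_as_int]] unfolding co_inversion_def by (smt (verit))+

lemma mover_crossing:
  assumes "qx \<noteq> qy" "z \<noteq> qy" "\<not> co_inversion px qx z" "\<not> co_inversion py qy z"
    "qy = px \<or> co_inversion px qx qy"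
  shows "\<not> co_inversion px qy z" "\<not> co_inversion py qx z"
  using d x assms [[smt_nat_as_int]] unfolding co_inversion_def by (smt (verit))+

end

text \<open>All motion is downwards, so a particle outside the arc from \<open>y\<close> down to
  \<open>x\<close> could enter the arc or pass \<open>x\<close> only by first passing
  \<open>y\<close>.\<close>

lemma arc_not_entered:
  fixes x y z z' :: nat
  assumes "x \<noteq> y" "z \<noteq> x" "z \<noteq> y" "z' \<noteq> x" "z' \<noteq> y" "\<not> co_inversion z z' y" "\<not> co_inversion y x z"
  shows "\<not> co_inversion y x z'" "\<not> co_inversion z z' x"
  using assms [[smt_nat_as_int]] unfolding co_inversion_def by (smt (verit))+

text \<open>The long row stays within the arc from \<open>px\<close> down to \<open>py\<close>, so
  whoever moves from \<open>py\<close> down to \<open>qx\<close> comes through \<open>px\<close>.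
  This makes the crossing state visible in the exchanged filling.\<close>

lemma reaches_start:
  "px \<noteq> py \<Longrightarrow> py \<noteq> qx \<Longrightarrow> \<not> co_inversion px qx py \<Longrightarrow> qx = px \<or> co_inversion py qx px"
  by (auto simp: co_inversion_def)

lemma co_inversion_asym: "co_inversion x y z \<Longrightarrow> \<not> co_inversion x z y"
  by (auto simp: co_inversion_def)

lemma co_inversion_distinct: "co_inversion x y z \<Longrightarrow> x \<noteq> y \<and> x \<noteq> z \<and> y \<noteq> z"
  by (auto simp: co_inversion_def)

locale descent_filling = key_filling +
  fixes i :: nat
  assumes i: "1 \<le> i" "Suc i \<le> n" and desc: "a (Suc i) < a i"
begin

abbreviation "X c \<equiv> A i c"
abbreviation "Y c \<equiv> A (Suc i) c"
abbreviation "k \<equiv> a (Suc i)"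
abbreviation "Y' c \<equiv> exchange_rows a i A i c"
abbreviation "X' c \<equiv> exchange_rows a i A (Suc i) c"
abbreviation "b \<equiv> a(i := a (Suc i), Suc i := a i)"

text \<open>The position of row \<open>z\<close> at the moment when rows \<open>i\<close> and \<open>i + 1\<close> leave column \<open>c\<close>. Only the rows
  that are removed between these two rows see a difference after the exchange.\<close>

definition Z :: "nat \<Rightarrow> nat \<Rightarrow> nat" where
  "Z z c = (if z < i then A z (Suc c) else A z c)"

text \<open>Shorter rows are removed first, and among equal lengths the lower row; the strict and
  weak bounds encode this tie rule.\<close>

definition between :: "nat \<Rightarrow> bool" where
  "between z \<longleftrightarrow> z \<in> {1..n} \<and> (z < i \<and> k < a z \<and> a z \<le> a i \<or> Suc i < z \<and> k \<le> a z \<and> a z < a i)"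

lemma pair_facts:
  assumes "c \<le> k"
  shows "X c \<noteq> Y c" "Y c \<noteq> X (Suc c)" "\<not> co_inversion (X c) (X (Suc c)) (Y c)"
  using assms desc i inj[of i "Suc i" c] att[of "Suc i" i c] up[of i "Suc i" c] by auto

lemma between_facts:
  assumes "between z" "c \<le> k"
  shows "Z z c \<noteq> X c" "Z z c \<noteq> Y c" "Z z c \<noteq> X (Suc c)" "\<not> co_inversion (X c) (X (Suc c)) (Z z c)"
    and "Suc c \<le> k \<Longrightarrow> Z z c \<noteq> Y (Suc c)"
    and "Suc c \<le> k \<Longrightarrow> \<not> co_inversion (Z z c) (Z z (Suc c)) (Y (Suc c))"
  subgoal using assms desc i att[of i z c] inj[of z i c] unfolding Z_def between_def by auto
  subgoal using assms desc i att[of "Suc i" z c] inj[of z "Suc i" c] unfolding Z_def between_def by auto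
  subgoal using assms desc i inj[of z i "Suc c"] att[of z i c] unfolding Z_def between_def by auto
  subgoal using assms desc i low[of i z c] up[of i z c] unfolding Z_def between_def by auto
  subgoal using assms desc i inj[of z "Suc i" "Suc c"] att[of z "Suc i" c] unfolding Z_def between_def by auto
  subgoal using assms desc i up[of z "Suc i" "Suc c"] low[of z "Suc i" c] unfolding Z_def between_def by auto
  done

lemma arc_free_step:
  assumes "between z" "Suc c \<le> k" "crossed i A c \<Longrightarrow> \<not> co_inversion (Y c) (X c) (Z z c)"
    and "crossed i A (Suc c)"
  shows "\<not> co_inversion (Y (Suc c)) (X (Suc c)) (Z z c)"
proof -
  note f = pair_facts[of c] pair_facts(1)[of "Suc c"] between_facts[OF assms(1), of c]
  show ?thesis
  proof (cases "crossed i A c")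
    case True
    then show ?thesis
      using arc_stays_crossed(1)[of "X c" "Y c" "X (Suc c)" "Z z c" "Y (Suc c)"] f assms by simp
  next
    case False
    then show ?thesis
      using arc_becomes_crossed(1)[of "X c" "Y c" "X (Suc c)" "Z z c" "Y (Suc c)"] f assms by simp
  qed
qed

text \<open>This is the invariant behind the exchange. It starts from the neighbours
  \<open>i + 1\<close> and \<open>i\<close>, with nothing between them; the circle facts preserve or
  restore it when rows \<open>i\<close> and \<open>i + 1\<close> step, and the later step of row
  \<open>z\<close> cannot enter the arc.\<close>

lemma arc_free:
  assumes "between z" "c \<le> k" "crossed i A c"
  shows "\<not> co_inversion (Y c) (X c) (Z z c)"
  using assms(2,3)
proof (induction c)
  case 0
  then show ?case using base i by (auto simp: co_inversion_def)
next
  case (Suc c)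
  have "\<not> co_inversion (Y (Suc c)) (X (Suc c)) (Z z c)"
    using arc_free_step[OF assms(1), of c] Suc by auto
  then show ?case
    using arc_not_entered(1)[of "X (Suc c)" "Y (Suc c)" "Z z c" "Z z (Suc c)"]
      Suc.prems pair_facts(1)[of "Suc c"] between_facts[OF assms(1), of c] between_facts(1,2)[OF assms(1), of "Suc c"]
    by simp
qed

lemma arc_free_before:
  assumes "between z" "Suc c \<le> k" "crossed i A (Suc c)"
  shows "\<not> co_inversion (Y (Suc c)) (X (Suc c)) (Z z c)"
  using arc_free_step[OF assms(1,2) _ assms(3)] arc_free[OF assms(1), of c] assms(2) by auto

lemma crossing_cases:
  assumes "Suc c \<le> k"
  obtains
    (stays_crossed) "Y' c = X c" "X' c = Y c" "Y' (Suc c) = X (Suc c)" "X' (Suc c) = Y (Suc c)"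
      "\<not> co_inversion (Y c) (Y (Suc c)) (X (Suc c))" "crossed i A c"
  | (uncrosses) "Y' c = X c" "X' c = Y c" "Y' (Suc c) = Y (Suc c)" "X' (Suc c) = X (Suc c)"
      "co_inversion (Y c) (Y (Suc c)) (X (Suc c))" "crossed i A c"
  | (stays_uncrossed) "Y' c = Y c" "X' c = X c" "Y' (Suc c) = Y (Suc c)" "X' (Suc c) = X (Suc c)"
      "Y (Suc c) \<noteq> X c" "\<not> co_inversion (X c) (X (Suc c)) (Y (Suc c))"
  | (crosses) "Y' c = Y c" "X' c = X c" "Y' (Suc c) = X (Suc c)" "X' (Suc c) = Y (Suc c)"
      "Y (Suc c) = X c \<or> co_inversion (X c) (X (Suc c)) (Y (Suc c))"
proof (cases "crossed i A c")
  case True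
  then show ?thesis using that(1,2) assms by (cases "crossed i A (Suc c)") (simp_all add: exchange_rows_def)
next
  case False
  then show ?thesis using that(3,4) assms by (cases "crossed i A (Suc c)") (simp_all add: exchange_rows_def)
qed

text \<open>After the exchange the long row lies above the short one and must respect it. Crossing
  is defined so that a step violating this is redirected by exchanging the targets.\<close>

lemma exchange_pair:
  assumes "Suc c \<le> k"
  shows "X' c \<noteq> Y' (Suc c)" "\<not> co_inversion (X' c) (X' (Suc c)) (Y' (Suc c))"
proof -
  have f: "X c \<noteq> Y c" "Y c \<noteq> X (Suc c)" "X (Suc c) \<noteq> Y (Suc c)"
    using assms pair_facts[of c] pair_facts(1)[of "Suc c"] by auto
  from assms have "X' c \<noteq> Y' (Suc c) \<and> \<not> co_inversion (X' c) (X' (Suc c)) (Y' (Suc c))"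
  proof (cases rule: crossing_cases)
    case stays_crossed
    then show ?thesis using f by simp
  next
    case uncrosses
    then show ?thesis using co_inversion_asym co_inversion_distinct by metis
  next
    case stays_uncrossed
    then show ?thesis by simp
  next
    case crosses
    then show ?thesis using f co_inversion_asym co_inversion_distinct co_inversion_same by metis
  qed
  then show "X' c \<noteq> Y' (Suc c)" "\<not> co_inversion (X' c) (X' (Suc c)) (Y' (Suc c))" by auto
qed

text \<open>Here \<open>z\<close> is respected by both rows. Targets are exchanged only when one
  path runs up to or over the target of the other, and then the two new paths together cover no more
  of the circle than the old ones.\<close>

lemma exchange_mover:
  assumes "Suc c \<le> k" "z \<noteq> X (Suc c)" "z \<noteq> Y (Suc c)"
    and "z \<noteq> X c" "z \<noteq> Y c" "\<not> co_inversion (X c) (X (Suc c)) z" "\<not> co_inversion (Y c) (Y (Suc c)) z"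
  shows "\<not> co_inversion (Y' c) (Y' (Suc c)) z" "\<not> co_inversion (X' c) (X' (Suc c)) z"
proof -
  have f: "X c \<noteq> Y c" "Y c \<noteq> X (Suc c)" "\<not> co_inversion (X c) (X (Suc c)) (Y c)" "X (Suc c) \<noteq> Y (Suc c)"
    using assms pair_facts[of c] pair_facts(1)[of "Suc c"] by auto
  note u = mover_uncrossing[OF f(1,2) assms(4,5,2) f(3,4) assms(3,6,7)]
  note v = mover_crossing[OF f(1,2) assms(4,5,2) f(3,4) assms(3,6,7)]
  from assms(1) have "\<not> co_inversion (Y' c) (Y' (Suc c)) z \<and> \<not> co_inversion (X' c) (X' (Suc c)) z"
  proof (cases rule: crossing_cases)
    case uncrosses
    then show ?thesis using u by simp
  next
    case crosses
    then show ?thesis using v by presburger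
  qed (use assms in auto)
  then show "\<not> co_inversion (Y' c) (Y' (Suc c)) z" "\<not> co_inversion (X' c) (X' (Suc c)) z" by auto
qed

text \<open>The new long row must respect the rows in between even where it follows the old short
  row, which had no such obligation; the empty arc of \<open>arc_free\<close> makes up for
  it.\<close>

lemma exchange_mover_between:
  assumes "between z" "c \<le> k"
  shows "\<not> co_inversion (X' c) (X' (Suc c)) (Z z c)"
proof -
  note f = pair_facts(1,2)[OF assms(2)] between_facts(1,2,3)[OF assms] pair_facts(3)[OF assms(2)]
  note g = between_facts(4)[OF assms]
  note w = arc_before_second[OF f g arc_free[OF assms]]
  show ?thesis
  proof (cases "Suc c \<le> k")
    case False
    then show ?thesis using assms(2) w g by (simp add: exchange_rows_def)
  next
    case True
    have h: "X (Suc c) \<noteq> Y (Suc c)" "Z z c \<noteq> Y (Suc c)"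
      using True pair_facts(1)[of "Suc c"] between_facts(5)[OF assms] by auto
    note u = arc_stays_crossed(2)[OF f h g arc_free[OF assms]]
    note v = arc_becomes_crossed(2)[OF f h g]
    from True show ?thesis
    proof (cases rule: crossing_cases)
      case stays_crossed
      then show ?thesis using u by simp
    next
      case uncrosses
      then show ?thesis using w by simp
    next
      case stays_uncrossed
      then show ?thesis using g by simp
    next
      case crosses
      then show ?thesis using v by presburger
    qed
  qed
qed

text \<open>The rows in between had to respect the old short row only. Where the new short row sits
  on the old long one, passing it from outside the arc would mean passing the old short row
  first.\<close>

lemma exchange_target_between:
  assumes "between z" "Suc c \<le> k"
  shows "\<not> co_inversion (Z z c) (Z z (Suc c)) (Y' (Suc c))"
  using arc_not_entered(2)[of "X (Suc c)" "Y (Suc c)" "Z z c" "Z z (Suc c)"]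
    pair_facts(1)[of "Suc c"] between_facts[OF assms(1), of c] between_facts(1,2)[OF assms(1), of "Suc c"]
    arc_free_before[OF assms] assms(2)
  unfolding exchange_rows_def by simp

lemma exchange_after: "k < c \<Longrightarrow> X' c = X c"
  by (auto simp: exchange_rows_def)

lemma exchange_other: "r \<noteq> i \<Longrightarrow> r \<noteq> Suc i \<Longrightarrow> exchange_rows a i A r c = A r c"
  by (simp add: exchange_rows_def)

text \<open>An entry larger than \<open>z\<close> would repeat the basement entry of a higher row,
  which attacks the first cell of row \<open>z\<close>.\<close>

lemma first_column_le: "z \<in> {1..n} \<Longrightarrow> 1 \<le> a z \<Longrightarrow> A z 1 \<le> z"
  using att[of "A z 1" z 0] range[of z 1] base[of "A z 1"] by fastforce

declare crossed.simps(2) [simp del]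

lemma exchange_mover_above:
  assumes "s \<in> {1..n}" "Suc i < s" "a s < k" "c \<le> a s"
  shows "\<not> co_inversion (Y' c) (Y' (Suc c)) (A s c)" "\<not> co_inversion (X' c) (X' (Suc c)) (A s c)"
proof -
  have "A s c \<noteq> X c" "A s c \<noteq> Y c" using inj[of s i c] inj[of s "Suc i" c] assms i desc by auto
  moreover have "A s c \<noteq> X (Suc c)" "A s c \<noteq> Y (Suc c)"
    using att[of s i c] att[of s "Suc i" c] assms i desc by auto
  moreover have "\<not> co_inversion (X c) (X (Suc c)) (A s c)" "\<not> co_inversion (Y c) (Y (Suc c)) (A s c)"
    using up[of i s c] up[of "Suc i" s c] assms i desc by auto
  ultimately show "\<not> co_inversion (Y' c) (Y' (Suc c)) (A s c)" "\<not> co_inversion (X' c) (X' (Suc c)) (A s c)"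
    using exchange_mover[of c "A s c"] assms by auto
qed

lemma exchange_mover_below:
  assumes "s \<in> {1..n}" "s < i" "a s \<le> k" "Suc c \<le> a s"
  shows "\<not> co_inversion (Y' c) (Y' (Suc c)) (A s (Suc c))" "\<not> co_inversion (X' c) (X' (Suc c)) (A s (Suc c))"
proof -
  have "A s (Suc c) \<noteq> X (Suc c)" "A s (Suc c) \<noteq> Y (Suc c)"
    using inj[of s i "Suc c"] inj[of s "Suc i" "Suc c"] assms i desc by auto
  moreover have "A s (Suc c) \<noteq> X c" "A s (Suc c) \<noteq> Y c"
    using att[of i s c] att[of "Suc i" s c] assms i desc by auto
  moreover have "\<not> co_inversion (X c) (X (Suc c)) (A s (Suc c))" "\<not> co_inversion (Y c) (Y (Suc c)) (A s (Suc c))"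
    using low[of i s c] low[of "Suc i" s c] assms i desc by auto
  ultimately show "\<not> co_inversion (Y' c) (Y' (Suc c)) (A s (Suc c))" "\<not> co_inversion (X' c) (X' (Suc c)) (A s (Suc c))"
    using exchange_mover[of c "A s (Suc c)"] assms by auto
qed

lemma exchange_key_filling: "key_filling n b (exchange_rows a i A)"
proof (unfold_locales, goal_cases)
  case (1 r)
  then show ?case using base i by (auto simp: exchange_rows_def)
next
  case (2 r c)
  then show ?case using range i desc by (auto simp: exchange_rows_def split: if_splits)
next
  case (3 r s c)
  \<comment> \<open>\<open>\<sigma> x\<close> is the old row that the new row \<open>x\<close>
    follows in column \<open>c\<close>.\<close>
  define \<sigma> where "\<sigma> x = (if x = i then (if crossed i A c then i else Suc i)
    else if x = Suc i then (if c \<le> k \<and> crossed i A c then Suc i else i) else x)" for x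
  have \<sigma>: "\<sigma> x \<in> {1..n} \<and> c \<le> a (\<sigma> x) \<and> exchange_rows a i A x c = A (\<sigma> x) c"
    if "x \<in> {1..n}" "c \<le> b x" for x
    using that i desc by (auto simp: exchange_rows_def \<sigma>_def split: if_splits)
  have "\<sigma> r = \<sigma> s" using inj[of "\<sigma> r" "\<sigma> s" c] \<sigma>[of r] \<sigma>[of s] 3 by simp
  moreover have "c \<le> k" if "r = i \<or> s = i" using that 3 by auto
  ultimately show ?case by (auto simp: \<sigma>_def split: if_splits)
next
  case (4 r s c)
  consider "r = Suc i" "s = i" | "r = Suc i" "s < i" | "r = i" "s < i" | "s = i" "Suc i < r" | "s = Suc i" "Suc i < r"
    | "r \<noteq> i" "r \<noteq> Suc i" "s \<noteq> i" "s \<noteq> Suc i"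
    using \<open>s < r\<close> by linarith
  then show ?case
  proof cases
    case 1
    then show ?thesis using exchange_pair(1)[of c] 4 by simp
  next
    case 2
    then show ?thesis
      using 4 i desc att[of i s c] att[of "Suc i" s c] by (auto simp: exchange_rows_def)
  next
    case 3
    then show ?thesis
      using 4 i desc att[of i s c] att[of "Suc i" s c] by (auto simp: exchange_rows_def)
  next
    case 4
    then show ?thesis
      using \<open>r \<in> _\<close> \<open>c \<le> b r\<close> \<open>Suc c \<le> b s\<close> i desc att[of r i c] att[of r "Suc i" c] by (auto simp: exchange_rows_def)
  next
    case 5
    then show ?thesis
      using 4 i desc att[of r i c] att[of r "Suc i" c] by (auto simp: exchange_rows_def)
  next
    case 6
    then show ?thesis using 4 att[of r s c] by (simp add: exchange_other)
  qed
next
  case (5 r s c)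
  note p = \<open>r \<in> _\<close> \<open>s \<in> _\<close> \<open>r < s\<close> \<open>b s < b r\<close> \<open>c \<le> b s\<close>
  consider "r = i" "s = Suc i" | "r = i" "Suc i < s" | "r = Suc i" "Suc i < s" | "s = i" "r < i" | "s = Suc i" "r < i"
    | "r \<noteq> i" "r \<noteq> Suc i" "s \<noteq> i" "s \<noteq> Suc i"
    using \<open>r < s\<close> by linarith
  then show ?case
  proof cases
    case 1
    then show ?thesis using p desc by simp
  next
    case 2
    then have "a s < k" "c \<le> a s" "Suc c \<le> k" using p by auto
    then show ?thesis
      using exchange_mover_above(1)[of s c] 2 p by (simp add: exchange_other)
  next
    case 3
    then have s: "a s < a i" "c \<le> a s" using p by auto
    show ?thesis
    proof (cases "a s < k")
      case True
      then show ?thesis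
        using exchange_mover_above(2)[of s c] 3 p s by (simp add: exchange_other)
    next
      case False
      then have "between s" "A s c = Z s c" using 3 p s unfolding between_def Z_def by auto
      then show ?thesis
        using exchange_mover_between[of s c] 3 s up[of i s c] p i exchange_after[of c] exchange_after[of "Suc c"]
        by (cases "c \<le> k") (auto simp: exchange_other)
    qed
  next
    case 4
    then have s: "k < a r" "c \<le> k" using p by auto
    show ?thesis
    proof (cases "a i < a r")
      case True
      then show ?thesis
        using up[of r i c] up[of r "Suc i" c] 4 p i s desc by (auto simp: exchange_rows_def)
    next
      case False
      then have b: "between r" using 4 s p unfolding between_def by auto
      show ?thesis
      \<comment> \<open>The arc argument looks at the preceding column and so says nothing about
        column 0. There row \<open>r\<close> goes from \<open>r < i\<close> to an entry that is at
        most \<open>r\<close>, which does not pass \<open>i\<close>.\<close>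
      proof (cases c)
        case 0
        then have "exchange_rows a i A s c = i" using 4 i base by (simp add: exchange_rows_def)
        moreover have "A r 1 \<le> r" using first_column_le[of r] p s by simp
        ultimately show ?thesis using 0 4 p base by (auto simp: exchange_other co_inversion_def)
      next
        case (Suc e)
        then show ?thesis
          using exchange_target_between[OF b, of e] s 4 by (simp add: exchange_other Z_def)
      qed
    qed
  next
    case 5
    then have "a i < a r" "c \<le> a i" using p by auto
    then show ?thesis
      using up[of r i c] up[of r "Suc i" c] 5 p i desc by (auto simp: exchange_rows_def)
  next
    case 6
    then show ?thesis using p up[of r s c] by (simp add: exchange_other)
  qed
next
  case (6 r s c)
  note p = \<open>r \<in> _\<close> \<open>s \<in> _\<close> \<open>s < r\<close> \<open>b s \<le> b r\<close> \<open>Suc c \<le> b s\<close>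
  consider "r = Suc i" "s = i" | "r = i" "s < i" | "r = Suc i" "s < i" | "s = i" "Suc i < r" | "s = Suc i" "Suc i < r"
    | "r \<noteq> i" "r \<noteq> Suc i" "s \<noteq> i" "s \<noteq> Suc i"
    using \<open>s < r\<close> by linarith
  then show ?case
  proof cases
    case 1
    then show ?thesis using exchange_pair(2)[of c] p by simp
  next
    case 2
    then have "a s \<le> k" "Suc c \<le> a s" "Suc c \<le> k" using p by auto
    then show ?thesis
      using exchange_mover_below(1)[of s c] 2 p by (simp add: exchange_other)
  next
    case 3
    then have s: "a s \<le> a i" "Suc c \<le> a s" using p by auto
    show ?thesis
    proof (cases "a s \<le> k")
      case True
      then show ?thesis
        using exchange_mover_below(2)[of s c] 3 p s by (simp add: exchange_other)
    next
      case False
      then have "between s" "A s (Suc c) = Z s c" using 3 p s unfolding between_def Z_def by auto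
      then show ?thesis
        using exchange_mover_between[of s c] 3 s low[of i s c] p i exchange_after[of c] exchange_after[of "Suc c"]
        by (cases "c \<le> k") (auto simp: exchange_other)
    qed
  next
    case 4
    then have s: "k \<le> a r" "Suc c \<le> k" using p by auto
    show ?thesis
    proof (cases "a i \<le> a r")
      case True
      then show ?thesis
        using low[of r i c] low[of r "Suc i" c] 4 p i s desc
        by (auto simp: exchange_rows_def)
    next
      case False
      then have b: "between r" using 4 s p unfolding between_def by auto
      then show ?thesis
        using exchange_target_between[OF b, of c] s 4 by (simp add: exchange_other Z_def)
    qed
  next
    case 5
    then have "a i \<le> a r" "Suc c \<le> a i" using p by auto
    then show ?thesis
      using low[of r i c] low[of r "Suc i" c] 5 p i desc
      by (auto simp: exchange_rows_def)
  next
    case 6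
    then show ?thesis using p low[of r s c] by (simp add: exchange_other)
  qed
qed

text \<open>A long row never passes the shorter row above it, so a path in the exchanged filling that does
  pass the other row betrays whether the two rows had been interchanged.\<close>

lemma crossed_decode_last:
  "crossed i A k \<longleftrightarrow> X' (Suc k) = Y' k \<or> co_inversion (X' k) (X' (Suc k)) (Y' k)"
  using pair_facts[of k] reaches_start[of "X k" "Y k" "X (Suc k)"] unfolding exchange_rows_def by simp

lemma crossed_decode_uncrossed:
  assumes "Suc c \<le> k" "\<not> crossed i A (Suc c)"
  shows "crossed i A c \<longleftrightarrow> X' (Suc c) = Y' c \<or> co_inversion (X' c) (X' (Suc c)) (Y' c)"
  using pair_facts[of c] reaches_start[of "X c" "Y c" "X (Suc c)"] assms unfolding exchange_rows_def by simp

lemma crossed_decode_crossed: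
  assumes "Suc c \<le> k" "crossed i A (Suc c)"
  shows "crossed i A c \<longleftrightarrow> \<not> (Y' (Suc c) = X' c \<or> co_inversion (Y' c) (Y' (Suc c)) (X' c))"
  using pair_facts[of c] reaches_start[of "X c" "Y c" "X (Suc c)"] assms unfolding exchange_rows_def by simp

end

definition column_set :: "nat \<Rightarrow> (nat \<Rightarrow> nat) \<Rightarrow> (nat \<Rightarrow> nat \<Rightarrow> nat) \<Rightarrow> nat \<Rightarrow> nat set" where
  "column_set n a A c = (\<lambda>r. A r c) ` {r \<in> {1..n}. c \<le> a r}"

lemma (in descent_filling) column_set_exchange:
  "column_set n b (exchange_rows a i A) c = column_set n a A c"
proof
  show "column_set n b (exchange_rows a i A) c \<subseteq> column_set n a A c"
  proof
    fix v assume "v \<in> column_set n b (exchange_rows a i A) c"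
    then obtain r where r: "r \<in> {1..n}" "c \<le> b r" "v = exchange_rows a i A r c"
      unfolding column_set_def by auto
    define s where "s = (if r = i then (if crossed i A c then i else Suc i)
      else if r = Suc i then (if c \<le> k \<and> crossed i A c then Suc i else i) else r)"
    have "s \<in> {1..n} \<and> c \<le> a s \<and> v = A s c"
      using r i desc by (auto simp: s_def exchange_rows_def split: if_splits)
    then show "v \<in> column_set n a A c" unfolding column_set_def by blast
  qed
  show "column_set n a A c \<subseteq> column_set n b (exchange_rows a i A) c"
  proof
    fix v assume "v \<in> column_set n a A c"
    then obtain r where r: "r \<in> {1..n}" "c \<le> a r" "v = A r c"
      unfolding column_set_def by auto
    define s where "s = (if r = i \<and> \<not> (c \<le> k \<and> crossed i A c) then Suc i
      else if r = Suc i \<and> \<not> crossed i A c then i else r)"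
    have "s \<in> {1..n} \<and> c \<le> b s \<and> v = exchange_rows a i A s c"
      using r i desc by (auto simp: s_def exchange_rows_def)
    then show "v \<in> column_set n b (exchange_rows a i A) c" unfolding column_set_def by blast
  qed
qed

lemma exchange_rows_inject:
  assumes A: "descent_filling n a A i" "descent_filling n a A' i"
    and eq: "\<And>r c. r \<in> {1..n} \<Longrightarrow> c \<le> (a(i := a (Suc i), Suc i := a i)) r \<Longrightarrow> exchange_rows a i A r c = exchange_rows a i A' r c"
    and r: "r \<in> {1..n}" "c \<le> a r"
  shows "A r c = A' r c"
proof -
  interpret A: descent_filling n a A i by fact
  interpret A': descent_filling n a A' i by fact
  let ?k = "a (Suc i)"
  note i = A.i A.desc
  have eqi: "exchange_rows a i A i c = exchange_rows a i A' i c" if "c \<le> ?k" for c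
    using eq[of i c] that i by simp
  have eqs: "exchange_rows a i A (Suc i) c = exchange_rows a i A' (Suc i) c" if "c \<le> a i" for c
    using eq[of "Suc i" c] that i by simp
  \<comment> \<open>The states are recovered from right to left: after column \<open>k\<close> only
    the long row goes on, which shows the last state, and each earlier one follows from the next
    state and the visible moves.\<close>
  have crossed: "crossed i A c = crossed i A' c" if "c \<le> ?k" for c
    using that
  proof (induction c rule: inc_induct)
    case base
    show ?case
      unfolding A.crossed_decode_last A'.crossed_decode_last using eqi[of ?k] eqs[of ?k] eqs[of "Suc ?k"] i by simp
  next
    case (step c)
    have c: "Suc c \<le> ?k" using step by simp
    note e = eqi[of c] eqi[of "Suc c"] eqs[of c] eqs[of "Suc c"]
    show ?case
    proof (cases "crossed i A (Suc c)")
      case True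
      then show ?thesis
        using A.crossed_decode_crossed[OF c] A'.crossed_decode_crossed[OF c] step.IH e c i by simp
    next
      case False
      then show ?thesis
        using A.crossed_decode_uncrossed[OF c] A'.crossed_decode_uncrossed[OF c] step.IH e c i by simp
    qed
  qed
  consider "r = i" "c \<le> ?k" | "r = i" "?k < c" | "r = Suc i" | "r \<noteq> i" "r \<noteq> Suc i" by linarith
  then show ?thesis
  proof cases
    case 1
    then show ?thesis
      using crossed[of c] eqi[of c] eqs[of c] i by (cases "crossed i A c") (simp_all add: exchange_rows_def)
  next
    case 2
    then show ?thesis using eqs[of c] r by (simp add: exchange_rows_def)
  next
    case 3
    then show ?thesis
      using crossed[of c] eqi[of c] eqs[of c] i r by (cases "crossed i A c") (simp_all add: exchange_rows_def)
  next
    case 4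
    then show ?thesis using eq[of r c] r by (simp add: exchange_rows_def)
  qed
qed

section \<open>Uniqueness of fillings with given column sets\<close>

lemma nearest_unique:
  fixes l u v :: nat
  assumes "\<not> co_inversion l u v" "\<not> co_inversion l v u" "u \<noteq> l" "v \<noteq> l"
  shows "u = v"
  using assms by (auto simp: co_inversion_def)

text \<open>For weakly increasing lengths every row must respect all lower rows. Going from the top
  row down, each row therefore moves to the first entry it meets among those that the higher rows
  leave over.\<close>

lemma sorted_filling_unique:
  assumes A: "key_filling n a A" "key_filling n a A'"
    and sorted: "\<And>r s. r \<in> {1..n} \<Longrightarrow> s \<in> {1..n} \<Longrightarrow> r \<le> s \<Longrightarrow> a r \<le> a s"
    and col: "\<And>c. column_set n a A c = column_set n a A' c"
    and r: "r \<in> {1..n}" "c \<le> a r"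
  shows "A r c = A' r c"
  using r
proof (induction c arbitrary: r)
  case 0
  then show ?case using A key_filling.base by metis
next
  case (Suc c)
  from Suc.prems show ?case
  proof (induction "n - r" arbitrary: r rule: less_induct)
    case less
    have one_sided: "\<not> co_inversion (B r c) (B' r (Suc c)) (B r (Suc c)) \<and> B r (Suc c) \<noteq> B r c"
      if B: "key_filling n a B" "key_filling n a B'" and colB: "\<And>c. column_set n a B c = column_set n a B' c"
        and agree: "B r c = B' r c" "\<And>s. s \<in> {1..n} \<Longrightarrow> r < s \<Longrightarrow> Suc c \<le> a s \<Longrightarrow> B s (Suc c) = B' s (Suc c)"
        and ne: "B r (Suc c) \<noteq> B' r (Suc c)" for B B'
    proof -
      interpret B: key_filling n a B by fact
      interpret B': key_filling n a B' by fact
      have "B r (Suc c) \<in> column_set n a B (Suc c)" using less.prems unfolding column_set_def by auto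
      then have "B r (Suc c) \<in> column_set n a B' (Suc c)" using colB by simp
      then obtain s where s: "s \<in> {1..n}" "Suc c \<le> a s" "B r (Suc c) = B' s (Suc c)"
        unfolding column_set_def by auto
      have "\<not> r < s"
      proof
        assume "r < s"
        then have "B s (Suc c) = B r (Suc c)" using agree(2)[of s] s by simp
        then show False using B.inj[of s r "Suc c"] s less.prems \<open>r < s\<close> by auto
      qed
      moreover have "s \<noteq> r" using s ne by auto
      ultimately have "s < r" by simp
      then show ?thesis
        using B'.low[of r s c] B'.att[of r s c] s less.prems agree(1) sorted[of s r] by auto
    qed
    have agree: "A r c = A' r c" using Suc.IH[of r] less.prems by simp
    have above: "A s (Suc c) = A' s (Suc c)" if "s \<in> {1..n}" "r < s" "Suc c \<le> a s" for s
      using less.hyps[of s] that less.prems by simp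
    show ?case
    proof (rule ccontr)
      assume ne: "A r (Suc c) \<noteq> A' r (Suc c)"
      then show False
        using one_sided[OF A col agree above ne] one_sided[OF A(2,1) col[symmetric] agree[symmetric] above[symmetric] ne[symmetric]]
          nearest_unique[of "A r c" "A r (Suc c)" "A' r (Suc c)"] agree by simp
    qed
  qed
qed

theorem key_filling_unique:
  assumes "key_filling n a A" "key_filling n a A'" "\<And>c. column_set n a A c = column_set n a A' c"
    and "r \<in> {1..n}" "c \<le> a r"
  shows "A r c = A' r c"
  using assms
\<comment> \<open>The weight \<open>n - r\<close> is larger for lower rows, so the sum drops
  whenever an exchange moves the greater of two adjacent lengths up by one row.\<close>
proof (induction "\<Sum>r\<in>{1..n}. (n - r) * a r" arbitrary: a A A' r c rule: less_induct)
  case less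
  show ?case
  proof (cases "\<exists>i. 1 \<le> i \<and> Suc i \<le> n \<and> a (Suc i) < a i")
    case False
    have step: "a r \<le> a (Suc r)" if "1 \<le> r" "Suc r \<le> n" for r using False that by (meson not_le)
    have "a r \<le> a s" if "r \<in> {1..n}" "s \<in> {1..n}" "r \<le> s" for r s
      using that(3) that(1,2)
    proof (induction s rule: dec_induct)
      case (step m)
      then have "a r \<le> a m" "1 \<le> m" "Suc m \<le> n" by auto
      then show ?case using \<open>\<And>r. 1 \<le> r \<Longrightarrow> Suc r \<le> n \<Longrightarrow> a r \<le> a (Suc r)\<close>[of m] by simp
    qed simp
    then show ?thesis using sorted_filling_unique less.prems by blast
  next
    case True
    then obtain i where i: "1 \<le> i" "Suc i \<le> n" "a (Suc i) < a i" by blast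
    define b where "b = a(i := a (Suc i), Suc i := a i)"
    have A: "descent_filling n a A i" "descent_filling n a A' i"
      using i less.prems(1,2) by (simp_all add: descent_filling_def descent_filling_axioms_def)
    have split: "{1..n} = {i, Suc i} \<union> ({1..n} - {i, Suc i})" using i by auto
    have sum: "(\<Sum>r\<in>{1..n}. (n - r) * f r) = (n - i) * f i + (n - Suc i) * f (Suc i) + (\<Sum>r\<in>{1..n} - {i, Suc i}. (n - r) * f r)" for f
      by (subst split, subst sum.union_disjoint) auto
    have rest: "(\<Sum>r\<in>{1..n} - {i, Suc i}. (n - r) * b r) = (\<Sum>r\<in>{1..n} - {i, Suc i}. (n - r) * a r)"
      by (rule sum.cong) (auto simp: b_def)
    obtain d where d: "n - i = Suc d" "n - Suc i = d" using i by (metis Suc_diff_Suc Suc_le_eq)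
    have lt: "(\<Sum>r\<in>{1..n}. (n - r) * b r) < (\<Sum>r\<in>{1..n}. (n - r) * a r)"
      unfolding sum[of b] sum[of a] rest d using i(3) by (simp add: b_def)
    have key: "key_filling n b (exchange_rows a i A)" "key_filling n b (exchange_rows a i A')"
      using descent_filling.exchange_key_filling[OF A(1)] descent_filling.exchange_key_filling[OF A(2)]
      unfolding b_def by auto
    have col: "column_set n b (exchange_rows a i A) c = column_set n b (exchange_rows a i A') c" for c
      using descent_filling.column_set_exchange[OF A(1)] descent_filling.column_set_exchange[OF A(2)] less.prems(3)
      unfolding b_def by simp
    have "exchange_rows a i A r c = exchange_rows a i A' r c" if "r \<in> {1..n}" "c \<le> b r" for r c
      using less.hyps[OF lt key col that] .
    then show ?thesis using exchange_rows_inject[OF A] less.prems(4,5) unfolding b_def by blast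
  qed
qed

section \<open>Crystal operators on words as paths\<close>

definition letter_step :: "nat \<Rightarrow> nat \<Rightarrow> int" where
  "letter_step i x = (if x = i + 1 then 1 else if x = i then - 1 else 0)"

text \<open>The signature path of the word: its maximum is \<open>word_eps i w\<close>, and its drop
  from the maximum to the end will be \<open>word_phi i w\<close>.\<close>

definition ht :: "nat \<Rightarrow> nat list \<Rightarrow> nat \<Rightarrow> int" where
  "ht i w k = (\<Sum>m<k. letter_step i (w ! m))"

text \<open>The tensor product rule raises the letter by which the path first reaches its maximum
  and lowers the letter by which it last leaves it.\<close>

definition first_max :: "nat \<Rightarrow> nat list \<Rightarrow> nat \<Rightarrow> bool" where
  "first_max i w p \<longleftrightarrow> p < length w \<and> (\<forall>k\<le>p. ht i w k < ht i w (Suc p)) \<and>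
     (\<forall>k\<le>length w. ht i w k \<le> ht i w (Suc p))"

definition last_max :: "nat \<Rightarrow> nat list \<Rightarrow> nat \<Rightarrow> bool" where
  "last_max i w p \<longleftrightarrow> p < length w \<and> (\<forall>k\<le>length w. ht i w k \<le> ht i w p) \<and>
     (\<forall>k\<le>length w. p < k \<longrightarrow> ht i w k < ht i w p)"

lemma ht_0 [simp]: "ht i w 0 = 0"
  by (simp add: ht_def)

lemma ht_Suc: "ht i w (Suc k) = ht i w k + letter_step i (w ! k)"
  by (simp add: ht_def)

lemma ht_Cons_Suc [simp]: "ht i (x # w) (Suc k) = letter_step i x + ht i w k"
  unfolding ht_def by (subst sum.lessThan_Suc_shift) simp

lemma ht_update:
  assumes "p < length w"
  shows "ht j (w[p := y]) k = ht j w k + (if p < k then letter_step j y - letter_step j (w ! p) else 0)"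
proof (induction k)
  case (Suc k)
  then show ?case using assms by (cases "k = p") (auto simp: ht_Suc)
qed simp

lemma letter_step_gt_0: "0 < letter_step i x \<Longrightarrow> x = i + 1"
  by (auto simp: letter_step_def split: if_splits)

lemma letter_step_lt_0: "letter_step i x < 0 \<Longrightarrow> x = i"
  by (auto simp: letter_step_def split: if_splits)

lemma ht_length: "ht i w (length w) = int (count_list w (i + 1)) - int (count_list w i)"
  by (induction w) (auto simp: letter_step_def)

lemma word_eps_bound: "k \<le> length w \<Longrightarrow> ht i w k \<le> int (word_eps i w)"
proof (induction w arbitrary: k)
  case (Cons x w)
  then show ?case
    by (cases k) (force simp: letter_step_def letter_eps_def letter_phi_def)+
qed simp

lemma word_eps_attained: "\<exists>k\<le>length w. ht i w k = int (word_eps i w)"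
proof (induction w)
  case (Cons x w)
  then obtain k where k: "k \<le> length w" "ht i w k = int (word_eps i w)" by blast
  show ?case
  proof (cases "x = i \<and> word_eps i w = 0")
    case True
    then show ?thesis by (intro exI[of _ 0]) (simp add: letter_eps_def letter_phi_def)
  next
    case False
    then show ?thesis using k
      by (intro exI[of _ "Suc k"]) (auto simp: letter_step_def letter_eps_def letter_phi_def of_nat_diff)
  qed
qed simp

lemma word_eps_eqI:
  assumes "\<And>k. k \<le> length w \<Longrightarrow> ht i w k \<le> e" "k \<le> length w" "ht i w k = e"
  shows "int (word_eps i w) = e"
  using assms word_eps_bound[of k w i] word_eps_attained[of w i] by (metis order_antisym)

lemma first_max_eps: "first_max i w p \<Longrightarrow> ht i w (Suc p) = int (word_eps i w)"
  unfolding first_max_def by (rule word_eps_eqI[symmetric, where k = "Suc p"]) auto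

lemma first_max_unique: "first_max i w p \<Longrightarrow> first_max i w q \<Longrightarrow> p = q"
  unfolding first_max_def by (metis Suc_leI linorder_neqE_nat not_le)

lemma first_max_letter:
  assumes "first_max i w p"
  shows "w ! p = i + 1" "ht i w (Suc p) = ht i w p + 1"
proof -
  have "ht i w p < ht i w (Suc p)" using assms unfolding first_max_def by simp
  then show *: "w ! p = i + 1" by (intro letter_step_gt_0) (simp add: ht_Suc)
  then show "ht i w (Suc p) = ht i w p + 1" by (simp add: ht_Suc letter_step_def)
qed

lemma word_raise_None: "word_raise i w = None \<longleftrightarrow> word_eps i w = 0"
  by (induction w) (auto simp: letter_eps_def letter_phi_def letter_raise_def)

lemma word_raise_first_max: "word_raise i w = Some v \<Longrightarrow> \<exists>p. first_max i w p \<and> v = w[p := i]"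
proof (induction w arbitrary: v)
  case (Cons x w)
  show ?case
  proof (cases "word_eps i w \<le> letter_phi i x")
    case True
    then have x: "x = i + 1" "v = i # w" "word_eps i w = 0"
      using Cons.prems by (auto simp: letter_raise_def letter_phi_def split: if_splits)
    have "first_max i (x # w) 0"
      unfolding first_max_def
    proof (intro conjI allI impI)
      fix k assume "k \<le> length (x # w)"
      then show "ht i (x # w) k \<le> ht i (x # w) (Suc 0)"
        using word_eps_bound[of "k - 1" w i] x by (cases k) (auto simp: letter_step_def)
    qed (use x in \<open>auto simp: letter_step_def\<close>)
    then show ?thesis using x by (intro exI[of _ 0]) simp
  next
    case False
    then obtain v' where v': "word_raise i w = Some v'" "v = x # v'" using Cons.prems by auto
    then obtain p where p: "first_max i w p" "v' = w[p := i]" using Cons.IH by blast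
    have e: "ht i w (Suc p) = int (word_eps i w)" using first_max_eps p by blast
    have s: "letter_step i x + int (word_eps i w) > 0"
      using False by (auto simp: letter_step_def letter_phi_def split: if_splits)
    have "first_max i (x # w) (Suc p)"
      unfolding first_max_def
    proof (intro conjI allI impI)
      fix k assume "k \<le> Suc p"
      then show "ht i (x # w) k < ht i (x # w) (Suc (Suc p))"
        using p e s unfolding first_max_def by (cases k) auto
    next
      fix k assume "k \<le> length (x # w)"
      then show "ht i (x # w) k \<le> ht i (x # w) (Suc (Suc p))"
        using p e s unfolding first_max_def by (cases k) auto
    qed (use p in \<open>auto simp: first_max_def\<close>)
    then show ?thesis using v' p by (intro exI[of _ "Suc p"]) simp
  qed
qed simp

lemma word_raise_iff: "word_raise i w = Some v \<longleftrightarrow> (\<exists>p. first_max i w p \<and> v = w[p := i])"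
proof
  assume "\<exists>p. first_max i w p \<and> v = w[p := i]"
  then obtain p where p: "first_max i w p" "v = w[p := i]" by blast
  then have "ht i w 0 < ht i w (Suc p)" unfolding first_max_def by blast
  then have "word_eps i w \<noteq> 0" using first_max_eps[OF p(1)] by simp
  then obtain v' where "word_raise i w = Some v'" using word_raise_None by fastforce
  then show "word_raise i w = Some v"
    using word_raise_first_max first_max_unique p by metis
qed (rule word_raise_first_max)

lemma word_lower_last_max: "word_lower i w = Some v \<Longrightarrow> \<exists>p. last_max i w p \<and> v = w[p := i + 1]"
proof (induction w arbitrary: v)
  case (Cons x w)
  show ?case
  proof (cases "word_eps i w < letter_phi i x")
    case True
    then have x: "x = i" "v = (i + 1) # w" "word_eps i w = 0"
      using Cons.prems by (auto simp: letter_lower_def letter_phi_def split: if_splits)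
    have "ht i (x # w) k < 0" if "0 < k" "k \<le> length (x # w)" for k
      using that word_eps_bound[of "k - 1" w i] x by (cases k) (auto simp: letter_step_def)
    then have "last_max i (x # w) 0"
      unfolding last_max_def by (metis gr0I ht_0 length_greater_0_conv less_imp_le list.discI order.refl)
    then show ?thesis using x by (intro exI[of _ 0]) simp
  next
    case False
    then obtain v' where v': "word_lower i w = Some v'" "v = x # v'" using Cons.prems by auto
    then obtain p where p: "last_max i w p" "v' = w[p := i + 1]" using Cons.IH by blast
    have e: "ht i w p = int (word_eps i w)"
      using p unfolding last_max_def by (intro word_eps_eqI[symmetric, where k = p]) auto
    have s: "letter_step i x + int (word_eps i w) \<ge> 0"
      using False by (auto simp: letter_step_def letter_phi_def split: if_splits)
    have "last_max i (x # w) (Suc p)"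
      unfolding last_max_def
    proof (intro conjI allI impI)
      fix k assume "k \<le> length (x # w)"
      then show "ht i (x # w) k \<le> ht i (x # w) (Suc p)"
        using p e s unfolding last_max_def by (cases k) auto
    next
      fix k assume "k \<le> length (x # w)" "Suc p < k"
      then show "ht i (x # w) k < ht i (x # w) (Suc p)"
        using p e s unfolding last_max_def by (cases k) auto
    qed (use p in \<open>auto simp: last_max_def\<close>)
    then show ?thesis using v' p by (intro exI[of _ "Suc p"]) simp
  qed
qed simp

lemma word_lower_None: "word_lower i w = None \<Longrightarrow> ht i w (length w) = int (word_eps i w)"
  by (induction w)
    (auto simp: letter_eps_def letter_phi_def letter_lower_def letter_step_def split: if_splits)

lemma last_max_unique: "last_max i w p \<Longrightarrow> last_max i w q \<Longrightarrow> p = q"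
  unfolding last_max_def by (metis linorder_neqE_nat not_le less_imp_le)

lemma last_max_eps: "last_max i w p \<Longrightarrow> ht i w p = int (word_eps i w)"
  unfolding last_max_def by (rule word_eps_eqI[symmetric, where k = p]) auto

lemma word_lower_iff: "word_lower i w = Some v \<longleftrightarrow> (\<exists>p. last_max i w p \<and> v = w[p := i + 1])"
proof
  assume "\<exists>p. last_max i w p \<and> v = w[p := i + 1]"
  then obtain p where p: "last_max i w p" "v = w[p := i + 1]" by blast
  then have "ht i w (length w) < ht i w p" unfolding last_max_def by blast
  then have "word_lower i w \<noteq> None" using last_max_eps[OF p(1)] word_lower_None by fastforce
  then obtain v' where "word_lower i w = Some v'" by blast
  then show "word_lower i w = Some v"
    using word_lower_last_max last_max_unique p by metis
qed (rule word_lower_last_max)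

text \<open>Replacing \<open>i + 1\<close> by \<open>i\<close> at the first maximum lowers the rest
  of the path by 2, so that position \<open>p\<close> becomes the last maximum of the new path. The
  opposite replacement reverses this.\<close>

lemma word_lower_raise: "word_lower i v = Some w \<longleftrightarrow> word_raise i w = Some v"
proof
  assume "word_raise i w = Some v"
  then obtain p where p: "first_max i w p" "v = w[p := i]" unfolding word_raise_iff by blast
  note l = first_max_letter[OF p(1)]
  have pl: "p < length w" using p unfolding first_max_def by simp
  have h: "ht i v k = ht i w k - (if p < k then 2 else 0)" for k
    unfolding p(2) ht_update[OF pl] l by (simp add: letter_step_def)
  have "last_max i v p"
    unfolding last_max_def h
  proof (intro conjI allI impI)
    fix k assume k: "k \<le> length v"
    then show "ht i w k - (if p < k then 2 else 0) \<le> ht i w p - (if p < p then 2 else 0)"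
      using p l unfolding first_max_def by (cases "k \<le> p") fastforce+
    assume "p < k"
    then show "ht i w k - (if p < k then 2 else 0) < ht i w p - (if p < p then 2 else 0)"
      using p l k unfolding first_max_def by fastforce
  qed (use p pl in simp)
  moreover have "w = v[p := i + 1]" using p l pl by (metis list_update_id list_update_overwrite)
  ultimately show "word_lower i v = Some w" unfolding word_lower_iff by blast
next
  assume "word_lower i v = Some w"
  then obtain p where p: "last_max i v p" "w = v[p := i + 1]" unfolding word_lower_iff by blast
  have pl: "p < length v" using p unfolding last_max_def by simp
  have "ht i v (Suc p) < ht i v p" using p pl unfolding last_max_def by simp
  then have l: "v ! p = i" by (intro letter_step_lt_0) (simp add: ht_Suc)
  have h: "ht i w k = ht i v k + (if p < k then 2 else 0)" for k
    unfolding p(2) ht_update[OF pl] l by (simp add: letter_step_def)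
  have l': "ht i w (Suc p) = ht i v p + 1" unfolding h by (simp add: ht_Suc l letter_step_def)
  have "first_max i w p"
    unfolding first_max_def l'
  proof (intro conjI allI impI)
    fix k assume "k \<le> p"
    then show "ht i w k < ht i v p + 1" using p pl unfolding last_max_def h by simp
  next
    fix k assume "k \<le> length w"
    then have "k \<le> length v" using p by simp
    then have "ht i v k \<le> ht i v p" "p < k \<Longrightarrow> ht i v k < ht i v p"
      using p unfolding last_max_def by blast+
    then show "ht i w k \<le> ht i v p + 1" unfolding h by auto
  qed (use p pl in simp)
  moreover have "v = w[p := i]" using p l pl by (metis list_update_id list_update_overwrite)
  ultimately show "word_raise i w = Some v" unfolding word_raise_iff by blast
qed

lemma word_raise_eps: "word_raise i w = Some v \<Longrightarrow> word_eps i w = Suc (word_eps i v)"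
proof -
  assume r: "word_raise i w = Some v"
  then obtain p where p: "first_max i w p" "v = w[p := i]" unfolding word_raise_iff by blast
  note l = first_max_letter[OF p(1)]
  have pl: "p < length w" using p unfolding first_max_def by simp
  have h: "ht i v k = ht i w k - (if p < k then 2 else 0)" for k
    unfolding p(2) ht_update[OF pl] l by (simp add: letter_step_def)
  have "int (word_eps i v) = ht i w (Suc p) - 1"
  proof (rule word_eps_eqI[where k = p])
    show "ht i v k \<le> ht i w (Suc p) - 1" if "k \<le> length v" for k
      using that p l unfolding h first_max_def by (cases "k \<le> p") fastforce+
  qed (use h l p pl in auto)
  then show ?thesis using first_max_eps[OF p(1)] by simp
qed

lemma word_raise_ht:
  assumes "word_raise i w = Some v"
  shows "ht j v (length v) = ht j w (length w) + letter_step j i - letter_step j (i + 1)"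
    and "length v = length w"
proof -
  obtain p where p: "first_max i w p" "v = w[p := i]" using assms unfolding word_raise_iff by blast
  then have "p < length w" unfolding first_max_def by simp
  then show "ht j v (length v) = ht j w (length w) + letter_step j i - letter_step j (i + 1)" "length v = length w"
    using p first_max_letter[OF p(1)] by (simp_all add: ht_update)
qed

section \<open>Stembridge relations\<close>

definition word_phi :: "nat \<Rightarrow> nat list \<Rightarrow> int" where
  "word_phi i w = int (word_eps i w) - ht i w (length w)"

text \<open>Minus the off-diagonal Cartan entry of type A. For distinct directions it is the amount
  by which raising in direction \<open>i\<close> lifts the \<open>j\<close>-path to the right of the
  changed letter.\<close>

definition coupling :: "nat \<Rightarrow> nat \<Rightarrow> int" where
  "coupling i j = (if j = i + 1 \<or> i = j + 1 then 1 else 0)"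

lemma coupling_sym: "coupling i j = coupling j i"
  by (auto simp: coupling_def)

lemma letter_step_coupling: "i \<noteq> j \<Longrightarrow> letter_step j i - letter_step j (i + 1) = coupling i j"
  by (auto simp: coupling_def letter_step_def)

lemma ht_first_max_update:
  assumes "first_max i w p"
  shows "ht i (w[p := i]) k = ht i w k - (if p < k then 2 else 0)"
    and "i \<noteq> j \<Longrightarrow> ht j (w[p := i]) k = ht j w k + (if p < k then coupling i j else 0)"
proof -
  have "p < length w" "w ! p = i + 1" using assms first_max_letter[OF assms] unfolding first_max_def by auto
  then show "ht i (w[p := i]) k = ht i w k - (if p < k then 2 else 0)"
    and "i \<noteq> j \<Longrightarrow> ht j (w[p := i]) k = ht j w k + (if p < k then coupling i j else 0)"
    using letter_step_coupling[of i j] by (simp_all add: ht_update letter_step_def[of i])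
qed

text \<open>Raising at \<open>p\<close> lifts the \<open>j\<close>-path only to the right of
  \<open>p\<close>. If its maximum does not grow although the directions are coupled, its first
  maximum lies left of \<open>p\<close>, and neither change moves the first maximum of the other
  path. The equation for \<open>word_phi\<close> is the hypothesis of the lowering relation read
  from \<open>t\<close>.\<close>

lemma word_raise_commute:
  assumes ij: "i \<noteq> j" and v: "word_raise i w = Some v" and u: "word_raise j w = Some u"
    and eps: "word_eps j v = word_eps j w"
  shows "\<exists>t. word_raise j v = Some t \<and> word_raise i u = Some t \<and> word_phi i v = word_phi i t"
proof -
  obtain p where p: "first_max i w p" "v = w[p := i]" using v unfolding word_raise_iff by blast
  obtain q where q: "first_max j w q" "u = w[q := j]" using u unfolding word_raise_iff by blast
  note hv = ht_first_max_update(2)[OF p(1) ij, folded p(2)]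
  note hu = ht_first_max_update(2)[OF q(1) ij[symmetric], folded q(2)]
  have pq: "p < length w" "q < length w" using p q unfolding first_max_def by auto
  have "p \<noteq> q" using first_max_letter(1)[OF p(1)] first_max_letter(1)[OF q(1)] ij by auto
  have lt: "q < p" if "coupling i j = 1"
  proof (rule ccontr)
    assume "\<not> q < p"
    then have "ht j v (Suc q) = ht j w (Suc q) + 1" using \<open>p \<noteq> q\<close> that unfolding hv by simp
    then have "ht j v (Suc q) > int (word_eps j v)" using eps first_max_eps[OF q(1)] by simp
    then show False using word_eps_bound[of "Suc q" v j] pq p by simp
  qed
  have c: "coupling i j = 0 \<or> coupling i j = 1" by (simp add: coupling_def)
  have "first_max j v q"
    unfolding first_max_def
  proof (intro conjI allI impI)
    fix k assume "k \<le> q"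
    then show "ht j v k < ht j v (Suc q)" using q lt c unfolding first_max_def hv by auto
  next
    fix k assume "k \<le> length v"
    then have "ht j v k \<le> int (word_eps j v)" by (rule word_eps_bound)
    moreover have "ht j v (Suc q) = int (word_eps j v)"
      using lt c first_max_eps[OF q(1)] unfolding hv eps by auto
    ultimately show "ht j v k \<le> ht j v (Suc q)" by simp
  qed (use p pq in auto)
  moreover have "first_max i u p"
    unfolding first_max_def
  proof (intro conjI allI impI)
    fix k assume "k \<le> p"
    then have "ht i w k < ht i w (Suc p)" using p unfolding first_max_def by blast
    then show "ht i u k < ht i u (Suc p)" using lt c \<open>k \<le> p\<close> unfolding hu coupling_sym[of j i] by auto
  next
    fix k assume "k \<le> length u"
    then have "ht i w k \<le> ht i w (Suc p)" using p q unfolding first_max_def by simp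
    then show "ht i u k \<le> ht i u (Suc p)" using lt c unfolding hu coupling_sym[of j i] by auto
  qed (use q pq in auto)
  ultimately have t: "word_raise j v = Some (v[q := j])" "word_raise i u = Some (v[q := j])"
    using list_update_swap[OF \<open>p \<noteq> q\<close>] p(2) q(2) unfolding word_raise_iff by metis+
  have "ht i u (Suc p) = ht i w (Suc p) + coupling j i"
    using lt c unfolding hu coupling_sym[of j i] by auto
  then have "int (word_eps i u) = int (word_eps i w) + coupling j i"
    using first_max_eps[OF p(1)] first_max_eps[OF \<open>first_max i u p\<close>] by simp
  moreover have "ht i (v[q := j]) (length (v[q := j])) = ht i v (length v) + coupling j i"
    using word_raise_ht(1)[OF t(1), of i] letter_step_coupling[of j i] ij by simp
  ultimately have "word_phi i v = word_phi i (v[q := j])"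
    using word_raise_eps[OF v] word_raise_eps[OF t(2)] unfolding word_phi_def by simp
  then show ?thesis using t by blast
qed

text \<open>Both sides of the degree four relation change the letters at positions
  \<open>p \<le> s < q \<le> r\<close>: the step at \<open>r\<close> is the first return of the
  \<open>i\<close>-path to its maximum beyond \<open>q\<close>, and the step at \<open>s\<close>
  first brings the \<open>j\<close>-path to one below its maximum beyond \<open>p\<close>.
  Coinciding positions are changed twice, in the same order on both sides.\<close>

lemma word_raise_braid_aux:
  assumes ij: "coupling i j = 1" and p: "first_max i w p" and q: "first_max j w q" and pq: "p < q"
    and k0: "k0 \<le> length w" "q < k0" "ht i w k0 = ht i w (Suc p)"
  obtains v1 v2 u1 u2 t where
    "word_raise j (w[p := i]) = Some v1" "word_raise j v1 = Some v2" "word_raise i v2 = Some t"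
    "word_raise i (w[q := j]) = Some u1" "word_raise i u1 = Some u2" "word_raise j u2 = Some t"
    "word_eps i v2 = word_eps i w" "word_eps j u2 = word_eps j w"
proof -
  define H G where "H = ht i w (Suc p)" and "G = ht j w (Suc q)"
  have ne: "i \<noteq> j" using ij by (auto simp: coupling_def)
  have ql: "q < length w" using q unfolding first_max_def by simp
  have h: "ht i w k < H" if "k \<le> p" for k using p that unfolding first_max_def H_def by blast
  have h': "ht i w k \<le> H" if "k \<le> length w" for k using p that unfolding first_max_def H_def by blast
  have g: "ht j w k < G" if "k \<le> q" for k using q that unfolding first_max_def G_def by blast
  have g': "ht j w k \<le> G" if "k \<le> length w" for k using q that unfolding first_max_def G_def by blast
  define k1 where "k1 = (LEAST k. q < k \<and> ht i w k = H)"
  have k1: "q < k1" "ht i w k1 = H" "k1 \<le> k0"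
    using LeastI[of "\<lambda>k. q < k \<and> ht i w k = H" k0] Least_le[of "\<lambda>k. q < k \<and> ht i w k = H" k0] k0
    unfolding k1_def H_def by auto
  have k1': "ht i w k < H" if "q < k" "k < k1" for k
    using not_less_Least[of k "\<lambda>k. q < k \<and> ht i w k = H"] that h'[of k] k0 k1(3) unfolding k1_def[symmetric] by fastforce
  obtain r where r: "k1 = Suc r" using k1 by (cases k1) auto
  \<comment> \<open>Such a height exists: at \<open>q\<close> itself the \<open>j\<close>-path is
    one below its maximum.\<close>
  define k2 where "k2 = (LEAST k. p < k \<and> ht j w k = G - 1)"
  have k2: "p < k2" "ht j w k2 = G - 1" "k2 \<le> q"
    using LeastI[of "\<lambda>k. p < k \<and> ht j w k = G - 1" q] Least_le[of "\<lambda>k. p < k \<and> ht j w k = G - 1" q] pq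
      first_max_letter(2)[OF q] unfolding k2_def G_def by auto
  have k2': "ht j w k < G - 1" if "p < k" "k < k2" for k
    using not_less_Least[of k "\<lambda>k. p < k \<and> ht j w k = G - 1"] that g[of k] k2(3) unfolding k2_def[symmetric] by fastforce
  obtain s where s: "k2 = Suc s" using k2 by (cases k2) auto
  have rl: "r < length w" using r k1 k0 by simp
  have ord: "p \<le> s" "s < q" "q \<le> r" using k1 k2 r s by auto
  note c = ij coupling_sym[of j i, unfolded ij]

  define v v1 v2 where "v = w[p := i]" and "v1 = v[q := j]" and "v2 = v1[s := j]"
  have gv: "ht j v k = ht j w k + (if p < k then 1 else 0)" for k
    unfolding v_def using ht_first_max_update(2)[OF p ne] c by simp
  have hv: "ht i v k = ht i w k - (if p < k then 2 else 0)" for k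
    unfolding v_def using ht_first_max_update(1)[OF p] by simp
  have fv: "first_max j v q"
    unfolding first_max_def gv
  proof (intro conjI allI impI)
    fix k assume "k \<le> q"
    then show "ht j w k + (if p < k then 1 else 0) < ht j w (Suc q) + (if p < Suc q then 1 else 0)"
      using g[of k] pq unfolding G_def by simp
  next
    fix k assume "k \<le> length v"
    then show "ht j w k + (if p < k then 1 else 0) \<le> ht j w (Suc q) + (if p < Suc q then 1 else 0)"
      using g'[of k] pq unfolding G_def v_def by simp
  qed (use ql v_def in simp)
  have gv1: "ht j v1 k = ht j w k + (if p < k then 1 else 0) - (if q < k then 2 else 0)" for k
    unfolding v1_def using ht_first_max_update(1)[OF fv] gv by simp
  have hv1: "ht i v1 k = ht i w k - (if p < k then 2 else 0) + (if q < k then 1 else 0)" for k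
    unfolding v1_def using ht_first_max_update(2)[OF fv ne[symmetric]] hv c by simp
  have v1s: "ht j v1 (Suc s) = G" unfolding gv1 using k2 s pq by simp
  have fv1: "first_max j v1 s"
    unfolding first_max_def v1s
  proof (intro conjI allI impI)
    fix k assume k: "k \<le> s"
    show "ht j v1 k < G"
    proof (cases "k \<le> p")
      case True
      then show ?thesis using g[of k] ord unfolding gv1 by simp
    next
      case False
      then show ?thesis using k2'[of k] k s ord unfolding gv1 by simp
    qed
  next
    fix k assume "k \<le> length v1"
    then have k: "k \<le> length w" unfolding v1_def v_def by simp
    consider "k \<le> q" | "q < k" by linarith
    then show "ht j v1 k \<le> G"
      using g[of k] g'[OF k] pq unfolding gv1 by cases auto
  qed (use ord ql in \<open>simp add: v1_def v_def\<close>)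
  have hv2: "ht i v2 k = ht i w k - (if p < k then 2 else 0) + (if q < k then 1 else 0) + (if s < k then 1 else 0)" for k
    unfolding v2_def using ht_first_max_update(2)[OF fv1 ne[symmetric]] hv1 c by simp
  have v2r: "ht i v2 (Suc r) = H" unfolding hv2 using k1 r ord by simp
  have fv2: "first_max i v2 r"
    unfolding first_max_def v2r
  proof (intro conjI allI impI)
    fix k assume k: "k \<le> r"
    consider "k \<le> p" | "p < k" "k \<le> q" | "q < k" by linarith
    then show "ht i v2 k < H"
    proof cases
      case 1
      then show ?thesis using h[of k] ord unfolding hv2 by simp
    next
      case 2
      then show ?thesis using h'[of k] ql unfolding hv2 by simp
    next
      case 3
      then show ?thesis using k1'[of k] k r ord unfolding hv2 by simp
    qed
  next
    fix k assume "k \<le> length v2"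
    then have k: "k \<le> length w" unfolding v2_def v1_def v_def by simp
    show "ht i v2 k \<le> H" using h'[OF k] ord unfolding hv2 by simp
  qed (use rl in \<open>simp add: v2_def v1_def v_def\<close>)

  define u u1 u2 where "u = w[q := j]" and "u1 = u[r := i]" and "u2 = u1[p := i]"
  have hu: "ht i u k = ht i w k + (if q < k then 1 else 0)" for k
    unfolding u_def using ht_first_max_update(2)[OF q ne[symmetric]] c by simp
  have gu: "ht j u k = ht j w k - (if q < k then 2 else 0)" for k
    unfolding u_def using ht_first_max_update(1)[OF q] by simp
  have ur: "ht i u (Suc r) = H + 1" unfolding hu using k1 r ord by simp
  have fu: "first_max i u r"
    unfolding first_max_def ur
  proof (intro conjI allI impI)
    fix k assume k: "k \<le> r"
    consider "k \<le> q" | "q < k" by linarith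
    then show "ht i u k < H + 1"
    proof cases
      case 1
      then show ?thesis using h'[of k] ql unfolding hu by simp
    next
      case 2
      then show ?thesis using k1'[of k] k r unfolding hu by simp
    qed
  next
    fix k assume "k \<le> length u"
    then have "k \<le> length w" by (simp add: u_def)
    then show "ht i u k \<le> H + 1" using h'[of k] unfolding hu by simp
  qed (use rl in \<open>simp add: u_def\<close>)
  have hu1: "ht i u1 k = ht i w k + (if q < k then 1 else 0) - (if r < k then 2 else 0)" for k
    unfolding u1_def using ht_first_max_update(1)[OF fu] hu by simp
  have gu1: "ht j u1 k = ht j w k - (if q < k then 2 else 0) + (if r < k then 1 else 0)" for k
    unfolding u1_def using ht_first_max_update(2)[OF fu ne] gu c by simp
  have u1p: "ht i u1 (Suc p) = H" unfolding hu1 H_def using pq ord by simp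
  have fu1: "first_max i u1 p"
    unfolding first_max_def u1p
  proof (intro conjI allI impI)
    fix k assume k: "k \<le> p"
    then show "ht i u1 k < H" using h[of k] ord unfolding hu1 by simp
  next
    fix k assume "k \<le> length u1"
    then have k: "k \<le> length w" unfolding u1_def u_def by simp
    consider "k \<le> q" | "q < k" "k \<le> r" | "r < k" by linarith
    then show "ht i u1 k \<le> H"
      using h'[OF k] k1'[of k] r ord unfolding hu1 by cases auto
  qed (use pq ql in \<open>simp add: u1_def u_def\<close>)
  have gu2: "ht j u2 k = ht j w k - (if q < k then 2 else 0) + (if r < k then 1 else 0) + (if p < k then 1 else 0)" for k
    unfolding u2_def using ht_first_max_update(2)[OF fu1 ne] gu1 c by simp
  have u2s: "ht j u2 (Suc s) = G" unfolding gu2 using k2 s ord by simp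
  have fu2: "first_max j u2 s"
    unfolding first_max_def u2s
  proof (intro conjI allI impI)
    fix k assume k: "k \<le> s"
    show "ht j u2 k < G"
    proof (cases "k \<le> p")
      case True
      then show ?thesis using g[of k] ord unfolding gu2 by simp
    next
      case False
      then show ?thesis using k2'[of k] k s ord unfolding gu2 by simp
    qed
  next
    fix k assume "k \<le> length u2"
    then have k: "k \<le> length w" unfolding u2_def u1_def u_def by simp
    consider "k \<le> q" | "q < k" "k \<le> r" | "r < k" by linarith
    then show "ht j u2 k \<le> G"
      using g[of k] g'[OF k] ord unfolding gu2 by cases auto
  qed (use ord ql in \<open>simp add: u2_def u1_def u_def\<close>)
  have eq: "v2[r := i] = u2[s := j]"
    using ord rl by (intro nth_equalityI) (auto simp: v2_def v1_def v_def u2_def u1_def u_def nth_list_update)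
  show ?thesis
  proof (rule that)
    show "word_raise j (w[p := i]) = Some v1" using fv unfolding word_raise_iff v1_def v_def by blast
    show "word_raise j v1 = Some v2" using fv1 unfolding word_raise_iff v2_def by blast
    show "word_raise i v2 = Some (v2[r := i])" using fv2 unfolding word_raise_iff by blast
    show "word_raise i (w[q := j]) = Some u1" using fu unfolding word_raise_iff u1_def u_def by blast
    show "word_raise i u1 = Some u2" using fu1 unfolding word_raise_iff u2_def by blast
    show "word_raise j u2 = Some (v2[r := i])" using fu2 unfolding word_raise_iff eq by blast
    show "word_eps i v2 = word_eps i w"
      using first_max_eps[OF fv2] first_max_eps[OF p] v2r unfolding H_def by simp
    show "word_eps j u2 = word_eps j w"
      using first_max_eps[OF fu2] first_max_eps[OF q] u2s unfolding G_def by simp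
  qed
qed

lemma word_raise_braid:
  assumes ij: "i \<noteq> j" and v: "word_raise i w = Some v" and u: "word_raise j w = Some u"
    and eps: "word_eps j v \<noteq> word_eps j w" "word_eps i u \<noteq> word_eps i w"
  obtains v1 v2 u1 u2 t where
    "word_raise j v = Some v1" "word_raise j v1 = Some v2" "word_raise i v2 = Some t"
    "word_raise i u = Some u1" "word_raise i u1 = Some u2" "word_raise j u2 = Some t"
    "word_phi j v2 \<noteq> word_phi j t" "word_phi i u2 \<noteq> word_phi i t"
proof -
  obtain p where p: "first_max i w p" "v = w[p := i]" using v unfolding word_raise_iff by blast
  obtain q where q: "first_max j w q" "u = w[q := j]" using u unfolding word_raise_iff by blast
  have pq: "p < length w" "q < length w" using p q unfolding first_max_def by auto
  have ne: "p \<noteq> q" using first_max_letter(1)[OF p(1)] first_max_letter(1)[OF q(1)] ij by auto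
  \<comment> \<open>Raising at \<open>q\<close> lifts the \<open>i\<close>-path only beyond
    \<open>q\<close>, so its maximum can grow only if the old maximum is attained there as
    well.\<close>
  have late: "coupling i j = 1 \<and> (\<exists>k\<le>length w. q < k \<and> ht i w k = int (word_eps i w))"
    if ij: "i \<noteq> j" and "word_eps i u \<noteq> word_eps i w" and q: "first_max j w q" "u = w[q := j]" for i j q u
  proof (rule ccontr)
    assume *: "\<not> ?thesis"
    note hu = ht_first_max_update(2)[OF q(1) ij[symmetric], folded q(2)]
    have c: "coupling i j = 0 \<or> coupling i j = 1" by (simp add: coupling_def)
    obtain k0 where k0: "k0 \<le> length w" "ht i w k0 = int (word_eps i w)"
      using word_eps_attained[of w i] by blast
    have "int (word_eps i u) = int (word_eps i w)"
    proof (rule word_eps_eqI)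
      show "ht i u k \<le> int (word_eps i w)" if "k \<le> length u" for k
      proof -
        have k: "k \<le> length w" using that q by simp
        then have "ht i w k \<noteq> int (word_eps i w)" if "q < k" "coupling i j = 1" using * that by blast
        then show ?thesis using word_eps_bound[OF k, of i] c unfolding hu coupling_sym[of j i] by auto
      qed
      show "k0 \<le> length u" using k0 q by simp
      show "ht i u k0 = int (word_eps i w)" using k0 * c unfolding hu coupling_sym[of j i] by auto
    qed
    then show False using that by simp
  qed
  obtain k1 where k1: "coupling i j = 1" "k1 \<le> length w" "q < k1" "ht i w k1 = int (word_eps i w)"
    using late[OF ij eps(2) q] by blast
  obtain k2 where k2: "k2 \<le> length w" "p < k2" "ht j w k2 = int (word_eps j w)"
    using late[OF ij[symmetric] eps(1) p] by blast
  have ji: "coupling j i = 1" using k1(1) coupling_sym by simp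
  obtain v1 v2 u1 u2 t where *:
    "word_raise j v = Some v1" "word_raise j v1 = Some v2" "word_raise i v2 = Some t"
    "word_raise i u = Some u1" "word_raise i u1 = Some u2" "word_raise j u2 = Some t"
    "word_eps i v2 = word_eps i w" "word_eps j u2 = word_eps j w"
  proof (cases "p < q")
    case True
    then show ?thesis
      using word_raise_braid_aux[OF k1(1) p(1) q(1) _ k1(2,3)] k1(4) first_max_eps[OF p(1)] that p(2) q(2) by metis
  next
    case False
    then have "q < p" using ne by simp
    then show ?thesis
      using word_raise_braid_aux[OF ji q(1) p(1) _ k2(1,2)] k2(3) first_max_eps[OF q(1)] that p(2) q(2) by metis
  qed
  \<comment> \<open>Counting raises along both sides gives the same \<open>word_eps j\<close> at
    \<open>v2\<close> and \<open>t\<close>, so the shift of the end point of the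
    \<open>j\<close>-path by one changes \<open>word_phi j\<close>; likewise for \<open>i\<close>,
    \<open>u2\<close> and \<open>t\<close>.\<close>
  have "word_phi j t = word_phi j v2 - 1" if "word_eps j t = word_eps j v2"
    using word_raise_ht(1)[OF *(3), of j] letter_step_coupling[OF ij] k1(1) that unfolding word_phi_def by simp
  moreover have "word_phi i t = word_phi i u2 - 1" if "word_eps i t = word_eps i u2"
    using word_raise_ht(1)[OF *(6), of i] letter_step_coupling[OF ij[symmetric]] ji that unfolding word_phi_def by simp
  moreover have "word_eps j v = Suc (word_eps j w) \<and> word_eps i u = Suc (word_eps i w)"
  proof -
    have "int (word_eps j v) = int (word_eps j w) + 1"
    proof (rule word_eps_eqI[where k = k2])
      show "ht j v k \<le> int (word_eps j w) + 1" if "k \<le> length v" for k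
        using word_eps_bound[of k w j] that ht_first_max_update(2)[OF p(1) ij, of k] k1(1) p(2) by simp
      show "ht j v k2 = int (word_eps j w) + 1"
        using k2 ht_first_max_update(2)[OF p(1) ij, of k2] k1(1) p(2) by simp
    qed (use k2 p in simp)
    moreover have "int (word_eps i u) = int (word_eps i w) + 1"
    proof (rule word_eps_eqI[where k = k1])
      show "ht i u k \<le> int (word_eps i w) + 1" if "k \<le> length u" for k
        using word_eps_bound[of k w i] that ht_first_max_update(2)[OF q(1) ij[symmetric], of k] ji q(2) by simp
      show "ht i u k1 = int (word_eps i w) + 1"
        using k1 ht_first_max_update(2)[OF q(1) ij[symmetric], of k1] ji q(2) by simp
    qed (use k1 q in simp)
    ultimately show ?thesis by simp
  qed
  ultimately have "word_phi j v2 \<noteq> word_phi j t" "word_phi i u2 \<noteq> word_phi i t"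
    using word_raise_eps[OF *(1)] word_raise_eps[OF *(2)] word_raise_eps[OF *(3)]
      word_raise_eps[OF *(4)] word_raise_eps[OF *(5)] word_raise_eps[OF *(6)] *(7,8) by auto
  then show ?thesis using that[OF *(1-6)] by blast
qed

section \<open>Components with equal highest weight\<close>

definition dual_word :: "nat \<Rightarrow> nat list \<Rightarrow> nat list" where
  "dual_word n w = map (\<lambda>x. Suc n - x) (rev w)"

lemma length_dual_word [simp]: "length (dual_word n w) = length w"
  by (simp add: dual_word_def)

lemma dual_word_in_lists: "w \<in> lists {1..n} \<Longrightarrow> dual_word n w \<in> lists {1..n}"
  unfolding dual_word_def in_lists_conv_set by fastforce

lemma dual_word_dual_word: "w \<in> lists {1..n} \<Longrightarrow> dual_word n (dual_word n w) = w"
  unfolding dual_word_def by (auto simp: rev_map[symmetric] in_lists_conv_set intro!: map_idI)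

lemma nth_dual_word: "k < length w \<Longrightarrow> dual_word n w ! k = Suc n - w ! (length w - Suc k)"
  unfolding dual_word_def by (simp add: rev_nth)

text \<open>The dual path is the old one read backwards and measured from its end. Its maximum is
  therefore the old drop from the maximum to the end, which exchanges \<open>word_eps\<close> with
  \<open>word_phi\<close>.\<close>

lemma ht_dual_word:
  assumes w: "w \<in> lists {1..n}" and i: "i \<in> {1..<n}"
  shows "k \<le> length w \<Longrightarrow> ht i (dual_word n w) k = ht (n - i) w (length w - k) - ht (n - i) w (length w)"
proof (induction k)
  case (Suc k)
  let ?m = "length w - Suc k"
  have m: "length w - k = Suc ?m" "?m < length w" using Suc.prems by auto
  then have "w ! ?m \<in> {1..n}" using w by (auto simp: in_lists_conv_set)
  then have "letter_step i (Suc n - w ! ?m) = - letter_step (n - i) (w ! ?m)"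
    using i unfolding letter_step_def by auto
  then have "ht i (dual_word n w) (Suc k) = ht i (dual_word n w) k - letter_step (n - i) (w ! ?m)"
    using Suc.prems by (simp add: ht_Suc nth_dual_word)
  then show ?case using Suc m by (simp add: ht_Suc)
qed simp

lemma word_eps_dual_word:
  assumes "w \<in> lists {1..n}" "i \<in> {1..<n}"
  shows "int (word_eps i (dual_word n w)) = word_phi (n - i) w"
proof -
  obtain k where k: "k \<le> length w" "ht (n - i) w k = int (word_eps (n - i) w)"
    using word_eps_attained by blast
  show ?thesis
    by (rule word_eps_eqI[where k = "length w - k"])
      (use k ht_dual_word[OF assms] word_eps_bound in \<open>auto simp: word_phi_def\<close>)
qed

lemma dual_word_update:
  "p < length w \<Longrightarrow> dual_word n (w[p := y]) = (dual_word n w)[length w - Suc p := Suc n - y]"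
  unfolding dual_word_def by (simp add: rev_update map_update)

lemma word_raise_lists: "word_raise i w = Some v \<Longrightarrow> w \<in> lists {1..n} \<Longrightarrow> i \<in> {1..<n} \<Longrightarrow> v \<in> lists {1..n}"
  unfolding word_raise_iff in_lists_conv_set using set_update_subset_insert by fastforce

lemma word_lower_lists: "word_lower i w = Some v \<Longrightarrow> w \<in> lists {1..n} \<Longrightarrow> i \<in> {1..<n} \<Longrightarrow> v \<in> lists {1..n}"
  unfolding word_lower_iff in_lists_conv_set using set_update_subset_insert by fastforce

lemma word_raise_dual_word:
  assumes w: "w \<in> lists {1..n}" and i: "i \<in> {1..<n}" and r: "word_lower (n - i) w = Some v"
  shows "word_raise i (dual_word n w) = Some (dual_word n v)"
proof -
  obtain p where p: "last_max (n - i) w p" "v = w[p := n - i + 1]" using r unfolding word_lower_iff by blast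
  have pl: "p < length w" using p unfolding last_max_def by simp
  have a: "length w - Suc (length w - Suc p) = p" using pl by simp
  have "first_max i (dual_word n w) (length w - Suc p)"
    unfolding first_max_def
  proof (intro conjI allI impI)
    fix k assume "k \<le> length w - Suc p"
    then show "ht i (dual_word n w) k < ht i (dual_word n w) (Suc (length w - Suc p))"
      using p pl ht_dual_word[OF w i] unfolding last_max_def by (simp add: Suc_diff_Suc)
  next
    fix k assume "k \<le> length (dual_word n w)"
    then show "ht i (dual_word n w) k \<le> ht i (dual_word n w) (Suc (length w - Suc p))"
      using p pl ht_dual_word[OF w i] unfolding last_max_def by (simp add: Suc_diff_Suc)
  qed (use pl in simp)
  moreover have "dual_word n v = (dual_word n w)[length w - Suc p := i]"
    unfolding p(2) dual_word_update[OF pl] using i by (simp add: Suc_diff_le)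
  ultimately show ?thesis unfolding word_raise_iff by blast
qed

lemma word_lower_dual_word:
  assumes w: "w \<in> lists {1..n}" and i: "i \<in> {1..<n}" and r: "word_raise (n - i) w = Some v"
  shows "word_lower i (dual_word n w) = Some (dual_word n v)"
proof -
  have "n - i \<in> {1..<n}" using i by auto
  then have "v \<in> lists {1..n}" using word_raise_lists[OF r w] by blast
  then have "word_raise i (dual_word n v) = Some (dual_word n w)"
    using word_raise_dual_word[of v n i w] i r by (simp add: word_lower_raise)
  then show ?thesis by (simp add: word_lower_raise)
qed

lemma word_lower_commute:
  assumes w: "w \<in> lists {1..n}" and ij: "i \<in> {1..<n}" "j \<in> {1..<n}" "i \<noteq> j"
    and v: "word_lower i w = Some v" and u: "word_lower j w = Some u"
    and phi: "word_phi j v = word_phi j w"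
  shows "\<exists>t. word_lower j v = Some t \<and> word_lower i u = Some t"
proof -
  let ?d = "dual_word n"
  have r: "n - i \<in> {1..<n}" "n - j \<in> {1..<n}" "n - (n - i) = i" "n - (n - j) = j" "n - i \<noteq> n - j"
    using ij by auto
  have vu: "v \<in> lists {1..n}" "u \<in> lists {1..n}" using word_lower_lists w ij v u by metis+
  have "word_raise (n - i) (?d w) = Some (?d v)" "word_raise (n - j) (?d w) = Some (?d u)"
    using word_raise_dual_word[OF w r(1)] word_raise_dual_word[OF w r(2)] r v u by auto
  moreover have "word_eps (n - j) (?d v) = word_eps (n - j) (?d w)"
    using word_eps_dual_word[OF vu(1) r(2)] word_eps_dual_word[OF w r(2)] phi r by simp
  ultimately obtain t where "word_raise (n - j) (?d v) = Some t" "word_raise (n - i) (?d u) = Some t"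
    using word_raise_commute r(5) by blast
  then have "word_lower j (?d (?d v)) = Some (?d t)" "word_lower i (?d (?d u)) = Some (?d t)"
    using word_lower_dual_word dual_word_in_lists vu ij by metis+
  then show ?thesis using dual_word_dual_word vu by metis
qed

lemma word_lower_braid:
  assumes w: "w \<in> lists {1..n}" and ij: "i \<in> {1..<n}" "j \<in> {1..<n}" "i \<noteq> j"
    and v: "word_lower i w = Some v" and u: "word_lower j w = Some u"
    and phi: "word_phi j v \<noteq> word_phi j w" "word_phi i u \<noteq> word_phi i w"
  obtains v1 v2 u1 u2 t where
    "word_lower j v = Some v1" "word_lower j v1 = Some v2" "word_lower i v2 = Some t"
    "word_lower i u = Some u1" "word_lower i u1 = Some u2" "word_lower j u2 = Some t"
proof -
  let ?d = "dual_word n"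
  have r: "n - i \<in> {1..<n}" "n - j \<in> {1..<n}" "n - (n - i) = i" "n - (n - j) = j" "n - i \<noteq> n - j"
    using ij by auto
  have vu: "v \<in> lists {1..n}" "u \<in> lists {1..n}" using word_lower_lists w ij v u by metis+
  have "word_raise (n - i) (?d w) = Some (?d v)" "word_raise (n - j) (?d w) = Some (?d u)"
    using word_raise_dual_word[OF w r(1)] word_raise_dual_word[OF w r(2)] r v u by auto
  moreover have "word_eps (n - j) (?d v) \<noteq> word_eps (n - j) (?d w)"
    using word_eps_dual_word[OF vu(1) r(2)] word_eps_dual_word[OF w r(2)] phi r by auto
  moreover have "word_eps (n - i) (?d u) \<noteq> word_eps (n - i) (?d w)"
    using word_eps_dual_word[OF vu(2) r(1)] word_eps_dual_word[OF w r(1)] phi r by auto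
  ultimately obtain v1 v2 u1 u2 t where *:
    "word_raise (n - j) (?d v) = Some v1" "word_raise (n - j) v1 = Some v2" "word_raise (n - i) v2 = Some t"
    "word_raise (n - i) (?d u) = Some u1" "word_raise (n - i) u1 = Some u2" "word_raise (n - j) u2 = Some t"
    by (rule word_raise_braid[OF r(5)])
  have l: "v1 \<in> lists {1..n}" "v2 \<in> lists {1..n}" "u1 \<in> lists {1..n}" "u2 \<in> lists {1..n}"
    using * word_raise_lists dual_word_in_lists vu r by metis+
  have "word_lower j (?d (?d v)) = Some (?d v1)" "word_lower j (?d v1) = Some (?d v2)" "word_lower i (?d v2) = Some (?d t)"
    "word_lower i (?d (?d u)) = Some (?d u1)" "word_lower i (?d u1) = Some (?d u2)" "word_lower j (?d u2) = Some (?d t)"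
    using * word_lower_dual_word dual_word_in_lists vu ij l by metis+
  then show ?thesis using that dual_word_dual_word vu by metis
qed

section \<open>Matching two components rank by rank\<close>

inductive lower_pair :: "nat \<Rightarrow> nat list \<Rightarrow> nat list \<Rightarrow> nat \<Rightarrow> nat list \<Rightarrow> nat list \<Rightarrow> bool"
  for n h h' where
  start: "lower_pair n h h' 0 h h'"
| lower: "lower_pair n h h' k x x' \<Longrightarrow> i \<in> {1..<n} \<Longrightarrow> word_lower i x = Some y \<Longrightarrow> word_lower i x' = Some y'
    \<Longrightarrow> lower_pair n h h' (Suc k) y y'"

lemma lower_pair_sym: "lower_pair n h h' k x x' \<Longrightarrow> lower_pair n h' h k x' x"
  by (induction rule: lower_pair.induct) (auto intro: lower_pair.intros)

text \<open>Equal end points of the paths are equal differences of consecutive weights; they turn an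
  equality of \<open>word_eps\<close> into one of \<open>word_phi\<close>.\<close>

definition highest_pair :: "nat \<Rightarrow> nat list \<Rightarrow> nat list \<Rightarrow> bool" where
  "highest_pair n h h' \<longleftrightarrow> h \<in> lists {1..n} \<and> h' \<in> lists {1..n} \<and>
     (\<forall>i\<in>{1..<n}. word_raise i h = None \<and> word_raise i h' = None \<and>
        ht i h (length h) = ht i h' (length h'))"

lemma highest_pair_sym: "highest_pair n h h' \<Longrightarrow> highest_pair n h' h"
  by (auto simp: highest_pair_def)

lemma lower_pair_lists:
  "lower_pair n h h' k x x' \<Longrightarrow> highest_pair n h h' \<Longrightarrow> x \<in> lists {1..n} \<and> x' \<in> lists {1..n}"
  by (induction rule: lower_pair.induct) (use word_lower_lists in \<open>auto simp: highest_pair_def\<close>)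

lemma lower_pair_ht:
  "lower_pair n h h' k x x' \<Longrightarrow> highest_pair n h h' \<Longrightarrow> i \<in> {1..<n} \<Longrightarrow>
    ht i x (length x) = ht i x' (length x')"
proof (induction rule: lower_pair.induct)
  case (lower k x x' j y y')
  then show ?case
    using word_raise_ht(1)[of j y x i] word_raise_ht(1)[of j y' x' i] by (simp add: word_lower_raise)
qed (simp add: highest_pair_def)

text \<open>A pair records one common lowering path. The point is that every raise, not only the one
  undoing the last lowering, has a partner.\<close>

definition raise_lifts :: "nat \<Rightarrow> nat list \<Rightarrow> nat list \<Rightarrow> nat \<Rightarrow> bool" where
  "raise_lifts n h h' k \<longleftrightarrow> (\<forall>x x' i y. lower_pair n h h' k x x' \<and> i \<in> {1..<n} \<and> word_raise i x = Some y \<longrightarrow>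
     (\<exists>k' y'. k = Suc k' \<and> word_raise i x' = Some y' \<and> lower_pair n h h' k' y y'))"

lemma raise_liftsD:
  assumes "raise_lifts n h h' k" "lower_pair n h h' k x x'" "i \<in> {1..<n}" "word_raise i x = Some y"
  obtains k' y' where "k = Suc k'" "word_raise i x' = Some y'" "lower_pair n h h' k' y y'"
  using assms unfolding raise_lifts_def by blast

text \<open>Each raise of \<open>x\<close> is copied by \<open>x'\<close>, so \<open>x'\<close> can
  be raised at least as often. Exchanging the two components yields equality.\<close>

lemma raise_lifts_eps_le:
  assumes "\<And>l. l \<le> k \<Longrightarrow> raise_lifts n h h' l" "lower_pair n h h' k x x'" "i \<in> {1..<n}"
  shows "word_eps i x \<le> word_eps i x'"
  using assms
proof (induction "word_eps i x" arbitrary: k x x')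
  case (Suc e)
  then obtain y where y: "word_raise i x = Some y" using word_raise_None[of i x] by fastforce
  obtain k' y' where k': "k = Suc k'" "word_raise i x' = Some y'" "lower_pair n h h' k' y y'"
    using raise_liftsD[OF Suc.prems(1)[of k] Suc.prems(2,3) y] by blast
  have "word_eps i y \<le> word_eps i y'"
    using Suc.hyps(1)[of y k' y'] Suc.hyps(2) word_raise_eps[OF y] Suc.prems k' by simp
  then show ?case using word_raise_eps[OF y] word_raise_eps[OF k'(2)] by simp
qed simp

text \<open>Induction on the rank. If \<open>x\<close> arises by lowering \<open>u\<close> in
  direction \<open>j\<close> and is raised in another direction \<open>i\<close>, the raising
  relation at \<open>x\<close> leads to a word \<open>t\<close> of smaller rank. Its partner is
  reached from that of \<open>u\<close>, and the lowering relation there closes the same polygon,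
  since \<open>word_phi\<close> agrees at smaller ranks.\<close>

lemma raise_lifts: "highest_pair n h h' \<Longrightarrow> raise_lifts n h h' k"
proof (induction k arbitrary: h h' rule: less_induct)
  case (less k)
  note hp = less.prems
  have IH: "raise_lifts n h h' l" "raise_lifts n h' h l" if "l < k" for l
    using less.IH that hp highest_pair_sym by blast+
  have eps: "word_eps i x = word_eps i x'" "word_phi i x = word_phi i x'"
    if "l < k" "lower_pair n h h' l x x'" "i \<in> {1..<n}" for l x x' i
  proof -
    show *: "word_eps i x = word_eps i x'"
      using raise_lifts_eps_le[of l n h h' x x' i] raise_lifts_eps_le[of l n h' h x' x i]
        IH that lower_pair_sym by (meson le_less_trans order_antisym)
    show "word_phi i x = word_phi i x'"
      using * lower_pair_ht[OF that(2) hp that(3)] unfolding word_phi_def by simp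
  qed
  have lowerable: "\<exists>y'. word_lower i x' = Some y' \<and> lower_pair n h h' (Suc l) y y'"
    if "l < k" "lower_pair n h h' l x x'" "i \<in> {1..<n}" "word_lower i x = Some y" for l x x' y i
  proof -
    from that(4) obtain p where p: "last_max i x p" unfolding word_lower_iff by blast
    then have "ht i x (length x) < int (word_eps i x)" using last_max_eps[OF p] unfolding last_max_def by auto
    then have "word_phi i x' \<noteq> 0" using eps[OF that(1-3)] unfolding word_phi_def by simp
    then have "word_lower i x' \<noteq> None" using word_lower_None[of i x'] unfolding word_phi_def by auto
    then show ?thesis using lower_pair.lower[OF that(2,3,4)] by blast
  qed
  show ?case
    unfolding raise_lifts_def
  proof (intro allI impI, elim conjE)
    fix x x' i y
    assume x: "lower_pair n h h' k x x'" and i: "i \<in> {1..<n}" and y: "word_raise i x = Some y"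
    from x show "\<exists>k' y'. k = Suc k' \<and> word_raise i x' = Some y' \<and> lower_pair n h h' k' y y'"
    proof cases
      case start
      then show ?thesis using hp i y unfolding highest_pair_def by auto
    next
      case (lower m u u' j)
      have mk: "m < k" using lower by simp
      have u: "word_raise j x = Some u" "word_raise j x' = Some u'" using lower by (simp_all add: word_lower_raise)
      have up: "lower_pair n h h' m u u'" and j: "j \<in> {1..<n}" using lower by auto
      show ?thesis
      proof (cases "i = j")
        case True
        then show ?thesis using u y lower by auto
      next
        case ij: False
        \<comment> \<open>\<open>word_raise_commute\<close> yields one of the two alternatives,
          depending on which of the two maxima is left unchanged; either one supports the lowering
          square at \<open>t'\<close>.\<close>
        have comm: ?thesis
          if t: "word_raise j y = Some t" "word_raise i u = Some t"
            and phi: "word_phi i y = word_phi i t \<or> word_phi j u = word_phi j t" for t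
        proof -
          obtain m' t' where t': "m = Suc m'" "word_raise i u' = Some t'" "lower_pair n h h' m' t t'"
            by (rule raise_liftsD[OF IH(1)[OF mk] up i t(2)])
          obtain y' where y': "word_lower j t' = Some y'" "lower_pair n h h' m y y'"
            using lowerable[of m' t t' j y] t' mk j t(1) by (auto simp: word_lower_raise)
          have l: "t' \<in> lists {1..n}" using lower_pair_lists[OF t'(3) hp] by simp
          have tu: "word_lower i t' = Some u'" using t'(2) by (simp add: word_lower_raise)
          have "m' < k" using t' mk by simp
          then have "word_phi i y' = word_phi i t' \<or> word_phi j u' = word_phi j t'"
            using phi eps(2)[OF mk y'(2) i] eps(2)[OF mk up j] eps(2)[OF \<open>m' < k\<close> t'(3) i] eps(2)[OF \<open>m' < k\<close> t'(3) j] by auto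
          then obtain s where "word_lower i y' = Some s" "word_lower j u' = Some s"
            using word_lower_commute[OF l j i ij[symmetric] y'(1) tu] word_lower_commute[OF l i j ij tu y'(1)] by blast
          then have "word_raise i y' = None \<or> word_lower i y' = Some x'" using lower by simp
          then have "word_raise i x' = Some y'"
            using \<open>word_lower i y' = Some s\<close> \<open>word_lower j u' = Some s\<close> lower by (simp add: word_lower_raise)
          then show ?thesis using y'(2) lower(1) by blast
        qed
        consider "word_eps j y = word_eps j x" | "word_eps i u = word_eps i x"
          | "word_eps j y \<noteq> word_eps j x" "word_eps i u \<noteq> word_eps i x" by blast
        then show ?thesis
        proof cases
          case 1
          then show ?thesis using word_raise_commute[OF ij y u(1)] comm by blast
        next
          case 2
          then show ?thesis using word_raise_commute[OF ij[symmetric] u(1) y] comm by blast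
        next
          case 3
          obtain v1 v2 u1 u2 t where c:
            "word_raise j y = Some v1" "word_raise j v1 = Some v2" "word_raise i v2 = Some t"
            "word_raise i u = Some u1" "word_raise i u1 = Some u2" "word_raise j u2 = Some t"
            "word_phi j v2 \<noteq> word_phi j t" "word_phi i u2 \<noteq> word_phi i t"
            by (rule word_raise_braid[OF ij y u(1) 3])
          obtain m1 u1' where u1: "m = Suc m1" "word_raise i u' = Some u1'" "lower_pair n h h' m1 u1 u1'"
            by (rule raise_liftsD[OF IH(1)[OF mk] up i c(4)])
          have m1: "m1 < k" using u1 mk by simp
          obtain m2 u2' where u2: "m1 = Suc m2" "word_raise i u1' = Some u2'" "lower_pair n h h' m2 u2 u2'"
            by (rule raise_liftsD[OF IH(1)[OF m1] u1(3) i c(5)])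
          have m2: "m2 < k" using u2 m1 by simp
          obtain m3 t' where t: "m2 = Suc m3" "word_raise j u2' = Some t'" "lower_pair n h h' m3 t t'"
            by (rule raise_liftsD[OF IH(1)[OF m2] u2(3) j c(6)])
          have m3: "m3 < k" using t m2 by simp
          obtain v2' where v2: "word_lower i t' = Some v2'" "lower_pair n h h' m2 v2 v2'"
            using lowerable[OF m3 t(3) i] c(3) t(1) by (auto simp: word_lower_raise)
          obtain v1' where v1: "word_lower j v2' = Some v1'" "lower_pair n h h' m1 v1 v1'"
            using lowerable[OF m2 v2(2) j] c(2) u2(1) by (auto simp: word_lower_raise)
          obtain y' where y': "word_lower j v1' = Some y'" "lower_pair n h h' m y y'"
            using lowerable[OF m1 v1(2) j] c(1) u1(1) by (auto simp: word_lower_raise)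
          have l: "t' \<in> lists {1..n}" using lower_pair_lists[OF t(3) hp] by simp
          have tu: "word_lower j t' = Some u2'" using t(2) by (simp add: word_lower_raise)
          have phi: "word_phi j v2' \<noteq> word_phi j t'" "word_phi i u2' \<noteq> word_phi i t'"
            using c(7,8) eps(2)[OF m2 v2(2) j] eps(2)[OF m3 t(3) j] eps(2)[OF m2 u2(3) i] eps(2)[OF m3 t(3) i] by auto
          obtain p1 p2 q1 q2 s where d:
            "word_lower j v2' = Some p1" "word_lower j p1 = Some p2" "word_lower i p2 = Some s"
            "word_lower i u2' = Some q1" "word_lower i q1 = Some q2" "word_lower j q2 = Some s"
            by (rule word_lower_braid[OF l i j ij v2(1) tu phi])
          have "q1 = u1'" using d(4) u2(2) by (simp add: word_lower_raise[symmetric])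
          then have "q2 = u'" using d(5) u1(2) by (simp add: word_lower_raise[symmetric])
          then have "s = x'" using d(6) lower by simp
          moreover have "p2 = y'" using d(1,2) v1(1) y'(1) by simp
          ultimately have "word_raise i x' = Some y'" using d(3) by (simp add: word_lower_raise)
          then show ?thesis using y'(2) lower(1) by blast
        qed
      qed
    qed
  qed
qed

lemma lower_pair_eps:
  assumes hp: "highest_pair n h h'" and x: "lower_pair n h h' k x x'" and i: "i \<in> {1..<n}"
  shows "word_eps i x = word_eps i x'"
proof (rule order_antisym)
  show "word_eps i x \<le> word_eps i x'"
    using raise_lifts_eps_le[OF raise_lifts[OF hp] x i] .
  show "word_eps i x' \<le> word_eps i x"
    using raise_lifts_eps_le[OF raise_lifts[OF highest_pair_sym[OF hp]] lower_pair_sym[OF x] i] .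
qed

lemma lower_pair_lowerable:
  assumes hp: "highest_pair n h h'" and x: "lower_pair n h h' k x x'" and i: "i \<in> {1..<n}"
    and y: "word_lower i x = Some y"
  obtains y' where "word_lower i x' = Some y'" "lower_pair n h h' (Suc k) y y'"
proof -
  from y obtain p where p: "last_max i x p" unfolding word_lower_iff by blast
  then have "ht i x (length x) < int (word_eps i x)" using last_max_eps[OF p] unfolding last_max_def by auto
  then have "ht i x' (length x') \<noteq> int (word_eps i x')"
    using lower_pair_eps[OF hp x i] lower_pair_ht[OF x hp i] by simp
  then have "word_lower i x' \<noteq> None" using word_lower_None[of i x'] by auto
  then show ?thesis using lower_pair.lower[OF x i y] that by blast
qed

lemma word_raise_sum_list: "word_raise i w = Some v \<Longrightarrow> sum_list w = Suc (sum_list v)"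
proof -
  assume "word_raise i w = Some v"
  then obtain p where p: "first_max i w p" "v = w[p := i]" unfolding word_raise_iff by blast
  have l: "p < length w" "w ! p = i + 1" using p first_max_letter(1) unfolding first_max_def by auto
  then have "w ! p \<le> sum_list w" using elem_le_sum_list by blast
  then show ?thesis using l p by (simp add: sum_list_update)
qed

lemma lower_pair_sum_list: "lower_pair n h h' k x x' \<Longrightarrow> sum_list x = sum_list h + k"
  by (induction rule: lower_pair.induct) (auto simp: word_lower_raise dest: word_raise_sum_list)

text \<open>Lowering is a function with raising as its inverse, so the partner of a word is
  determined by the partner of a raised word. In rank 0 the sum of the letters forces the other rank
  to be 0 as well.\<close>

lemma lower_pair_functional:
  assumes hp: "highest_pair n h h'"
  shows "lower_pair n h h' k x x' \<Longrightarrow> lower_pair n h h' l x x'' \<Longrightarrow> x' = x''"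
proof (induction k arbitrary: l x x' x'')
  case 0
  have "l = 0" using lower_pair_sum_list[OF 0(1)] lower_pair_sum_list[OF 0(2)] by simp
  then show ?case using 0 by (auto elim: lower_pair.cases)
next
  case (Suc k)
  from Suc.prems(1) obtain i u u' where u: "lower_pair n h h' k u u'" "i \<in> {1..<n}"
    "word_lower i u = Some x" "word_lower i u' = Some x'"
    by (auto elim: lower_pair.cases)
  then have r: "word_raise i x = Some u" by (simp add: word_lower_raise)
  obtain l' u'' where u'': "word_raise i x'' = Some u''" "lower_pair n h h' l' u u''"
    by (rule raise_liftsD[OF raise_lifts[OF hp] Suc.prems(2) u(2) r])
  have "u' = u''" using Suc.IH[OF u(1) u''(2)] .
  then show ?case using u(4) u''(1) by (simp add: word_lower_raise[symmetric])
qed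

section \<open>Connected components\<close>

abbreviation word_component :: "nat \<Rightarrow> nat list \<Rightarrow> nat list set" where
  "word_component n h \<equiv> component (lists {1..n}) {1..<n} word_raise h"

lemma component_refl: "x \<in> component V I e x"
  by (simp add: component_def)

lemma component_raise:
  assumes "x \<in> component V I e h" "x \<in> V" "y \<in> V" "i \<in> I" "e i x = Some y"
  shows "y \<in> component V I e h"
proof -
  have "(x, y) \<in> edges V I e \<union> (edges V I e)\<inverse>" using assms unfolding edges_def by auto
  then show ?thesis using assms(1) unfolding component_def by (auto intro: rtrancl_into_rtrancl)
qed

lemma component_lower:
  assumes "x \<in> component V I e h" "x \<in> V" "y \<in> V" "i \<in> I" "e i y = Some x"
  shows "y \<in> component V I e h"
proof -
  have "(x, y) \<in> edges V I e \<union> (edges V I e)\<inverse>" using assms unfolding edges_def by auto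
  then show ?thesis using assms(1) unfolding component_def by (auto intro: rtrancl_into_rtrancl)
qed

lemma component_induct [consumes 1, case_names start raise lower]:
  assumes "x \<in> component V I e h" "P h"
    and "\<And>i x y. P x \<Longrightarrow> x \<in> V \<Longrightarrow> y \<in> V \<Longrightarrow> i \<in> I \<Longrightarrow> e i x = Some y \<Longrightarrow> P y"
    and "\<And>i x y. P x \<Longrightarrow> x \<in> V \<Longrightarrow> y \<in> V \<Longrightarrow> i \<in> I \<Longrightarrow> e i y = Some x \<Longrightarrow> P y"
  shows "P x"
proof -
  have "(h, x) \<in> (edges V I e \<union> (edges V I e)\<inverse>)\<^sup>*" using assms(1) unfolding component_def by auto
  then show ?thesis
  proof (induction rule: rtrancl_induct)
    case base
    show ?case by fact
  next
    case (step y z)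
    then consider "(y, z) \<in> edges V I e" | "(z, y) \<in> edges V I e" by blast
    then show ?case
      using step.IH assms(3)[of y z] assms(4)[of y z] unfolding edges_def by cases blast+
  qed
qed

lemma component_subset: "h \<in> V \<Longrightarrow> x \<in> component V I e h \<Longrightarrow> x \<in> V"
  by (erule component_induct) auto

lemma component_eq:
  assumes "x \<in> component V I e h"
  shows "component V I e x = component V I e h"
proof -
  let ?R = "(edges V I e \<union> (edges V I e)\<inverse>)\<^sup>*"
  have "sym ?R" by (intro sym_rtrancl) (auto simp: sym_def)
  moreover have "(h, x) \<in> ?R" using assms unfolding component_def by auto
  ultimately have "(x, h) \<in> ?R" "(h, x) \<in> ?R" by (auto dest: symD)
  then show ?thesis unfolding component_def by (auto intro: rtrancl_trans)
qed

lemma lower_pair_component: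
  "lower_pair n h h' k x x' \<Longrightarrow> highest_pair n h h' \<Longrightarrow> x \<in> word_component n h"
proof (induction rule: lower_pair.induct)
  case (lower k x x' i y y')
  then have "x \<in> lists {1..n}" "y \<in> lists {1..n}"
    using lower_pair_lists word_lower_lists by blast+
  then show ?case using component_lower[of x _ _ _ h y i] lower by (simp add: word_lower_raise)
qed (rule component_refl)

lemma component_lower_pair:
  assumes hp: "highest_pair n h h'" and x: "x \<in> word_component n h"
  shows "\<exists>k x'. lower_pair n h h' k x x'"
  using x
proof (induction rule: component_induct)
  case start
  show ?case using lower_pair.start by blast
next
  case (raise i x y)
  then obtain k x' where x': "lower_pair n h h' k x x'" by blast
  obtain k' y' where "lower_pair n h h' k' y y'"
    by (rule raise_liftsD[OF raise_lifts[OF hp] x' raise(4,5)])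
  then show ?case by blast
next
  case (lower i x y)
  then obtain k x' where x': "lower_pair n h h' k x x'" by blast
  have "word_lower i x = Some y" using lower by (simp add: word_lower_raise)
  then obtain y' where "lower_pair n h h' (Suc k) y y'"
    using lower_pair_lowerable[OF hp x' lower(4)] by blast
  then show ?case by blast
qed

lemma count_list_update:
  "p < length w \<Longrightarrow> int (count_list (w[p := y]) m) =
    int (count_list w m) + (if m = y then 1 else 0) - (if m = w ! p then 1 else 0)"
proof (induction w arbitrary: p)
  case (Cons x w)
  show ?case
  proof (cases p)
    case (Suc q)
    then show ?thesis using Cons.IH[of q] Cons.prems by (cases "x = m") simp_all
  qed simp
qed simp

lemma word_raise_count:
  assumes "word_raise i w = Some v"
  shows "int (count_list v m) = int (count_list w m) + (if m = i then 1 else 0) - (if m = i + 1 then 1 else 0)"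
proof -
  obtain p where p: "first_max i w p" "v = w[p := i]" using assms unfolding word_raise_iff by blast
  then show ?thesis using first_max_letter(1)[OF p(1)] count_list_update[of p w i m] unfolding first_max_def by simp
qed

lemma lower_pair_count:
  "lower_pair n h h' k x x' \<Longrightarrow> count_list h m = count_list h' m \<Longrightarrow> count_list x m = count_list x' m"
proof (induction rule: lower_pair.induct)
  case (lower k x x' i y y')
  then show ?case using word_raise_count[of i y x m] word_raise_count[of i y' x' m] by (simp add: word_lower_raise)
qed simp

section \<open>The isomorphism between components of equal highest weight\<close>

definition word_transport :: "nat \<Rightarrow> nat list \<Rightarrow> nat list \<Rightarrow> nat list \<Rightarrow> nat list" where
  "word_transport n h h' x = (THE x'. \<exists>k. lower_pair n h h' k x x')"

context
  fixes n h h'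
  assumes hp: "highest_pair n h h'"
begin

lemma word_transport_eq: "lower_pair n h h' k x x' \<Longrightarrow> word_transport n h h' x = x'"
  unfolding word_transport_def by (rule the_equality) (use lower_pair_functional[OF hp] in blast)+

lemma word_transport_pair:
  "x \<in> word_component n h \<Longrightarrow> \<exists>k. lower_pair n h h' k x (word_transport n h h' x)"
  using component_lower_pair[OF hp] word_transport_eq by blast

lemma word_transport_component:
  assumes "x \<in> word_component n h"
  shows "word_transport n h h' x \<in> word_component n h'"
  using word_transport_pair[OF assms] lower_pair_sym lower_pair_component highest_pair_sym[OF hp] by blast

lemma word_transport_highest: "word_transport n h h' h = h'"
  using word_transport_eq lower_pair.start by blast

lemma word_transport_inj: "inj_on (word_transport n h h') (word_component n h)"
proof (rule inj_onI)
  fix x y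
  assume xy: "x \<in> word_component n h" "y \<in> word_component n h"
    and eq: "word_transport n h h' x = word_transport n h h' y"
  obtain k where k: "lower_pair n h h' k x (word_transport n h h' x)" using word_transport_pair[OF xy(1)] by blast
  obtain l where l: "lower_pair n h h' l y (word_transport n h h' y)" using word_transport_pair[OF xy(2)] by blast
  show "x = y"
    using lower_pair_functional[OF highest_pair_sym[OF hp] lower_pair_sym[OF k]] lower_pair_sym[OF l] eq by simp
qed

lemma word_transport_raise:
  assumes x: "x \<in> word_component n h" and i: "i \<in> {1..<n}"
  shows "word_raise i (word_transport n h h' x) = map_option (word_transport n h h') (word_raise i x)"
proof -
  obtain k where k: "lower_pair n h h' k x (word_transport n h h' x)" using word_transport_pair[OF x] by blast
  show ?thesis
  proof (cases "word_raise i x")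
    case None
    then show ?thesis
      using lower_pair_eps[OF hp k i] word_raise_None[of i x] word_raise_None[of i "word_transport n h h' x"] by simp
  next
    case (Some y)
    obtain k' y' where "word_raise i (word_transport n h h' x) = Some y'" "lower_pair n h h' k' y y'"
      by (rule raise_liftsD[OF raise_lifts[OF hp] k i Some])
    then show ?thesis using Some word_transport_eq by simp
  qed
qed

lemma word_transport_lower:
  assumes x: "x \<in> word_component n h" and i: "i \<in> {1..<n}" and y: "word_lower i x = Some y"
  shows "word_lower i (word_transport n h h' x) = Some (word_transport n h h' y)"
proof -
  obtain k where k: "lower_pair n h h' k x (word_transport n h h' x)" using word_transport_pair[OF x] by blast
  obtain y' where "word_lower i (word_transport n h h' x) = Some y'" "lower_pair n h h' (Suc k) y y'"
    by (rule lower_pair_lowerable[OF hp k i y])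
  then show ?thesis using word_transport_eq by simp
qed

lemma word_transport_lower_None:
  assumes x: "x \<in> word_component n h" and i: "i \<in> {1..<n}" and y: "word_lower i x = None"
  shows "word_lower i (word_transport n h h' x) = None"
proof (rule ccontr)
  assume "word_lower i (word_transport n h h' x) \<noteq> None"
  then obtain y' where y': "word_lower i (word_transport n h h' x) = Some y'" by blast
  obtain k where k: "lower_pair n h h' k x (word_transport n h h' x)" using word_transport_pair[OF x] by blast
  obtain z where "word_lower i x = Some z"
    by (rule lower_pair_lowerable[OF highest_pair_sym[OF hp] lower_pair_sym[OF k] i y'])
  then show False using y by simp
qed

lemma word_transport_count:
  assumes "x \<in> word_component n h" "count_list h m = count_list h' m"
  shows "count_list (word_transport n h h' x) m = count_list x m"
proof -
  obtain k where "lower_pair n h h' k x (word_transport n h h' x)" using word_transport_pair[OF assms(1)] by blast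
  from lower_pair_count[OF this assms(2)] show ?thesis by simp
qed

end

section \<open>Pairing and records\<close>

lemma diagram_eq: "diagram n a = Sigma {1..n} (\<lambda>r. {1..a r})"
  by (auto simp: diagram_def)

lemma finite_diagram [simp]: "finite (diagram n a)"
  by (simp add: diagram_eq)

lemma card_le_by_relation:
  assumes "finite U" "\<And>x. x \<in> L \<Longrightarrow> \<exists>u\<in>U. (x, u) \<in> R"
    and "\<And>x y u. (x, u) \<in> R \<Longrightarrow> (y, u) \<in> R \<Longrightarrow> x = y"
  shows "card L \<le> card U"
proof -
  obtain f where f: "\<forall>x\<in>L. f x \<in> U \<and> (x, f x) \<in> R" using bchoice[of L "\<lambda>x u. u \<in> U \<and> (x, u) \<in> R"] assms(2) by blast
  have "inj_on f L"
  proof (rule inj_onI)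
    fix x y assume "x \<in> L" "y \<in> L" "f x = f y"
    then have "(x, f x) \<in> R" "(y, f x) \<in> R" using f by auto
    then show "x = y" by (rule assms(3))
  qed
  then show ?thesis using f assms(1) by (intro card_inj_on_le[of f]) auto
qed

locale column_injective =
  fixes n :: nat and a :: "nat \<Rightarrow> nat" and T :: filling
  assumes column_inj: "\<lbrakk>x \<in> diagram n a; y \<in> diagram n a; snd x = snd y; T x = T y\<rbrakk> \<Longrightarrow> x = y"
begin

abbreviation "cells m \<equiv> cells_of n a T m"

definition col_ht :: "nat \<Rightarrow> nat \<Rightarrow> int" where
  "col_ht i k = int (card {x \<in> cells (i + 1). snd x \<le> k}) - int (card {x \<in> cells i. snd x \<le> k})"

lemma finite_cells [simp]: "finite (cells m)"
  by (rule finite_subset[of _ "diagram n a"]) (auto simp: cells_of_def)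

lemma cells_inj: "x \<in> cells m \<Longrightarrow> y \<in> cells m \<Longrightarrow> snd x = snd y \<Longrightarrow> x = y"
  using column_inj by (auto simp: cells_of_def)

lemma cells_inj': "(r, d) \<in> cells m \<Longrightarrow> (s, d) \<in> cells m \<Longrightarrow> r = s"
  using cells_inj by fastforce

lemma cells_disjoint: "x \<in> cells m \<Longrightarrow> x \<in> cells l \<Longrightarrow> m = l"
  by (auto simp: cells_of_def)

lemma cells_col_pos: "x \<in> cells m \<Longrightarrow> 0 < snd x"
  by (auto simp: cells_of_def diagram_def)

lemma col_ht_diff:
  assumes "k \<le> l"
  shows "col_ht i l - col_ht i k = int (card {x \<in> cells (i + 1). k < snd x \<and> snd x \<le> l})
    - int (card {x \<in> cells i. k < snd x \<and> snd x \<le> l})"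
proof -
  have "card {x \<in> cells m. snd x \<le> l} = card {x \<in> cells m. snd x \<le> k} + card {x \<in> cells m. k < snd x \<and> snd x \<le> l}" for m
  proof -
    have "{x \<in> cells m. snd x \<le> l} = {x \<in> cells m. snd x \<le> k} \<union> {x \<in> cells m. k < snd x \<and> snd x \<le> l}"
      using assms by auto
    then show ?thesis by (simp only:) (subst card_Un_disjoint, auto)
  qed
  then show ?thesis unfolding col_ht_def by simp
qed

lemma card_column: "card {x \<in> cells m. k < snd x \<and> snd x \<le> Suc k} = (if \<exists>x\<in>cells m. snd x = Suc k then 1 else 0)"
proof (cases "\<exists>x\<in>cells m. snd x = Suc k")
  case True
  then obtain x where x: "x \<in> cells m" "snd x = Suc k" by blast
  have "z = x" if "z \<in> cells m" "k < snd z" "snd z \<le> Suc k" for z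
    using cells_inj[OF that(1) x(1)] that x(2) by simp
  moreover have "k < snd x" "snd x \<le> Suc k" using x by auto
  ultimately have "{x \<in> cells m. k < snd x \<and> snd x \<le> Suc k} = {x}" using x by blast
  then show ?thesis using True by simp
next
  case False
  then have "{x \<in> cells m. k < snd x \<and> snd x \<le> Suc k} = {}" by (auto simp: le_Suc_eq)
  then show ?thesis using False by (simp only: card.empty if_False)
qed

lemma col_ht_Suc:
  "col_ht i (Suc k) = col_ht i k + (if \<exists>x\<in>cells (i + 1). snd x = Suc k then 1 else 0)
    - (if \<exists>x\<in>cells i. snd x = Suc k then 1 else 0)"
  using col_ht_diff[of k "Suc k" i] unfolding card_column
  by (cases "\<exists>x\<in>cells (i + 1). snd x = Suc k"; cases "\<exists>x\<in>cells i. snd x = Suc k") simp_all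

lemma col_ht_0 [simp]: "col_ht i 0 = 0"
proof -
  have "\<not> snd x \<le> 0" if "x \<in> cells m" for x m using cells_col_pos[OF that] by simp
  then have "{x \<in> cells m. snd x \<le> 0} = {}" for m by blast
  then show ?thesis unfolding col_ht_def by (simp only: card.empty)
qed

text \<open>Strict left-to-right maxima of the height. The positive ones will be exactly the columns
  of the unpaired \<open>i + 1\<close>; column 0 is a record for trivial reasons.\<close>

definition record_col :: "nat \<Rightarrow> nat \<Rightarrow> bool" where
  "record_col i c \<longleftrightarrow> (\<forall>k<c. col_ht i k < col_ht i c)"

text \<open>The last clause is the nesting of pairs: whatever lies in the span of a pair has its
  partner inside the span, so the span contains equally many of both entries.\<close>

definition stage_inv :: "nat \<Rightarrow> cell rel \<Rightarrow> bool" where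
  "stage_inv i P \<longleftrightarrow> P \<subseteq> cells i \<times> cells (i + 1) \<and>
     (\<forall>x\<in>cells i. \<forall>y\<in>cells (i + 1). snd x = snd y \<longrightarrow> (x, y) \<in> P) \<and>
     (\<forall>(x, y)\<in>P. snd x \<le> snd y) \<and> single_valued P \<and> single_valued (P\<inverse>) \<and>
     (\<forall>(x, y)\<in>P. \<forall>z\<in>cells i \<union> cells (i + 1). snd x < snd z \<and> snd z < snd y \<longrightarrow>
        (\<exists>(u, v)\<in>P. (z = u \<or> z = v) \<and> snd x < snd u \<and> snd v < snd y))"

lemma
  assumes "stage_inv i P"
  shows stage_sub: "(x, y) \<in> P \<Longrightarrow> x \<in> cells i \<and> y \<in> cells (i + 1)"
    and stage_column: "x \<in> cells i \<Longrightarrow> y \<in> cells (i + 1) \<Longrightarrow> snd x = snd y \<Longrightarrow> (x, y) \<in> P"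
    and stage_le: "(x, y) \<in> P \<Longrightarrow> snd x \<le> snd y"
    and stage_right: "(x, y) \<in> P \<Longrightarrow> (x, y') \<in> P \<Longrightarrow> y = y'"
    and stage_left: "(x, y) \<in> P \<Longrightarrow> (x', y) \<in> P \<Longrightarrow> x = x'"
    and stage_nested: "(x, y) \<in> P \<Longrightarrow> z \<in> cells i \<union> cells (i + 1) \<Longrightarrow> snd x < snd z \<Longrightarrow> snd z < snd y \<Longrightarrow>
      \<exists>u v. (u, v) \<in> P \<and> (z = u \<or> z = v) \<and> snd x < snd u \<and> snd v < snd y"
proof -
  show "x \<in> cells i \<and> y \<in> cells (i + 1)" if "(x, y) \<in> P"
    using assms that unfolding stage_inv_def by (elim conjE) blast
  show "(x, y) \<in> P" if "x \<in> cells i" "y \<in> cells (i + 1)" "snd x = snd y"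
    using assms that unfolding stage_inv_def by (elim conjE) blast
  show "snd x \<le> snd y" if "(x, y) \<in> P"
    using assms that unfolding stage_inv_def by (elim conjE) fast
  show "y = y'" if "(x, y) \<in> P" "(x, y') \<in> P"
    using assms that unfolding stage_inv_def single_valued_def by (elim conjE) blast
  show "x = x'" if "(x, y) \<in> P" "(x', y) \<in> P"
    using assms that unfolding stage_inv_def single_valued_def by (elim conjE) blast
  show "\<exists>u v. (u, v) \<in> P \<and> (z = u \<or> z = v) \<and> snd x < snd u \<and> snd v < snd y"
    if "(x, y) \<in> P" "z \<in> cells i \<union> cells (i + 1)" "snd x < snd z" "snd z < snd y"
    using assms that unfolding stage_inv_def by (elim conjE) fast
qed

lemma stage_inv: "pairing_stage n a T i P \<Longrightarrow> stage_inv i P"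
proof (induction rule: pairing_stage.induct)
  case column
  show ?case
    unfolding stage_inv_def single_valued_def by (auto dest: cells_inj')
next
  case (step P x y)
  note S = step.IH
  \<comment> \<open>If the partner of \<open>z\<close> were outside the span, its pair would contain
    \<open>x\<close> or \<open>y\<close> or have one of them strictly inside its own span. In the
    latter case nesting would have paired that cell before.\<close>
  have nest: "\<exists>u v. (u, v) \<in> P \<and> (z = u \<or> z = v) \<and> snd x < snd u \<and> snd v < snd y"
    if z: "z \<in> cells i \<union> cells (i + 1)" "snd x < snd z" "snd z < snd y" for z
  proof -
    have "z \<in> Field P" using step.hyps(7) z by blast
    then obtain u v where uv: "(u, v) \<in> P" "z = u \<or> z = v" unfolding Field_def by blast
    note le = stage_le[OF S uv(1)] and sub = stage_sub[OF S uv(1)]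
    have "snd x < snd u"
    proof (rule ccontr)
      assume "\<not> snd x < snd u"
      then consider "snd u = snd x" | "snd u < snd x" by linarith
      then show False
      proof cases
        case 1
        then have "u = x" using cells_inj sub step.hyps(2) by blast
        then show False using uv step.hyps(4) by (auto simp: Field_def)
      next
        case 2
        then have "snd x < snd v" using uv z le by auto
        then obtain u' v' where "(u', v') \<in> P" "x = u' \<or> x = v'"
          using stage_nested[OF S uv(1), of x] step.hyps(2) 2 by blast
        then show False using step.hyps(4) by (auto simp: Field_def)
      qed
    qed
    moreover have "snd v < snd y"
    proof (rule ccontr)
      assume "\<not> snd v < snd y"
      then consider "snd v = snd y" | "snd y < snd v" by linarith
      then show False
      proof cases
        case 1
        then have "v = y" using cells_inj sub step.hyps(3) by blast
        then show False using uv step.hyps(5) by (auto simp: Field_def)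
      next
        case 2
        then have "snd u < snd y" using uv z le by auto
        then obtain u' v' where "(u', v') \<in> P" "y = u' \<or> y = v'"
          using stage_nested[OF S uv(1), of y] step.hyps(3) 2 by blast
        then show False using step.hyps(5) by (auto simp: Field_def)
      qed
    qed
    ultimately show ?thesis using uv by blast
  qed
  have n1: "(x, y') \<notin> P" "(y', x) \<notin> P" "(y, y') \<notin> P" "(y', y) \<notin> P" for y'
    using step.hyps(4,5) by (auto simp: Field_def)
  show ?case
    unfolding stage_inv_def
  proof (intro conjI)
    show "insert (x, y) P \<subseteq> cells i \<times> cells (i + 1)" using stage_sub[OF S] step.hyps by auto
    show "\<forall>x'\<in>cells i. \<forall>y'\<in>cells (i + 1). snd x' = snd y' \<longrightarrow> (x', y') \<in> insert (x, y) P"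
      using stage_column[OF S] by blast
    show "\<forall>(x', y')\<in>insert (x, y) P. snd x' \<le> snd y'" using stage_le[OF S] step.hyps(6) by auto
    show "single_valued (insert (x, y) P)" "single_valued ((insert (x, y) P)\<inverse>)"
      using stage_right[OF S] stage_left[OF S] n1 unfolding single_valued_def by blast+
    show "\<forall>(x', y')\<in>insert (x, y) P. \<forall>z\<in>cells i \<union> cells (i + 1). snd x' < snd z \<and> snd z < snd y' \<longrightarrow>
        (\<exists>(u, v)\<in>insert (x, y) P. (z = u \<or> z = v) \<and> snd x' < snd u \<and> snd v < snd y')"
      using nest stage_nested[OF S] by fast
  qed
qed

lemma stage_balanced:
  assumes P: "stage_inv i P" and xy: "(x, y) \<in> P"
  shows "card {z \<in> cells i. snd x < snd z \<and> snd z < snd y} = card {z \<in> cells (i + 1). snd x < snd z \<and> snd z < snd y}"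
    (is "card ?L = card ?U")
proof (rule order_antisym)
  show "card ?L \<le> card ?U"
  proof (rule card_le_by_relation[where R = P])
    fix z assume z: "z \<in> ?L"
    then obtain u v where uv: "(u, v) \<in> P" "z = u \<or> z = v" "snd x < snd u" "snd v < snd y"
      using stage_nested[OF P xy, of z] by auto
    note s = stage_sub[OF P uv(1)] stage_le[OF P uv(1)]
    have "z \<noteq> v" using s z cells_disjoint[of z i "i + 1"] by auto
    then have "(z, v) \<in> P" "v \<in> ?U" using uv s by auto
    then show "\<exists>v\<in>?U. (z, v) \<in> P" by blast
  qed (simp, rule stage_left[OF P])
  show "card ?U \<le> card ?L"
  proof (rule card_le_by_relation[where R = "P\<inverse>"])
    fix z assume z: "z \<in> ?U"
    then obtain u v where uv: "(u, v) \<in> P" "z = u \<or> z = v" "snd x < snd u" "snd v < snd y"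
      using stage_nested[OF P xy, of z] by auto
    note s = stage_sub[OF P uv(1)] stage_le[OF P uv(1)]
    have "z \<noteq> u" using s z cells_disjoint[of z i "i + 1"] by auto
    then have "(z, u) \<in> P\<inverse>" "u \<in> ?L" using uv s by auto
    then show "\<exists>u\<in>?L. (z, u) \<in> P\<inverse>" by blast
  qed (simp, use stage_right[OF P] in blast)
qed

text \<open>The columns from \<open>x\<close> to \<open>y\<close> contain equally many
  \<open>i\<close> and \<open>i + 1\<close>, so the height at \<open>y\<close> equals the one just
  before \<open>x\<close>, and \<open>y\<close> is not in a record column.\<close>

lemma record_not_paired:
  assumes P: "stage_inv i P" and y: "y \<in> cells (i + 1)" "record_col i (snd y)"
  shows "y \<notin> Field P"
proof
  assume "y \<in> Field P"
  then obtain x where xy: "(x, y) \<in> P"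
    unfolding Field_def using stage_sub[OF P, of y] y(1) cells_disjoint[of y i "i + 1"] by auto
  have x: "x \<in> cells i" and le: "snd x \<le> snd y" using stage_sub[OF P xy] stage_le[OF P xy] by auto
  define k where "k = snd x - 1"
  have k: "snd x = Suc k" using cells_col_pos[OF x] unfolding k_def by simp
  have noU: "z = y" if "z \<in> cells (i + 1)" "snd z = snd x" for z
    using stage_right[OF P stage_column[OF P x that(1) that(2)[symmetric]] xy] .
  have noL: "z = x" if "z \<in> cells i" "snd z = snd y" for z
    using stage_left[OF P stage_column[OF P that(1) y(1) that(2)] xy] .
  have arith: "(k < sz \<and> sz \<le> sy) = (Suc k < sz \<and> sz < sy)" if "sz \<noteq> Suc k" "sz \<noteq> sy" for sz sy :: nat
    using that by auto
  have "{z \<in> cells i. k < snd z \<and> snd z \<le> snd y} = insert x {z \<in> cells i. snd x < snd z \<and> snd z < snd y}"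
  proof (rule set_eqI)
    fix z
    show "z \<in> {z \<in> cells i. k < snd z \<and> snd z \<le> snd y} \<longleftrightarrow> z \<in> insert x {z \<in> cells i. snd x < snd z \<and> snd z < snd y}"
    proof (cases "z = x \<or> z \<notin> cells i")
      case True
      then show ?thesis using x k le by auto
    next
      case False
      then have "snd z \<noteq> Suc k" "snd z \<noteq> snd y" using noL[of z] cells_inj[of z i x] x k by auto
      then show ?thesis using False arith k by simp
    qed
  qed
  moreover have "{z \<in> cells (i + 1). k < snd z \<and> snd z \<le> snd y} = insert y {z \<in> cells (i + 1). snd x < snd z \<and> snd z < snd y}"
  proof (rule set_eqI)
    fix z
    show "z \<in> {z \<in> cells (i + 1). k < snd z \<and> snd z \<le> snd y} \<longleftrightarrow> z \<in> insert y {z \<in> cells (i + 1). snd x < snd z \<and> snd z < snd y}"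
    proof (cases "z = y \<or> z \<notin> cells (i + 1)")
      case True
      then show ?thesis using y(1) k le by auto
    next
      case False
      then have "snd z \<noteq> Suc k" "snd z \<noteq> snd y" using noU[of z] cells_inj[of z "i + 1" y] y(1) k by auto
      then show ?thesis using False arith k by simp
    qed
  qed
  ultimately have "col_ht i (snd y) - col_ht i k = 0"
    using col_ht_diff[of k "snd y" i] k le stage_balanced[OF P xy] by simp
  moreover have "col_ht i k < col_ht i (snd y)" using y(2) k le unfolding record_col_def by simp
  ultimately show False by simp
qed

text \<open>In a stage of maximal size, an unpaired \<open>i\<close> left of an unpaired
  \<open>i + 1\<close> could be chosen at minimal distance. Everything between is then paired, and
  the stage could still grow.\<close>

lemma maximal_stage:
  obtains P where "pairing_stage n a T i P"
    "\<And>x y. x \<in> cells i \<Longrightarrow> y \<in> cells (i + 1) \<Longrightarrow> x \<notin> Field P \<Longrightarrow> y \<notin> Field P \<Longrightarrow> \<not> snd x < snd y"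
proof -
  have sub: "Q \<subseteq> cells i \<times> cells (i + 1)" if "pairing_stage n a T i Q" for Q
    using stage_inv[OF that] unfolding stage_inv_def by (elim conjE)
  then have "card Q < Suc (card (cells i \<times> cells (i + 1)))" if "pairing_stage n a T i Q" for Q
    using card_mono[OF _ sub[OF that]] by (simp add: less_Suc_eq_le)
  then obtain P where P: "pairing_stage n a T i P" "\<And>Q. pairing_stage n a T i Q \<Longrightarrow> card Q \<le> card P"
    using ex_has_greatest_nat[of "pairing_stage n a T i" _ card, OF pairing_stage.column] by blast
  have finP: "finite P" using finite_subset[OF sub[OF P(1)]] by simp
  have "\<not> snd x < snd y"
    if "x \<in> cells i" "y \<in> cells (i + 1)" "x \<notin> Field P" "y \<notin> Field P" for x y
    using that
  proof (induction "snd y - snd x" arbitrary: x y rule: less_induct)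
    case less
    show ?case
    proof
      assume lt: "snd x < snd y"
      have "z \<in> Field P" if "z \<in> cells i \<union> cells (i + 1)" "snd x < snd z" "snd z < snd y" for z
      proof (rule ccontr)
        assume "z \<notin> Field P"
        moreover have "snd y - snd z < snd y - snd x" "snd z - snd x < snd y - snd x"
          using that(2,3) by linarith+
        ultimately show False
          using less.hyps[of y z] less.hyps[of z x] less.prems that by (elim UnE) simp_all
      qed
      then have "pairing_stage n a T i (insert (x, y) P)"
        by (intro pairing_stage.step[OF P(1) less.prems lt]) blast
      then have "card (insert (x, y) P) \<le> card P" using P(2) by simp
      moreover have "(x, y) \<notin> P" using less.prems by (auto simp: Field_def)
      ultimately show False using finP by simp
    qed
  qed
  then show ?thesis using that P(1) by blast
qed

text \<open>In a maximal stage every \<open>i\<close> after column \<open>k\<close> and up to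
  \<open>y\<close> is paired with an \<open>i + 1\<close> of the same stretch other than
  \<open>y\<close>, so the stretch has a surplus of \<open>i + 1\<close>.\<close>

lemma unpaired_record:
  assumes "y \<in> unpaired_upper n a T i"
  shows "record_col i (snd y)"
proof -
  obtain P where P: "pairing_stage n a T i P"
    "\<And>x y. x \<in> cells i \<Longrightarrow> y \<in> cells (i + 1) \<Longrightarrow> x \<notin> Field P \<Longrightarrow> y \<notin> Field P \<Longrightarrow> \<not> snd x < snd y"
    using maximal_stage by blast
  note S = stage_inv[OF P(1)]
  have y: "y \<in> cells (i + 1)" "y \<notin> Field P" using assms P(1) unfolding unpaired_upper_def by auto
  show ?thesis
    unfolding record_col_def
  proof (intro allI impI)
    fix k assume k: "k < snd y"
    let ?L = "{x \<in> cells i. k < snd x \<and> snd x \<le> snd y}"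
    let ?U = "{x \<in> cells (i + 1). k < snd x \<and> snd x \<le> snd y}"
    have "card ?L \<le> card (?U - {y})"
    proof (rule card_le_by_relation[where R = P])
      fix x assume x: "x \<in> ?L"
      have xy: "(x, y) \<notin> P" using y by (auto simp: Field_def)
      then have ne: "snd x \<noteq> snd y" using stage_column[OF S, of x y] x y by blast
      then have "x \<in> Field P" using P(2)[of x y] x y by auto
      then obtain v where "(x, v) \<in> P \<or> (v, x) \<in> P" unfolding Field_def by blast
      then have v: "(x, v) \<in> P" using stage_sub[OF S, of v x] x cells_disjoint[of x i "i + 1"] by auto
      have vU: "v \<in> cells (i + 1)" "snd x \<le> snd v" using stage_sub[OF S v] stage_le[OF S v] by auto
      have vy: "v \<noteq> y" using v xy by blast
      have "\<not> snd y < snd v"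
      proof
        assume "snd y < snd v"
        then obtain u w where "(u, w) \<in> P" "y = u \<or> y = w"
          using stage_nested[OF S v, of y] y x ne by auto
        then show False using y by (auto simp: Field_def)
      qed
      then have "v \<in> ?U - {y}" using vy vU x by simp
      then show "\<exists>v\<in>?U - {y}. (x, v) \<in> P" using v by blast
    qed (simp, rule stage_left[OF S])
    also have "\<dots> < card ?U" using y k by (intro card_Diff1_less) auto
    finally show "col_ht i k < col_ht i (snd y)" using col_ht_diff[of k "snd y" i] k by simp
  qed
qed

lemma unpaired_upper_iff: "y \<in> unpaired_upper n a T i \<longleftrightarrow> y \<in> cells (i + 1) \<and> record_col i (snd y)"
  using unpaired_record record_not_paired stage_inv unfolding unpaired_upper_def by blast

lemma record_has_cell:
  assumes "record_col i c" "0 < c"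
  shows "\<exists>y\<in>unpaired_upper n a T i. snd y = c"
proof -
  obtain k where k: "c = Suc k" using assms(2) by (cases c) auto
  then have "col_ht i k < col_ht i (Suc k)" using assms(1) unfolding record_col_def by simp
  then have "\<exists>x\<in>cells (i + 1). snd x = c" unfolding col_ht_Suc k by (auto split: if_splits)
  then show ?thesis using assms(1) unpaired_upper_iff by auto
qed

lemma record_above:
  assumes "b < col_ht i k" "\<forall>l<c. col_ht i l \<le> b" "col_ht i c \<le> b"
  shows "\<exists>l>c. record_col i l"
proof -
  define l where "l = (LEAST l. b < col_ht i l)"
  have l: "b < col_ht i l" unfolding l_def using assms(1) by (rule LeastI)
  have "\<not> b < col_ht i m" if "m < l" for m using not_less_Least that unfolding l_def by blast
  then have "record_col i l" using l unfolding record_col_def by fastforce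
  moreover have "c < l" using l assms by (metis linorder_neqE_nat not_le)
  ultimately show ?thesis by blast
qed

lemma key_raise_None: "key_raise n a i T = None \<longleftrightarrow> (\<forall>k. col_ht i k \<le> 0)"
proof
  assume "key_raise n a i T = None"
  then have e: "unpaired_upper n a T i = {}" unfolding key_raise_def by (auto split: if_splits)
  show "\<forall>k. col_ht i k \<le> 0"
  proof (rule ccontr)
    assume "\<not> ?thesis"
    then obtain k where "0 < col_ht i k" by (metis not_le)
    then obtain l where "0 < l" "record_col i l" using record_above[of 0 i k 0] by auto
    then show False using record_has_cell e by blast
  qed
next
  assume *: "\<forall>k. col_ht i k \<le> 0"
  have "unpaired_upper n a T i = {}"
  proof (rule ccontr)
    assume "\<not> ?thesis"
    then obtain y where "y \<in> cells (i + 1)" "record_col i (snd y)" using unpaired_upper_iff by auto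
    then have "col_ht i 0 < col_ht i (snd y)" using cells_col_pos unfolding record_col_def by blast
    then show False using * by (metis col_ht_0 not_le)
  qed
  then show "key_raise n a i T = None" by (simp add: key_raise_def)
qed

text \<open>The rightmost unpaired \<open>i + 1\<close> is in the last record column, and any
  greater height would produce a later record. So it marks the first maximum of the column
  path.\<close>

lemma key_raise_Some:
  assumes "key_raise n a i T = Some T'"
  obtains y where "y \<in> cells (i + 1)" "record_col i (snd y)" "\<And>k. col_ht i k \<le> col_ht i (snd y)"
    "T' = raise_at n a T i y"
proof -
  let ?U = "unpaired_upper n a T i"
  have ne: "?U \<noteq> {}" using assms unfolding key_raise_def by auto
  have fin: "finite ?U" by (rule finite_subset[of _ "cells (i + 1)"]) (auto simp: unpaired_upper_def)
  have "Max (snd ` ?U) \<in> snd ` ?U" using ne fin by (intro Max_in) auto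
  then obtain y where y: "y \<in> ?U" "snd y = Max (snd ` ?U)" by auto
  have le: "snd z \<le> snd y" if "z \<in> ?U" for z using that fin unfolding y(2) by simp
  have "(THE y. y \<in> ?U \<and> (\<forall>z\<in>?U. snd z \<le> snd y)) = y"
  proof (rule the_equality)
    show "y \<in> ?U \<and> (\<forall>z\<in>?U. snd z \<le> snd y)" using y le by blast
    fix z assume z: "z \<in> ?U \<and> (\<forall>w\<in>?U. snd w \<le> snd z)"
    then have "snd z = snd y" using y le by (meson order_antisym)
    then show "z = y" using z y unpaired_upper_iff cells_inj by blast
  qed
  then have T': "T' = raise_at n a T i y" using assms ne unfolding key_raise_def by simp
  have r: "y \<in> cells (i + 1)" "record_col i (snd y)" using y unpaired_upper_iff by auto
  have "col_ht i k \<le> col_ht i (snd y)" for k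
  proof (rule ccontr)
    assume "\<not> ?thesis"
    then obtain l where l: "snd y < l" "record_col i l"
      using record_above[of "col_ht i (snd y)" i k "snd y"] r unfolding record_col_def by (auto simp: less_imp_le)
    then obtain z where "z \<in> ?U" "snd z = l" using record_has_cell by (metis gr_zeroI not_less_zero)
    then show False using le[of z] l by simp
  qed
  then show ?thesis using that r T' by blast
qed

end

section \<open>Words of columns\<close>

lemma
  assumes "\<And>x. x \<in> set u \<Longrightarrow> x \<noteq> i \<and> x \<noteq> Suc i"
  shows word_eps_neutral: "word_eps i (u @ w) = word_eps i w"
    and word_raise_neutral: "word_raise i (u @ w) = map_option ((@) u) (word_raise i w)"
proof -
  have "word_eps i (u @ w) = word_eps i w \<and> word_raise i (u @ w) = map_option ((@) u) (word_raise i w)"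
    using assms
  proof (induction u)
    case Nil
    then show ?case by (cases "word_raise i w") auto
  next
    case (Cons x u)
    then show ?case
      using word_raise_None[of i w]
      by (cases "word_raise i w") (auto simp: letter_eps_def letter_phi_def letter_raise_def)
  qed
  then show "word_eps i (u @ w) = word_eps i w" "word_raise i (u @ w) = map_option ((@) u) (word_raise i w)"
    by auto
qed

lemma sorted_list_of_set_split:
  fixes S :: "nat set"
  assumes "finite S"
  shows "sorted_list_of_set S = sorted_list_of_set {x \<in> S. x < i} @ (if i \<in> S then [i] else []) @
    (if Suc i \<in> S then [Suc i] else []) @ sorted_list_of_set {x \<in> S. Suc i < x}" (is "_ = ?R")
proof (rule sorted_distinct_set_unique)
  have f: "finite {x \<in> S. x < i}" "finite {x \<in> S. Suc i < x}" using assms by auto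
  show "sorted (sorted_list_of_set S)" "distinct (sorted_list_of_set S)" by auto
  show "sorted ?R" "distinct ?R" using f by (auto simp: sorted_append)
  show "set (sorted_list_of_set S) = set ?R"
    using f assms by (auto simp: not_less_eq less_Suc_eq)
qed

text \<open>Increasing order puts \<open>i\<close> directly before \<open>i + 1\<close>; when both
  occur they cancel in the tensor product rule, which corresponds to the pairing within a
  column.\<close>

definition columns_word :: "nat set list \<Rightarrow> nat list" where
  "columns_word Ss = concat (map sorted_list_of_set Ss)"

definition column_step :: "nat \<Rightarrow> nat set \<Rightarrow> int" where
  "column_step i S = (if Suc i \<in> S then 1 else 0) - (if i \<in> S then 1 else 0)"

definition columns_ht :: "nat \<Rightarrow> nat set list \<Rightarrow> nat \<Rightarrow> int" where
  "columns_ht i Ss k = (\<Sum>m<k. column_step i (Ss ! m))"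

lemma columns_ht_0 [simp]: "columns_ht i Ss 0 = 0"
  by (simp add: columns_ht_def)

lemma columns_ht_Cons_Suc [simp]: "columns_ht i (S # Ss) (Suc k) = column_step i S + columns_ht i Ss k"
  unfolding columns_ht_def by (subst sum.lessThan_Suc_shift) simp

lemma columns_word_Cons: "columns_word (S # Ss) = sorted_list_of_set S @ columns_word Ss"
  by (simp add: columns_word_def)

context
  fixes S :: "nat set" and i :: nat and w :: "nat list"
  assumes fin: "finite S"
begin

text \<open>Letters other than \<open>i\<close> and \<open>i + 1\<close> are neutral. The same
  neutral ends serve the column and its raised version, so only the middle has to be
  compared.\<close>

lemma column_parts:
  obtains U V where "\<forall>w. word_eps i (U @ w) = word_eps i w" "\<forall>w. word_eps i (V @ w) = word_eps i w"
    "\<forall>w. word_raise i (U @ w) = map_option ((@) U) (word_raise i w)"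
    "\<forall>w. word_raise i (V @ w) = map_option ((@) V) (word_raise i w)"
    "sorted_list_of_set S = U @ (if i \<in> S then [i] else []) @ (if Suc i \<in> S then [Suc i] else []) @ V"
    "sorted_list_of_set (insert i (S - {Suc i})) = U @ [i] @ V"
proof -
  let ?U = "sorted_list_of_set {x \<in> S. x < i}" and ?V = "sorted_list_of_set {x \<in> S. Suc i < x}"
  let ?S' = "insert i (S - {Suc i})"
  have f: "finite {x \<in> S. x < i}" "finite {x \<in> S. Suc i < x}" "finite ?S'" using fin by auto
  have e: "{x \<in> ?S'. x < i} = {x \<in> S. x < i}" "{x \<in> ?S'. Suc i < x} = {x \<in> S. Suc i < x}" by auto
  show ?thesis
  proof (rule that)
    show "\<forall>w. word_eps i (?U @ w) = word_eps i w" "\<forall>w. word_raise i (?U @ w) = map_option ((@) ?U) (word_raise i w)"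
      using f by (intro allI word_eps_neutral word_raise_neutral; auto)+
    show "\<forall>w. word_eps i (?V @ w) = word_eps i w" "\<forall>w. word_raise i (?V @ w) = map_option ((@) ?V) (word_raise i w)"
      using f by (intro allI word_eps_neutral word_raise_neutral; auto)+
    show "sorted_list_of_set S = ?U @ (if i \<in> S then [i] else []) @ (if Suc i \<in> S then [Suc i] else []) @ ?V"
      by (rule sorted_list_of_set_split[OF fin])
    show "sorted_list_of_set ?S' = ?U @ [i] @ ?V"
      using sorted_list_of_set_split[OF f(3), of i] unfolding e by simp
  qed
qed

lemma word_eps_column:
  "int (word_eps i (sorted_list_of_set S @ w)) = max 0 (column_step i S + int (word_eps i w))"
proof -
  obtain U V where uv: "\<forall>w. word_eps i (U @ w) = word_eps i w" "\<forall>w. word_eps i (V @ w) = word_eps i w"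
    "\<forall>w. word_raise i (U @ w) = map_option ((@) U) (word_raise i w)"
    "\<forall>w. word_raise i (V @ w) = map_option ((@) V) (word_raise i w)"
    "sorted_list_of_set S = U @ (if i \<in> S then [i] else []) @ (if Suc i \<in> S then [Suc i] else []) @ V"
    "sorted_list_of_set (insert i (S - {Suc i})) = U @ [i] @ V"
    by (rule column_parts)
  then show ?thesis by (auto simp: column_step_def letter_eps_def letter_phi_def)
qed

lemma word_raise_column_pass:
  assumes v: "word_raise i w = Some v" and pos: "0 < column_step i S + int (word_eps i w)"
  shows "word_raise i (sorted_list_of_set S @ w) = Some (sorted_list_of_set S @ v)"
proof -
  have "word_eps i w \<noteq> 0" using v word_raise_None[of i w] by auto
  obtain U V where uv: "\<forall>w. word_eps i (U @ w) = word_eps i w" "\<forall>w. word_eps i (V @ w) = word_eps i w"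
    "\<forall>w. word_raise i (U @ w) = map_option ((@) U) (word_raise i w)"
    "\<forall>w. word_raise i (V @ w) = map_option ((@) V) (word_raise i w)"
    "sorted_list_of_set S = U @ (if i \<in> S then [i] else []) @ (if Suc i \<in> S then [Suc i] else []) @ V"
    "sorted_list_of_set (insert i (S - {Suc i})) = U @ [i] @ V"
    by (rule column_parts)
  then show ?thesis
    using v pos \<open>word_eps i w \<noteq> 0\<close> by (auto simp: column_step_def letter_eps_def letter_phi_def)
qed

lemma word_raise_column_stop:
  assumes e: "word_eps i w = 0" and s: "column_step i S = 1"
  shows "word_raise i (sorted_list_of_set S @ w) = Some (sorted_list_of_set (insert i (S - {Suc i})) @ w)"
proof -
  have m: "Suc i \<in> S" "i \<notin> S" using s by (auto simp: column_step_def split: if_splits)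
  obtain U V where uv: "\<forall>w. word_eps i (U @ w) = word_eps i w" "\<forall>w. word_eps i (V @ w) = word_eps i w"
    "\<forall>w. word_raise i (U @ w) = map_option ((@) U) (word_raise i w)"
    "\<forall>w. word_raise i (V @ w) = map_option ((@) V) (word_raise i w)"
    "sorted_list_of_set S = U @ (if i \<in> S then [i] else []) @ (if Suc i \<in> S then [Suc i] else []) @ V"
    "sorted_list_of_set (insert i (S - {Suc i})) = U @ [i] @ V"
    by (rule column_parts)
  show ?thesis
    unfolding uv(5,6) using e m uv(2-4) by (simp add: uv(3) letter_raise_def letter_phi_def)
qed

end

lemma columns_word_eps:
  assumes "\<And>S. S \<in> set Ss \<Longrightarrow> finite S"
  shows "(\<forall>k\<le>length Ss. columns_ht i Ss k \<le> int (word_eps i (columns_word Ss))) \<and>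
    (\<exists>k\<le>length Ss. columns_ht i Ss k = int (word_eps i (columns_word Ss)))"
  using assms
proof (induction Ss)
  case Nil
  then show ?case by (simp add: columns_word_def)
next
  case (Cons S Ss)
  let ?e = "int (word_eps i (columns_word Ss))"
  have e: "int (word_eps i (columns_word (S # Ss))) = max 0 (column_step i S + ?e)"
    using word_eps_column Cons.prems unfolding columns_word_Cons by simp
  have IH: "\<forall>k\<le>length Ss. columns_ht i Ss k \<le> ?e" "\<exists>k\<le>length Ss. columns_ht i Ss k = ?e"
    using Cons by auto
  show ?case
    unfolding e
  proof
    show "\<forall>k\<le>length (S # Ss). columns_ht i (S # Ss) k \<le> max 0 (column_step i S + ?e)"
    proof (intro allI impI)
      fix k assume "k \<le> length (S # Ss)"
      then show "columns_ht i (S # Ss) k \<le> max 0 (column_step i S + ?e)"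
        using IH(1) by (cases k) auto
    qed
    obtain k where k: "k \<le> length Ss" "columns_ht i Ss k = ?e" using IH(2) by blast
    show "\<exists>k\<le>length (S # Ss). columns_ht i (S # Ss) k = max 0 (column_step i S + ?e)"
    proof (cases "0 \<le> column_step i S + ?e")
      case True
      then show ?thesis using k by (intro exI[of _ "Suc k"]) simp
    next
      case False
      then show ?thesis by (intro exI[of _ 0]) simp
    qed
  qed
qed

text \<open>Columns before the first maximum pass the operator on to the right, and the column that
  reaches it contains \<open>i + 1\<close> but not \<open>i\<close> and absorbs it. The column with
  list index \<open>c\<close> is the step from height \<open>c\<close> to height
  \<open>Suc c\<close>.\<close>

lemma columns_word_raise:
  assumes "\<And>S. S \<in> set Ss \<Longrightarrow> finite S" "c < length Ss"
    and "\<And>k. k \<le> c \<Longrightarrow> columns_ht i Ss k < columns_ht i Ss (Suc c)"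
    and "\<And>k. k \<le> length Ss \<Longrightarrow> columns_ht i Ss k \<le> columns_ht i Ss (Suc c)"
  shows "word_raise i (columns_word Ss) = Some (columns_word (Ss[c := insert i (Ss ! c - {Suc i})]))"
  using assms
proof (induction Ss arbitrary: c)
  case (Cons S Ss)
  have fin: "finite S" "\<And>S. S \<in> set Ss \<Longrightarrow> finite S" using Cons.prems by auto
  obtain k0 where k0: "k0 \<le> length Ss" "columns_ht i Ss k0 = int (word_eps i (columns_word Ss))"
    using columns_word_eps[OF fin(2)] by blast
  show ?case
  proof (cases c)
    case 0
    have "0 < column_step i S" using Cons.prems(3)[of 0] 0 by simp
    then have s: "column_step i S = 1" by (auto simp: column_step_def split: if_splits)
    have "columns_ht i Ss k0 \<le> 0" using Cons.prems(4)[of "Suc k0"] k0 0 by simp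
    then have "word_eps i (columns_word Ss) = 0" using k0 by simp
    then show ?thesis using word_raise_column_stop[OF fin(1) _ s] 0 by (simp add: columns_word_Cons)
  next
    case (Suc d)
    have r: "word_raise i (columns_word Ss) = Some (columns_word (Ss[d := insert i (Ss ! d - {Suc i})]))"
    proof (rule Cons.IH)
      show "columns_ht i Ss k < columns_ht i Ss (Suc d)" if "k \<le> d" for k
        using Cons.prems(3)[of "Suc k"] that Suc by simp
      show "columns_ht i Ss k \<le> columns_ht i Ss (Suc d)" if "k \<le> length Ss" for k
        using Cons.prems(4)[of "Suc k"] that Suc by simp
    qed (use fin Cons.prems Suc in auto)
    have "columns_ht i Ss (Suc d) \<le> int (word_eps i (columns_word Ss))"
      using columns_word_eps[OF fin(2)] Cons.prems(2) Suc by auto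
    then have "0 < column_step i S + int (word_eps i (columns_word Ss))"
      using Cons.prems(3)[of 0] Suc by simp
    then show ?thesis using word_raise_column_pass[OF fin(1) r] Suc by (simp add: columns_word_Cons)
  qed
qed simp

lemma count_list_distinct: "distinct xs \<Longrightarrow> count_list xs m = (if m \<in> set xs then 1 else 0)"
  by (induction xs) auto

lemma count_columns_word:
  assumes "\<And>S. S \<in> set Ss \<Longrightarrow> finite S"
  shows "count_list (columns_word Ss) m = length (filter (\<lambda>S. m \<in> S) Ss)"
  using assms
proof (induction Ss)
  case (Cons S Ss)
  have "count_list (sorted_list_of_set S) m = (if m \<in> S then 1 else 0)"
    using count_list_distinct[of "sorted_list_of_set S"] Cons.prems by simp
  then show ?case using Cons by (simp add: columns_word_Cons)
qed (simp add: columns_word_def)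

text \<open>The sizes tell where to cut the word, and a sorted list determines its set.\<close>

lemma columns_word_inject:
  assumes "columns_word Ss = columns_word Ss'" "length Ss = length Ss'"
    and "\<And>k. k < length Ss \<Longrightarrow> finite (Ss ! k) \<and> finite (Ss' ! k) \<and> card (Ss ! k) = card (Ss' ! k)"
  shows "Ss = Ss'"
proof -
  have "map sorted_list_of_set Ss = map sorted_list_of_set Ss'"
    by (rule concat_injective) (use assms in \<open>auto simp: columns_word_def set_zip\<close>)
  then show ?thesis
    using assms(2,3) by (intro nth_equalityI) (auto simp: map_equality_iff, (metis set_sorted_list_of_set)+)
qed

section \<open>Highest weight words\<close>

lemma word_eps_replicate_Suc: "word_eps i (replicate k (Suc i) @ w) = k + word_eps i w"
  by (induction k) (auto simp: letter_eps_def letter_phi_def)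

lemma word_eps_replicate: "word_eps i (replicate k i @ w) = word_eps i w - k"
  by (induction k) (auto simp: letter_eps_def letter_phi_def)

text \<open>Only two blocks matter: that of \<open>i\<close> comes first and cancels all of the at
  most equally many letters \<open>i + 1\<close> behind it.\<close>

lemma highest_word_raise:
  assumes "is_partition n lam" "i \<in> {1..<n}"
  shows "word_raise i (highest_word n lam) = None"
proof -
  have "[1..<n + 1] = [1..<i] @ [i, Suc i] @ [Suc (Suc i)..<n + 1]"
    using assms(2) upt_add_eq_append[of 1 i "n + 1 - i"] by (simp add: upt_conv_Cons)
  then have e: "highest_word n lam = concat (map (\<lambda>j. replicate (lam j) j) [1..<i]) @ replicate (lam i) i @
      replicate (lam (Suc i)) (Suc i) @ concat (map (\<lambda>j. replicate (lam j) j) [Suc (Suc i)..<n + 1])"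
    unfolding highest_word_def by simp
  have "word_eps i (concat (map (\<lambda>j. replicate (lam j) j) [Suc (Suc i)..<n + 1]) @ []) = 0"
    by (subst word_eps_neutral) auto
  moreover have "lam (Suc i) \<le> lam i" using assms unfolding is_partition_def by auto
  ultimately have "word_eps i (highest_word n lam) = 0"
    unfolding e by (subst word_eps_neutral) (auto simp: word_eps_replicate word_eps_replicate_Suc)
  then show ?thesis by (simp add: word_raise_None)
qed

lemma highest_word_lists: "highest_word n lam \<in> lists {1..n}"
  unfolding highest_word_def by auto

lemma count_highest_word: "m \<in> {1..n} \<Longrightarrow> count_list (highest_word n lam) m = lam m"
proof (induction n)
  case (Suc n)
  have "highest_word (Suc n) lam = highest_word n lam @ replicate (lam (Suc n)) (Suc n)"
    unfolding highest_word_def by simp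
  moreover have "count_list (replicate k x) m = (if x = m then k else 0)" for k x
    by (induction k) auto
  moreover have "count_list (highest_word n lam) (Suc n) = 0"
    using highest_word_lists[of n lam] by (auto simp: count_list_0_iff in_lists_conv_set)
  ultimately show ?case using Suc by (cases "m = Suc n") auto
qed simp

section \<open>The word of a tabloid\<close>

abbreviation entries :: "filling \<Rightarrow> nat \<Rightarrow> nat \<Rightarrow> nat" where
  "entries T \<equiv> (\<lambda>r c. aug T (r, c))"

lemma aug_diagram_iff: "(r, c) \<in> aug_diagram n a \<longleftrightarrow> r \<in> {1..n} \<and> c \<le> a r"
  by (auto simp: aug_diagram_def diagram_def)

lemma diagram_iff: "(r, c) \<in> diagram n a \<longleftrightarrow> r \<in> {1..n} \<and> 0 < c \<and> c \<le> a r"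
  by (auto simp: diagram_def)

lemma key_filling_cong:
  assumes "key_filling n a A" "\<And>r c. r \<in> {1..n} \<Longrightarrow> c \<le> a r \<Longrightarrow> A r c = B r c"
  shows "key_filling n a B"
proof -
  interpret key_filling n a A by fact
  note e = assms(2)[symmetric]
  show ?thesis
  proof (unfold_locales, goal_cases)
    case (1 r)
    then show ?case using e[of r 0] base[of r] by simp
  next
    case (2 r c)
    then show ?case using e[of r c] range[of r c] by simp
  next
    case (3 r s c)
    then show ?case using e[of r c] e[of s c] inj[of r s c] by simp
  next
    case (4 r s c)
    then show ?case using e[of r c] e[of s "Suc c"] att[of r s c] by simp
  next
    case (5 r s c)
    then show ?case using e[of r c] e[of r "Suc c"] e[of s c] up[of r s c] by simp
  next
    case (6 r s c)
    then show ?case using e[of r c] e[of r "Suc c"] e[of s "Suc c"] low[of r s c] by simp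
  qed
qed

lemma SSKD_key_filling:
  assumes "T \<in> SSKD n a"
  shows "key_filling n a (entries T)"
proof -
  have T: "T \<in> fillings n a" and na: "non_attacking n a T"
    and tr: "\<And>x y z. triple n a x y z \<Longrightarrow> \<not> co_inversion (aug T x) (aug T y) (aug T z)"
    using assms unfolding SSKD_def by auto
  have na': "aug T x \<noteq> aug T y" if "x \<in> aug_diagram n a" "y \<in> aug_diagram n a" "attacks x y" for x y
    using na that unfolding non_attacking_def by blast
  show ?thesis
  proof (unfold_locales, goal_cases)
    case (1 r)
    then show ?case by (simp add: aug_def)
  next
    case (2 r c)
    then show ?case using T by (auto simp: aug_def fillings_def diagram_iff PiE_iff)
  next
    case (3 r s c)
    then show ?case using na'[of "(r, c)" "(s, c)"] by (auto simp: aug_diagram_iff attacks_def)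
  next
    case (4 r s c)
    then show ?case using na'[of "(r, c)" "(s, Suc c)"] by (auto simp: aug_diagram_iff attacks_def)
  next
    case (5 r s c)
    then have "triple n a (r, c) (r, Suc c) (s, c)" unfolding triple_def by (auto simp: aug_diagram_iff)
    then show ?case using tr by blast
  next
    case (6 r s c)
    then have "triple n a (r, c) (r, Suc c) (s, Suc c)" unfolding triple_def by (auto simp: aug_diagram_iff)
    then show ?case using tr by blast
  qed
qed

lemma key_filling_SSKD:
  assumes T: "T \<in> fillings n a" and key: "key_filling n a (entries T)"
  shows "T \<in> SSKD n a"
proof -
  interpret key_filling n a "entries T" by fact
  have "non_attacking n a T"
    unfolding non_attacking_def
  proof (intro ballI impI)
    fix x y assume xy: "x \<in> aug_diagram n a" "y \<in> aug_diagram n a" "attacks x y"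
    obtain r c s d where e: "x = (r, c)" "y = (s, d)" by (cases x, cases y) auto
    note m = xy[unfolded e aug_diagram_iff]
    from xy(3) consider "c = d" "r \<noteq> s" | "d = Suc c" "s < r" unfolding attacks_def e by auto
    then show "aug T x \<noteq> aug T y"
    proof cases
      case 1
      then show ?thesis using m inj[of r s c] unfolding e by auto
    next
      case 2
      then show ?thesis using m att[of r s c] unfolding e by auto
    qed
  qed
  moreover have "\<not> co_inversion (aug T x) (aug T y) (aug T z)" if t: "triple n a x y z" for x y z
  proof -
    from t obtain r c s where e: "x = (r, c)" "y = (r, Suc c)"
      and z: "z = (s, c) \<and> s > r \<and> a r > a s \<or> z = (s, Suc c) \<and> s < r \<and> a r \<ge> a s"
      and m: "x \<in> aug_diagram n a" "y \<in> aug_diagram n a" "z \<in> aug_diagram n a"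
      unfolding triple_def by auto
    from z show ?thesis
    proof
      assume "z = (s, c) \<and> s > r \<and> a r > a s"
      then show ?thesis using up[of r s c] m unfolding e by (auto simp: aug_diagram_iff)
    next
      assume "z = (s, Suc c) \<and> s < r \<and> a r \<ge> a s"
      then show ?thesis using low[of r s c] m unfolding e by (auto simp: aug_diagram_iff)
    qed
  qed
  ultimately show ?thesis using T unfolding SSKD_def by blast
qed

text \<open>The sum of the parts is a bound for every row length that also makes sense for
  \<open>n = 0\<close>. Surplus columns are empty and add nothing to the word; the basement is left
  out.\<close>

definition key_columns :: "nat \<Rightarrow> (nat \<Rightarrow> nat) \<Rightarrow> filling \<Rightarrow> nat set list" where
  "key_columns n a T = map (column_set n a (entries T)) [1..<Suc (sum a {1..n})]"

definition key_word :: "nat \<Rightarrow> (nat \<Rightarrow> nat) \<Rightarrow> filling \<Rightarrow> nat list" where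
  "key_word n a T = columns_word (key_columns n a T)"

definition swap_columns :: "nat \<Rightarrow> (nat \<Rightarrow> nat) \<Rightarrow> nat \<Rightarrow> nat set \<Rightarrow> filling \<Rightarrow> filling" where
  "swap_columns n a i D T = (\<lambda>x\<in>diagram n a. if snd x \<in> D then swap_entry i (T x) else T x)"

lemma row_le_sum: "r \<in> {1..n} \<Longrightarrow> a r \<le> sum a {1..n}" for a :: "nat \<Rightarrow> nat"
  by (rule member_le_sum) auto

lemma length_key_columns [simp]: "length (key_columns n a T) = sum a {1..n}"
  by (simp add: key_columns_def del: upt_Suc)

lemma nth_key_columns: "k < sum a {1..n} \<Longrightarrow> key_columns n a T ! k = column_set n a (entries T) (Suc k)"
  unfolding key_columns_def by (simp del: upt_Suc)

lemma finite_column_set [simp]: "finite (column_set n a A c)"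
  by (simp add: column_set_def)

lemma finite_key_columns: "S \<in> set (key_columns n a T) \<Longrightarrow> finite S"
  unfolding key_columns_def by auto

lemma swap_entry_image_both: "i \<in> S \<Longrightarrow> Suc i \<in> S \<Longrightarrow> swap_entry i ` S = S"
  by (auto simp: swap_entry_def image_iff)

lemma swap_entry_image_upper: "i \<notin> S \<Longrightarrow> Suc i \<in> S \<Longrightarrow> swap_entry i ` S = insert i (S - {Suc i})"
  by (auto simp: swap_entry_def image_iff)

lemma swap_entry_image_lower: "i \<in> S \<Longrightarrow> Suc i \<notin> S \<Longrightarrow> swap_entry i ` S = insert (Suc i) (S - {i})"
  by (auto simp: swap_entry_def image_iff)

lemma columns_ht_Suc: "columns_ht i Ss (Suc k) = columns_ht i Ss k + column_step i (Ss ! k)"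
  by (simp add: columns_ht_def)

lemma columns_ht_update:
  assumes "p < length Ss"
  shows "columns_ht i (Ss[p := S]) k = columns_ht i Ss k + (if p < k then column_step i S - column_step i (Ss ! p) else 0)"
proof (induction k)
  case (Suc k)
  then show ?case using assms by (cases "k = p") (auto simp: columns_ht_Suc)
qed simp

text \<open>A form shared by raising and lowering, which differ only in the predicates for the left
  and the right run.\<close>

definition run_columns :: "(nat \<Rightarrow> bool) \<Rightarrow> (nat \<Rightarrow> bool) \<Rightarrow> nat \<Rightarrow> nat set" where
  "run_columns P Q c = {d. d < c \<and> (\<forall>d'. d \<le> d' \<and> d' < c \<longrightarrow> P d')} \<union> {c} \<union>
     {d. c < d \<and> (\<forall>d'. c < d' \<and> d' \<le> d \<longrightarrow> Q d')}"

lemma run_columns_left: "d \<in> run_columns P Q c \<Longrightarrow> d < c \<Longrightarrow> Suc d \<in> run_columns P Q c \<and> (\<forall>d'. d \<le> d' \<and> d' < c \<longrightarrow> P d')"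
  unfolding run_columns_def by (cases "Suc d = c") auto

lemma run_columns_right: "d \<in> run_columns P Q c \<Longrightarrow> c < d \<Longrightarrow> d - 1 \<in> run_columns P Q c \<and> Q d"
  unfolding run_columns_def by (cases "d - 1 = c") auto

lemma run_columns_left_end:
  assumes "Suc d \<in> run_columns P Q c" "d \<notin> run_columns P Q c" "d < c"
  shows "\<not> P d"
proof
  assume "P d"
  have "P d'" if "d \<le> d'" "d' < c" for d'
    using run_columns_left[OF assms(1)] \<open>P d\<close> that by (cases "d' = d") auto
  then show False using assms(2,3) unfolding run_columns_def by blast
qed

lemma run_columns_right_end:
  "d \<in> run_columns P Q c \<Longrightarrow> Suc d \<notin> run_columns P Q c \<Longrightarrow> c \<le> d \<Longrightarrow> \<not> Q (Suc d)"
  unfolding run_columns_def by (auto simp: le_Suc_eq)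

lemma run_columns_refl: "c \<in> run_columns P Q c"
  by (simp add: run_columns_def)

locale tabloid =
  fixes n :: nat and a :: "nat \<Rightarrow> nat" and T :: filling
  assumes T: "T \<in> SSKD n a"
begin

sublocale key_filling n a "entries T"
  using SSKD_key_filling[OF T] .

sublocale column_injective n a T
proof unfold_locales
  fix x y assume xy: "x \<in> diagram n a" "y \<in> diagram n a" "snd x = snd y" "T x = T y"
  obtain r c s d where e: "x = (r, c)" "y = (s, d)" by (cases x, cases y) auto
  show "x = y" using inj[of r s c] xy unfolding e by (auto simp: diagram_iff aug_def)
qed

abbreviation "column \<equiv> column_set n a (entries T)"
abbreviation "H i \<equiv> columns_ht i (key_columns n a T)"

lemma column_iff: "v \<in> column d \<longleftrightarrow> (\<exists>s. occ v d s)"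
  unfolding column_set_def occ_def by auto

lemma occ_cells: "0 < d \<Longrightarrow> occ v d s \<longleftrightarrow> (s, d) \<in> cells v"
  unfolding occ_def cells_of_def by (auto simp: diagram_iff aug_def)

lemma occ_0: "occ v 0 s \<longleftrightarrow> s \<in> {1..n} \<and> s = v"
  unfolding occ_def by (auto simp: aug_def)

lemma column_cells: "0 < d \<Longrightarrow> v \<in> column d \<longleftrightarrow> (\<exists>x\<in>cells v. snd x = d)"
  by (simp add: column_iff occ_cells) (metis prod.collapse snd_conv)

lemma cells_col_le: "x \<in> cells v \<Longrightarrow> snd x \<le> sum a {1..n}"
  using row_le_sum[of "fst x" n a] by (cases x) (auto simp: cells_of_def diagram_iff)

lemma H_Suc: "k < sum a {1..n} \<Longrightarrow> H i (Suc k) = H i k + column_step i (column (Suc k))"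
  by (simp add: columns_ht_Suc nth_key_columns)

lemma H_col_ht: "k \<le> sum a {1..n} \<Longrightarrow> H i k = col_ht i k"
proof (induction k)
  case (Suc k)
  then show ?case
    using H_Suc[of k i] col_ht_Suc[of i k] column_cells[of "Suc k" i] column_cells[of "Suc k" "Suc i"]
    by (simp add: column_step_def)
qed simp

lemma H_flat:
  assumes "k \<le> l" "l \<le> sum a {1..n}" "\<And>e. k < e \<Longrightarrow> e \<le> l \<Longrightarrow> i \<in> column e \<and> Suc i \<in> column e"
  shows "H i l = H i k"
  using assms
proof (induction l rule: dec_induct)
  case (step m)
  then show ?case using H_Suc[of m i] by (simp add: column_step_def)
qed simp

text \<open>The two bounds fit both operators: in raising the height first reaches its maximum at
  \<open>c\<close>, in lowering it last attains it at \<open>c - 1\<close>.\<close>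

lemma balanced:
  assumes i: "i \<in> {1..<n}" and c: "0 < c" "c \<le> sum a {1..n}"
    and left: "\<And>k. k < c \<Longrightarrow> H i k \<le> H i (c - 1)"
    and right: "\<And>k. c \<le> k \<Longrightarrow> k \<le> sum a {1..n} \<Longrightarrow> H i k \<le> H i c"
  shows "key_balanced n a (entries T) i c"
proof unfold_locales
  show "i \<in> {1..<n}" by fact
next
  fix d s
  assume d: "d < c" "occ i d s"
    and both: "\<And>e. d < e \<Longrightarrow> e < c \<Longrightarrow> Ex (occ i e) \<and> Ex (occ (i + 1) e)"
  show "Ex (occ (i + 1) d)"
  proof (rule ccontr)
    assume no: "\<not> Ex (occ (i + 1) d)"
    \<comment> \<open>The basement contains \<open>i + 1\<close>, because
      \<open>i < n\<close>.\<close>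
    have "d \<noteq> 0"
    proof
      assume "d = 0"
      then have "occ (i + 1) d (i + 1)" using i occ_0[of "i + 1" "i + 1"] by auto
      then show False using no by blast
    qed
    then obtain e where e: "d = Suc e" by (cases d) auto
    have "H i d = H i e - 1"
      using H_Suc[of e i] d c no column_iff[of i d] column_iff[of "Suc i" d] unfolding e by (auto simp: column_step_def)
    moreover have "H i (c - 1) = H i d"
      using d c both by (intro H_flat) (auto simp: column_iff)
    ultimately show False using left[of e] d e by simp
  qed
next
  fix d s
  assume d: "c < d" "occ (i + 1) d s"
    and both: "\<And>e. c < e \<Longrightarrow> e < d \<Longrightarrow> Ex (occ i e) \<and> Ex (occ (i + 1) e)"
  show "Ex (occ i d)"
  proof (rule ccontr)
    assume no: "\<not> Ex (occ i d)"
    obtain e where e: "d = Suc e" using d by (cases d) auto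
    have dN: "d \<le> sum a {1..n}" using d(2) row_le_sum[of s n a] unfolding occ_def by auto
    have "H i d = H i e + 1"
      using H_Suc[of e i] d dN no column_iff[of i d] column_iff[of "Suc i" d] unfolding e by (auto simp: column_step_def)
    moreover have "H i e = H i c"
      using d e dN both by (intro H_flat) (auto simp: column_iff)
    ultimately show False using right[of d] d dN by simp
  qed
qed

lemma swap_columns_fillings:
  assumes "i \<in> {1..<n}"
  shows "swap_columns n a i D T \<in> fillings n a"
proof -
  have "T \<in> fillings n a" using T unfolding SSKD_def by simp
  then show ?thesis using assms unfolding fillings_def swap_columns_def by (auto simp: swap_entry_def PiE_iff)
qed

lemma entries_swap_columns:
  assumes "0 \<notin> D" "r \<in> {1..n}" "d \<le> a r"
  shows "entries (swap_columns n a i D T) r d = (if d \<in> D then swap_entry i (entries T r d) else entries T r d)"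
  using assms by (auto simp: aug_def swap_columns_def diagram_iff)

lemma column_swap_columns:
  assumes "0 \<notin> D"
  shows "column_set n a (entries (swap_columns n a i D T)) d = (if d \<in> D then swap_entry i ` column d else column d)"
proof -
  have "column_set n a (entries (swap_columns n a i D T)) d =
      (\<lambda>r. if d \<in> D then swap_entry i (entries T r d) else entries T r d) ` {r \<in> {1..n}. d \<le> a r}"
    unfolding column_set_def by (rule image_cong) (use entries_swap_columns[OF assms] in auto)
  then show ?thesis unfolding column_set_def by (auto simp: image_image)
qed

text \<open>A column with both entries is unchanged as a set, so only the swap in column
  \<open>c\<close>, at list index \<open>c - 1\<close>, shows in the word.\<close>

lemma key_columns_swap_columns:
  assumes "0 \<notin> D" "c \<in> D" "c \<le> sum a {1..n}"
    and "\<And>d. d \<in> D \<Longrightarrow> d \<noteq> c \<Longrightarrow> i \<in> column d \<and> Suc i \<in> column d"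
  shows "key_columns n a (swap_columns n a i D T) = (key_columns n a T)[c - 1 := swap_entry i ` column c]"
proof (rule nth_equalityI)
  fix k assume "k < length (key_columns n a (swap_columns n a i D T))"
  then have k: "k < sum a {1..n}" by simp
  have "0 < c" using assms by (metis gr0I)
  show "key_columns n a (swap_columns n a i D T) ! k = (key_columns n a T)[c - 1 := swap_entry i ` column c] ! k"
  proof (cases "Suc k = c")
    case True
    then show ?thesis using k assms(2) by (auto simp: nth_key_columns column_swap_columns[OF assms(1)])
  next
    case False
    then have "c - 1 \<noteq> k" using \<open>0 < c\<close> by auto
    then show ?thesis
      using k False assms(4)[of "Suc k"] swap_entry_image_both[of i "column (Suc k)"]
      by (simp add: nth_key_columns column_swap_columns[OF assms(1)])
  qed
qed simp

lemma swap_columns_SSKD: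
  assumes "i \<in> {1..<n}" "0 \<notin> D"
    and "key_filling n a (\<lambda>r d. if d \<in> D then swap_entry i (entries T r d) else entries T r d)"
  shows "swap_columns n a i D T \<in> SSKD n a"
  by (rule key_filling_SSKD[OF swap_columns_fillings[OF assms(1)]], rule key_filling_cong[OF assms(3)])
    (simp add: entries_swap_columns[OF assms(2)])

lemma key_word_lists: "key_word n a T \<in> lists {1..n}"
proof -
  have "v \<in> {1..n}" if "v \<in> set (key_word n a T)" for v
  proof -
    from that obtain S where S: "S \<in> set (key_columns n a T)" "v \<in> set (sorted_list_of_set S)"
      unfolding key_word_def columns_word_def by auto
    then have "v \<in> S" using finite_key_columns by simp
    moreover obtain d where "S = column d" using S(1) unfolding key_columns_def by auto
    ultimately show ?thesis using range unfolding column_set_def by auto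
  qed
  then show ?thesis unfolding in_lists_conv_set by blast
qed

lemma key_word_count: "m \<in> {1..n} \<Longrightarrow> count_list (key_word n a T) m = key_wt n a T m"
proof -
  have c: "count_list (columns_word (key_columns n a T)) m = length (filter (\<lambda>S. m \<in> S) (key_columns n a T))"
    by (rule count_columns_word) (rule finite_key_columns)
  have "count_list (key_word n a T) m = length (filter (\<lambda>d. m \<in> column d) [1..<Suc (sum a {1..n})])"
    unfolding key_word_def c
    by (simp add: key_columns_def filter_map o_def del: upt_Suc)
  also have "\<dots> = card {d \<in> {1..sum a {1..n}}. m \<in> column d}"
    by (subst distinct_card[symmetric]) (auto simp del: upt_Suc intro!: arg_cong[of _ _ card])
  also have "{d \<in> {1..sum a {1..n}}. m \<in> column d} = snd ` cells m"
  proof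
    show "{d \<in> {1..sum a {1..n}}. m \<in> column d} \<subseteq> snd ` cells m"
    proof
      fix d assume "d \<in> {d \<in> {1..sum a {1..n}}. m \<in> column d}"
      then have "0 < d" "m \<in> column d" by auto
      then show "d \<in> snd ` cells m" using column_cells[of d m] by blast
    qed
    show "snd ` cells m \<subseteq> {d \<in> {1..sum a {1..n}}. m \<in> column d}"
    proof
      fix d assume "d \<in> snd ` cells m"
      then obtain x where "x \<in> cells m" "d = snd x" by blast
      then show "d \<in> {d \<in> {1..sum a {1..n}}. m \<in> column d}"
        using column_cells[of d m] cells_col_le[of x m] cells_col_pos[of x m] by (auto simp: Suc_le_eq)
    qed
  qed
  also have "card \<dots> = card (cells m)"
    by (rule card_image, rule inj_onI) (rule cells_inj)
  also have "\<dots> = key_wt n a T m" unfolding key_wt_def cells_of_def ..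
  finally show ?thesis .
qed

lemma key_raise_word:
  assumes i: "i \<in> {1..<n}" and T': "key_raise n a i T = Some T'"
  shows "T' \<in> SSKD n a" "word_raise i (key_word n a T) = Some (key_word n a T')"
proof -
  obtain y where y: "y \<in> cells (i + 1)" and rec: "record_col i (snd y)" and max: "\<And>k. col_ht i k \<le> col_ht i (snd y)"
    and raise: "T' = raise_at n a T i y"
    using key_raise_Some[OF T'] by blast
  obtain r c where rc: "y = (r, c)" by (cases y)
  have c: "0 < c" "c \<le> sum a {1..n}" using cells_col_pos[OF y] cells_col_le[OF y] rc by auto
  have less: "H i k < H i c" if "k < c" for k
    using rec that c H_col_ht[of k i] H_col_ht[of c i] unfolding record_col_def rc by simp
  have le: "H i k \<le> H i c" if "k \<le> sum a {1..n}" for k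
    using max[of k] that c H_col_ht[of k i] H_col_ht[of c i] unfolding rc by simp
  have step: "H i c = H i (c - 1) + column_step i (column c)"
    using H_Suc[of "c - 1" i] c by simp
  then have "0 < column_step i (column c)" using less[of "c - 1"] c by simp
  then have ic: "i \<notin> column c" "Suc i \<in> column c" and s1: "column_step i (column c) = 1"
    by (auto simp: column_step_def split: if_splits)
  define D where "D = run_columns
    (\<lambda>d. (r, d) \<in> cells (i + 1) \<and> (\<exists>s>r. (s, d) \<in> cells i))
    (\<lambda>d. (r, d) \<in> cells (i + 1) \<and> (\<exists>s<r. (s, d) \<in> cells i)) c"
  have cD: "c \<in> D" unfolding D_def by (rule run_columns_refl)
  have DL: "Suc d \<in> D \<and> (r, d) \<in> cells (i + 1) \<and> (\<exists>s>r. (s, d) \<in> cells i)" if "d \<in> D" "d < c" for d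
    using run_columns_left[OF that[unfolded D_def]] that unfolding D_def by blast
  have DR: "d - 1 \<in> D \<and> (r, d) \<in> cells (i + 1) \<and> (\<exists>s<r. (s, d) \<in> cells i)" if "d \<in> D" "c < d" for d
    using run_columns_right[OF that[unfolded D_def]] unfolding D_def by blast
  \<comment> \<open>The runs are defined by diagram cells, and the basement has none.\<close>
  have D0: "0 \<notin> D" using DL[of 0] c cells_col_pos by fastforce
  have pos: "0 < d" if "d \<in> D" for d using that D0 by (metis gr0I)
  have bal: "key_balanced n a (entries T) i c"
    using balanced[OF i c] less step s1 le by (metis add_le_cancel_right order.refl zless_add1_eq less_le)
  have reg: "swap_region n a (entries T) i c r (i + 1) i D"
  proof (intro swap_region.intro[OF bal] swap_region_axioms.intro)
    show "occ (i + 1) c r" using occ_cells c y rc by simp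
    show "\<not> occ i c s" for s using ic column_iff by blast
    show "Suc d \<in> D \<and> occ (i + 1) d r \<and> (\<exists>s>r. occ i d s)" if "d \<in> D" "d < c" for d
      using DL[OF that] occ_cells[OF pos[OF that(1)]] by simp
    show "d - 1 \<in> D \<and> occ (i + 1) d r \<and> (\<exists>s<r. occ i d s)" if "d \<in> D" "c < d" for d
      using DR[OF that] occ_cells[OF pos[OF that(1)]] by simp
    show "s \<le> r" if "Suc d \<in> D" "d \<notin> D" "d < c" "occ (i + 1) d r" "occ i d s" for d s
    proof (cases "d = 0")
      case True
      then show ?thesis using that occ_0 by simp
    next
      case False
      then show ?thesis
        using run_columns_left_end[OF that(1-3)[unfolded D_def]] that occ_cells[of d] by (metis gr0I not_le)
    qed
    show "r \<le> s" if "d \<in> D" "Suc d \<notin> D" "c \<le> d" "occ (i + 1) (Suc d) r" "occ i (Suc d) s" for d s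
      using run_columns_right_end[OF that(1-3)[unfolded D_def]] that occ_cells[of "Suc d"] by (metis zero_less_Suc not_le)
  qed (use cD D0 in auto)
  note key = swap_region.raise_key_filling[OF reg refl]
  have runs: "left_run n a T i y \<union> right_run n a T i y = D - {c}"
    unfolding left_run_def right_run_def D_def run_columns_def rc by auto
  \<comment> \<open>Column \<open>c\<close> contains no \<open>i\<close>, so swapping the two
    entries in the whole column changes only the cell \<open>y\<close>. The raise is thus a uniform
    swap on \<open>D\<close>.\<close>
  have "T' = swap_columns n a i D T"
  proof
    fix x
    show "T' x = swap_columns n a i D T x"
    proof (cases "x \<in> diagram n a \<and> snd x = c \<and> x \<noteq> y")
      case True
      then have "T x \<noteq> i + 1" using cells_inj[OF _ y, of x] rc by (auto simp: cells_of_def)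
      moreover have "T x \<noteq> i"
      proof
        assume "T x = i"
        then have "x \<in> cells i" using True by (simp add: cells_of_def)
        then show False using ic(1) column_cells[OF c(1)] True by blast
      qed
      ultimately show ?thesis using True cD unfolding raise raise_at_def runs swap_columns_def
        by (auto simp: swap_entry_def)
    next
      case False
      have y': "T y = i + 1" "y \<in> diagram n a" using y by (simp_all add: cells_of_def)
      from False consider "x \<notin> diagram n a" | "x = y" | "x \<in> diagram n a" "snd x \<noteq> c" "x \<noteq> y" using rc by fastforce
      then show ?thesis
      proof cases
        case 1
        then show ?thesis by (simp add: raise raise_at_def swap_columns_def)
      next
        case 2
        have "snd y \<in> D" using cD rc by simp
        then show ?thesis using y' 2 by (simp add: raise raise_at_def swap_columns_def swap_entry_def)
      next
        case 3
        then show ?thesis by (simp add: raise raise_at_def runs swap_columns_def)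
      qed
    qed
  qed
  then show "T' \<in> SSKD n a" using swap_columns_SSKD[OF i D0 key] by simp
  have both: "i \<in> column d \<and> Suc i \<in> column d" if "d \<in> D" "d \<noteq> c" for d
    using DL[of d] DR[of d] that column_iff occ_cells[OF pos[OF that(1)]] by (metis Suc_eq_plus1 linorder_neqE_nat)
  have cols: "key_columns n a T' = (key_columns n a T)[c - 1 := insert i (key_columns n a T ! (c - 1) - {Suc i})]"
    using key_columns_swap_columns[OF D0 cD c(2) both] swap_entry_image_upper[OF ic] nth_key_columns[of "c - 1" a n T] c
      \<open>T' = swap_columns n a i D T\<close> by simp
  show "word_raise i (key_word n a T) = Some (key_word n a T')"
    unfolding key_word_def cols
    by (rule columns_word_raise) (use c less le finite_key_columns in auto)
qed

lemma H_eps: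
  "(\<forall>k\<le>sum a {1..n}. H i k \<le> int (word_eps i (key_word n a T))) \<and>
    (\<exists>k\<le>sum a {1..n}. H i k = int (word_eps i (key_word n a T)))"
  using columns_word_eps[of "key_columns n a T" i] finite_key_columns[of _ n a T] unfolding key_word_def by simp

lemma key_raise_None_word:
  assumes "key_raise n a i T = None"
  shows "word_raise i (key_word n a T) = None"
proof -
  obtain k where "k \<le> sum a {1..n}" "H i k = int (word_eps i (key_word n a T))"
    using H_eps by blast
  moreover have "col_ht i k \<le> 0" using assms key_raise_None by simp
  ultimately show ?thesis using H_col_ht by (simp add: word_raise_None)
qed

lemma H_total: "H i (sum a {1..n}) = ht i (key_word n a T) (length (key_word n a T))"
proof -
  have "columns_ht i Ss (length Ss) = int (length (filter (\<lambda>S. i + 1 \<in> S) Ss)) - int (length (filter (\<lambda>S. i \<in> S) Ss))"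
    for Ss by (induction Ss) (auto simp: column_step_def)
  from this[of "key_columns n a T"] show ?thesis
    unfolding ht_length key_word_def using count_columns_word[of "key_columns n a T"] finite_key_columns[of _ n a T] by simp
qed

text \<open>A preimage under raising is built directly, starting from the column after the last
  maximum of the height path, with runs of \<open>i\<close> in place of runs of
  \<open>i + 1\<close>.\<close>

lemma key_lower_word:
  assumes i: "i \<in> {1..<n}" and r: "word_raise i (key_word n a T) \<noteq> None"
    and l: "word_lower i (key_word n a T) = Some v"
  obtains T' where "T' \<in> SSKD n a" "word_raise i (key_word n a T') = Some (key_word n a T)"
proof -
  define N E where "N = sum a {1..n}" and "E = int (word_eps i (key_word n a T))"
  have Epos: "0 < E" using r word_raise_None[of i "key_word n a T"] unfolding E_def by simp
  have bound: "H i k \<le> E" if "k \<le> N" for k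
    using H_eps that unfolding N_def E_def by simp
  obtain k1 where k1: "k1 \<le> N" "H i k1 = E"
    using H_eps unfolding N_def E_def by blast
  obtain q where q: "last_max i (key_word n a T) q" using l unfolding word_lower_iff by blast
  then have "ht i (key_word n a T) (length (key_word n a T)) < E"
    using last_max_eps[OF q] unfolding last_max_def E_def by simp
  then have HN: "H i N < E" using H_total unfolding N_def by simp
  define k where "k = Max {k. k \<le> N \<and> H i k = E}"
  have fin: "finite {k. k \<le> N \<and> H i k = E}" by simp
  have "k \<in> {k. k \<le> N \<and> H i k = E}" unfolding k_def by (rule Max_in) (use k1 in auto)
  then have k: "k \<le> N" "H i k = E" by auto
  have kmax: "H i m < E" if "k < m" "m \<le> N" for m
  proof -
    have "m \<notin> {k. k \<le> N \<and> H i k = E}" using Max_ge[OF fin, of m] that(1) unfolding k_def by (meson not_le)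
    then have "H i m \<noteq> E" using that(2) by simp
    then show ?thesis using bound[OF that(2)] by simp
  qed
  have kN: "k < N" using k HN by (metis le_neq_implies_less less_irrefl)
  define c where "c = Suc k"
  have c: "0 < c" "c \<le> sum a {1..n}" using kN unfolding c_def N_def by auto
  have step: "H i c = H i k + column_step i (column c)"
    using H_Suc[of k i] kN unfolding c_def N_def by simp
  then have "column_step i (column c) < 0" using kmax[of c] k kN unfolding c_def by simp
  then have ic: "i \<in> column c" "Suc i \<notin> column c" and s1: "column_step i (column c) = - 1"
    by (auto simp: column_step_def split: if_splits)
  \<comment> \<open>Column \<open>k0\<close>, where the positive maximum is first attained, contains
    no \<open>i\<close>. It stops the left run, which consists of entries \<open>i\<close> and could
    otherwise extend into the basement, where both \<open>i\<close> and \<open>i + 1\<close>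
    occur.\<close>
  define k0 where "k0 = (LEAST m. H i m = E)"
  have k0: "H i k0 = E" "k0 \<le> k" unfolding k0_def using k by (auto intro: LeastI Least_le)
  have "k0 \<noteq> 0" using k0 Epos by (intro notI) simp
  then obtain m where m: "k0 = Suc m" by (cases k0) auto
  have "H i m \<noteq> E" using not_less_Least[of m "\<lambda>m. H i m = E"] m unfolding k0_def by simp
  then have "H i m < E" using bound[of m] k0 m k by simp
  then have "0 < column_step i (column k0)" using H_Suc[of m i] k0 m kN unfolding N_def by simp
  then have ik0: "i \<notin> column k0" by (auto simp: column_step_def split: if_splits)
  obtain r where r: "occ i c r" using ic(1) column_iff by blast
  define D where "D = run_columns
    (\<lambda>d. occ i d r \<and> (\<exists>s>r. occ (i + 1) d s)) (\<lambda>d. occ i d r \<and> (\<exists>s<r. occ (i + 1) d s)) c"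
  have cD: "c \<in> D" unfolding D_def by (rule run_columns_refl)
  have DL': "\<forall>d'. d \<le> d' \<and> d' < c \<longrightarrow> occ i d' r" if "d \<in> D" "d < c" for d
    using run_columns_left[OF that[unfolded D_def]] by blast
  have DL: "Suc d \<in> D \<and> occ i d r \<and> (\<exists>s>r. occ (i + 1) d s)" if "d \<in> D" "d < c" for d
    using run_columns_left[OF that[unfolded D_def]] that unfolding D_def by blast
  have DR: "d - 1 \<in> D \<and> occ i d r \<and> (\<exists>s<r. occ (i + 1) d s)" if "d \<in> D" "c < d" for d
    using run_columns_right[OF that[unfolded D_def]] unfolding D_def by blast
  have D0: "0 \<notin> D"
  proof
    assume "0 \<in> D"
    then have "occ i k0 r" using DL'[of 0] k0(2) c unfolding c_def by simp
    then show False using ik0 column_iff by blast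
  qed
  have bal: "key_balanced n a (entries T) i c"
    using bound k(2) kN s1 step kmax
    by (intro balanced[OF i c]) (auto simp: c_def N_def less_le_trans zle_diff1_eq[symmetric] simp del: zle_diff1_eq)
  have reg: "swap_region n a (entries T) i c r i (i + 1) D"
  proof (intro swap_region.intro[OF bal] swap_region_axioms.intro)
    show "\<not> occ (i + 1) c s" for s using ic column_iff by simp
    show "Suc d \<in> D \<and> occ i d r \<and> (\<exists>s>r. occ (i + 1) d s)" if "d \<in> D" "d < c" for d
      using DL[OF that] .
    show "d - 1 \<in> D \<and> occ i d r \<and> (\<exists>s<r. occ (i + 1) d s)" if "d \<in> D" "c < d" for d
      using DR[OF that] .
    show "s \<le> r" if "Suc d \<in> D" "d \<notin> D" "d < c" "occ i d r" "occ (i + 1) d s" for d s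
      using run_columns_left_end[OF that(1-3)[unfolded D_def]] that by (meson not_le)
    show "r \<le> s" if "d \<in> D" "Suc d \<notin> D" "c \<le> d" "occ i (Suc d) r" "occ (i + 1) (Suc d) s" for d s
      using run_columns_right_end[OF that(1-3)[unfolded D_def]] that by (meson not_le)
  qed (use cD D0 r in auto)
  note key = swap_region.lower_key_filling[OF reg refl]
  have both: "i \<in> column d \<and> Suc i \<in> column d" if "d \<in> D" "d \<noteq> c" for d
    using DL[of d] DR[of d] that column_iff by (metis Suc_eq_plus1 linorder_neqE_nat)
  let ?S = "insert (Suc i) (column c - {i})"
  define T' where "T' = swap_columns n a i D T"
  have cols: "key_columns n a T' = (key_columns n a T)[k := ?S]"
    using key_columns_swap_columns[OF D0 cD c(2) both] swap_entry_image_lower[OF ic]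
    unfolding T'_def c_def by simp
  have nth: "key_columns n a T ! k = column c" using nth_key_columns[of k a n T] kN unfolding c_def N_def by simp
  \<comment> \<open>Turning \<open>i\<close> into \<open>i + 1\<close> in column
    \<open>Suc k\<close> lifts the path by 2 beyond \<open>k\<close>, which makes
    \<open>Suc k\<close> the place of its first maximum.\<close>
  have ht': "columns_ht i (key_columns n a T') m = H i m + (if k < m then 2 else 0)" for m
    unfolding cols using columns_ht_update[of k "key_columns n a T" i ?S m] kN s1 nth
    unfolding N_def by (simp add: column_step_def)
  have Hc: "H i c = E - 1" using step s1 k by simp
  have "word_raise i (key_word n a T') =
    Some (columns_word ((key_columns n a T')[k := insert i (key_columns n a T' ! k - {Suc i})]))"
    unfolding key_word_def
  proof (rule columns_word_raise)
    show "finite S" if "S \<in> set (key_columns n a T')" for S using finite_key_columns[OF that] .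
    show "k < length (key_columns n a T')" using kN unfolding N_def by simp
    show "columns_ht i (key_columns n a T') m < columns_ht i (key_columns n a T') (Suc k)" if "m \<le> k" for m
      unfolding ht' using that bound[of m] k(1) Hc unfolding c_def by simp
    show "columns_ht i (key_columns n a T') m \<le> columns_ht i (key_columns n a T') (Suc k)"
      if "m \<le> length (key_columns n a T')" for m
      unfolding ht' using that bound[of m] kmax[of m] Hc unfolding c_def N_def by (cases "k < m") auto
  qed
  moreover have "(key_columns n a T')[k := insert i (key_columns n a T' ! k - {Suc i})] = key_columns n a T"
  proof -
    have "insert i (?S - {Suc i}) = column c" using ic by auto
    then show ?thesis unfolding cols using kN nth unfolding N_def by (metis length_key_columns list_update_id list_update_overwrite nth_list_update_eq)
  qed
  ultimately have "word_raise i (key_word n a T') = Some (key_word n a T)" by (simp add: key_word_def)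
  with swap_columns_SSKD[OF i D0 key, folded T'_def] show ?thesis by (rule that)
qed

end

text \<open>The shape fixes the column sizes, so the word determines the column sets, and these
  determine the entries.\<close>

lemma key_word_inject:
  assumes "T \<in> SSKD n a" "T' \<in> SSKD n a" "key_word n a T = key_word n a T'"
  shows "T = T'"
proof -
  interpret T: tabloid n a T by unfold_locales fact
  interpret T': tabloid n a T' by unfold_locales fact
  have card: "card (column_set n a (entries U) c) = card {r \<in> {1..n}. c \<le> a r}" if "tabloid n a U" for U c
  proof -
    interpret U: tabloid n a U by fact
    show ?thesis
      unfolding column_set_def
    proof (rule card_image, rule inj_onI)
      fix x y assume "x \<in> {r \<in> {1..n}. c \<le> a r}" "y \<in> {r \<in> {1..n}. c \<le> a r}" "entries U x c = entries U y c"
      then show "x = y" using U.inj[of x y c] by simp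
    qed
  qed
  have "key_columns n a T = key_columns n a T'"
  proof (rule columns_word_inject)
    show "columns_word (key_columns n a T) = columns_word (key_columns n a T')"
      using assms(3) unfolding key_word_def .
    show "finite (key_columns n a T ! k) \<and> finite (key_columns n a T' ! k) \<and>
        card (key_columns n a T ! k) = card (key_columns n a T' ! k)" if "k < length (key_columns n a T)" for k
      using that card[OF T.tabloid_axioms] card[OF T'.tabloid_axioms] by (simp add: nth_key_columns)
  qed simp
  then have col: "column_set n a (entries T) c = column_set n a (entries T') c" for c
  proof -
    consider "c = 0" | k where "c = Suc k" "k < sum a {1..n}" | "sum a {1..n} < c"
      by (metis not_less_eq not_less_iff_gr_or_eq old.nat.exhaust)
    then show ?thesis
    proof cases
      case 1
      then show ?thesis by (simp add: column_set_def aug_def)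
    next
      case 2
      then show ?thesis using \<open>key_columns n a T = key_columns n a T'\<close> nth_key_columns by metis
    next
      case 3
      have "{r \<in> {1..n}. c \<le> a r} = {}" using row_le_sum[of _ n a] 3 by fastforce
      then show ?thesis unfolding column_set_def by (simp only: image_empty)
    qed
  qed
  show ?thesis
  proof
    fix x
    show "T x = T' x"
    proof (cases "x \<in> diagram n a")
      case True
      then obtain r c where x: "x = (r, c)" "r \<in> {1..n}" "0 < c" "c \<le> a r" by (cases x) (auto simp: diagram_iff)
      then show ?thesis
        using key_filling_unique[OF T.key_filling_axioms T'.key_filling_axioms col x(2,4)] by (simp add: aug_def)
    next
      case False
      have "T \<in> diagram n a \<rightarrow>\<^sub>E {1..n}" "T' \<in> diagram n a \<rightarrow>\<^sub>E {1..n}"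
        using assms(1,2) unfolding SSKD_def fillings_def by blast+
      then show ?thesis using PiE_arb[OF _ False] by metis
    qed
  qed
qed

section \<open>Embedding of a component into a normal crystal\<close>

lemma SSKD_tabloid: "T \<in> SSKD n a \<Longrightarrow> tabloid n a T"
  by unfold_locales

lemma key_word_raise:
  assumes "T \<in> SSKD n a" "i \<in> {1..<n}"
  shows "word_raise i (key_word n a T) = map_option (key_word n a) (key_raise n a i T)"
  using tabloid.key_raise_None_word[OF SSKD_tabloid] tabloid.key_raise_word(2)[OF SSKD_tabloid] assms
  by (cases "key_raise n a i T") auto

lemma key_raise_closed: "T \<in> SSKD n a \<Longrightarrow> i \<in> {1..<n} \<Longrightarrow> key_raise n a i T = Some T' \<Longrightarrow> T' \<in> SSKD n a"
  using tabloid.key_raise_word(1)[OF SSKD_tabloid] by blast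

theorem theorem5p40:
  fixes n :: nat and a :: "nat \<Rightarrow> nat" and C :: "filling set"
  assumes "C \<in> components (SSKD n a) {1..<n} (key_raise n a)"
  shows "\<exists>(lam :: nat \<Rightarrow> nat) (X :: nat list set) (\<Phi> :: filling \<Rightarrow> nat list).
           is_partition n lam \<and>
           extremal {1..<n} (normal_crystal n lam) word_raise word_lower (highest_word n lam) X \<and>
           bij_betw \<Phi> C X \<and>
           (\<forall>T\<in>C. \<forall>m\<in>{1..n}. word_wt (\<Phi> T) m = key_wt n a T m) \<and>
           (\<forall>T\<in>C. \<forall>T'\<in>C. \<forall>i\<in>{1..<n}.
              key_raise n a i T = Some T' \<longleftrightarrow> word_raise i (\<Phi> T) = Some (\<Phi> T'))"
proof -
  let ?V = "SSKD n a" and ?I = "{1..<n}" and ?w = "key_word n a"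
  obtain T0 where T0: "T0 \<in> ?V" and C: "C = component ?V ?I (key_raise n a) T0"
    using assms unfolding components_def by blast
  have CV: "T \<in> ?V" if "T \<in> C" for T using component_subset[OF T0] that unfolding C by blast
  have Craise: "T' \<in> C" if "T \<in> C" "i \<in> ?I" "key_raise n a i T = Some T'" for T T' i
    using component_raise[OF that(1)[unfolded C] CV[OF that(1)] key_raise_closed[OF CV[OF that(1)] that(2,3)] that(2,3)]
    unfolding C .
  \<comment> \<open>Each raise decreases the sum of the letters by one, so raising inside
    \<open>C\<close> comes to an end.\<close>
  have "\<exists>Hw\<in>C. \<forall>i\<in>?I. key_raise n a i Hw = None" if "T \<in> C" for T
    using that
  proof (induction "sum_list (?w T)" arbitrary: T rule: less_induct)
    case less
    show ?case
    proof (cases "\<forall>i\<in>?I. key_raise n a i T = None")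
      case True
      then show ?thesis using less.prems by blast
    next
      case False
      then obtain i T' where i: "i \<in> ?I" "key_raise n a i T = Some T'" by auto
      then have "word_raise i (?w T) = Some (?w T')"
        using key_word_raise[OF CV[OF less.prems] i(1)] by simp
      then have "sum_list (?w T') < sum_list (?w T)" using word_raise_sum_list by simp
      then show ?thesis using less.hyps[of T'] Craise[OF less.prems i] by simp
    qed
  qed
  moreover have "T0 \<in> C" unfolding C by (rule component_refl)
  ultimately obtain Hw where Hw: "Hw \<in> C" "\<And>i. i \<in> ?I \<Longrightarrow> key_raise n a i Hw = None" by blast
  have CH: "C = component ?V ?I (key_raise n a) Hw" using component_eq[OF Hw(1)[unfolded C]] unfolding C by (rule sym)
  \<comment> \<open>The weight of the highest word dictates the partition. Its parts decrease
    because the end point of each height path of \<open>h\<close> is at most 0.\<close>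
  define h lam where "h = ?w Hw" and "lam = count_list h"
  have hlists: "?w T \<in> lists {1..n}" if "T \<in> C" for T
    using tabloid.key_word_lists[OF SSKD_tabloid[OF CV[OF that]]] .
  have hNone: "word_raise i h = None" if "i \<in> ?I" for i
    using key_word_raise[OF CV[OF Hw(1)] that] Hw(2)[OF that] unfolding h_def by simp
  have step: "lam (Suc i) \<le> lam i" if "i \<in> ?I" for i
    using word_eps_bound[of "length h" h i] hNone[OF that] word_raise_None[of i h] ht_length[of i h]
    unfolding lam_def by simp
  have part: "is_partition n lam"
    unfolding is_partition_def
  proof (intro ballI impI)
    fix i j assume ij: "i \<in> {1..n}" "j \<in> {1..n}" "i \<le> j"
    from ij(3,1,2) show "lam j \<le> lam i"
    proof (induction j rule: dec_induct)
      case (step m)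
      then show ?case using \<open>\<And>i. i \<in> ?I \<Longrightarrow> lam (Suc i) \<le> lam i\<close>[of m] by auto
    qed simp
  qed
  let ?h' = "highest_word n lam"
  have hp: "highest_pair n h ?h'"
    unfolding highest_pair_def
    using hlists[OF Hw(1)] highest_word_lists hNone highest_word_raise[OF part]
    by (auto simp: h_def[symmetric] ht_length count_highest_word lam_def)
  let ?t = "word_transport n h ?h'"
  have wC: "?w T \<in> word_component n h" if "T \<in> C" for T
  proof -
    have "?w T \<in> word_component n h \<and> T \<in> C" using that unfolding CH
    proof (induction rule: component_induct)
      case start
      show ?case unfolding h_def by (simp add: component_refl)
    next
      case (raise i T T')
      then have "T' \<in> C" using Craise CH by blast
      moreover have "?w T' \<in> word_component n h"
        using component_raise[of "?w T" _ _ _ h "?w T'" i] raise key_word_raise[OF raise(2,4)]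
          hlists[OF \<open>T' \<in> C\<close>] hlists[of T] CH by simp
      ultimately show ?case using CH by simp
    next
      case (lower i T T')
      then have "T' \<in> C" using component_lower CH by metis
      moreover have "?w T' \<in> word_component n h"
        using component_lower[of "?w T" _ _ _ h "?w T'" i] lower key_word_raise[OF lower(3,4)]
          hlists[OF \<open>T' \<in> C\<close>] hlists[of T] CH by simp
      ultimately show ?case using CH by simp
    qed
    then show ?thesis by simp
  qed
  define \<Phi> where "\<Phi> = (\<lambda>T. ?t (?w T))"
  have inj: "inj_on \<Phi> C"
  proof (rule inj_onI)
    fix T T' assume T: "T \<in> C" "T' \<in> C" "\<Phi> T = \<Phi> T'"
    then have "?w T = ?w T'"
      using inj_onD[OF word_transport_inj[OF hp] _ wC[OF T(1)] wC[OF T(2)]] unfolding \<Phi>_def by blast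
    then show "T = T'" using key_word_inject CV T by blast
  qed
  have raise: "word_raise i (\<Phi> T) = map_option \<Phi> (key_raise n a i T)" if "T \<in> C" "i \<in> ?I" for T i
    using word_transport_raise[OF hp wC[OF that(1)] that(2)] key_word_raise[OF CV[OF that(1)] that(2)]
    unfolding \<Phi>_def by (simp add: option.map_comp o_def)
  have ext: "extremal ?I (normal_crystal n lam) word_raise word_lower ?h' (\<Phi> ` C)"
    unfolding extremal_def
  proof (intro conjI ballI allI impI)
    show "\<Phi> ` C \<subseteq> normal_crystal n lam"
      unfolding normal_crystal_def \<Phi>_def using word_transport_component[OF hp] wC by blast
    show "?h' \<in> \<Phi> ` C"
      using word_transport_highest[OF hp] Hw(1) unfolding \<Phi>_def h_def by (metis image_eqI)
    show "y \<in> \<Phi> ` C" if "i \<in> ?I" "x \<in> \<Phi> ` C" "word_raise i x = Some y" for i x y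
    proof -
      from that(2) obtain T where T: "T \<in> C" "x = \<Phi> T" by blast
      with that(3) raise[OF T(1) that(1)] obtain T' where "key_raise n a i T = Some T'" "y = \<Phi> T'" by auto
      then show ?thesis using Craise[OF T(1) that(1)] by blast
    qed
    show "\<not> (\<exists>z\<in>\<Phi> ` C. word_raise i x = Some z)"
      if i: "i \<in> ?I" and x: "x \<in> \<Phi> ` C" and y: "word_lower i x = Some y \<and> y \<notin> \<Phi> ` C" for i x y
    proof
      assume "\<exists>z\<in>\<Phi> ` C. word_raise i x = Some z"
      then have r: "word_raise i x \<noteq> None" by auto
      obtain T where T: "T \<in> C" "x = \<Phi> T" using x by blast
      have r': "word_raise i (?w T) \<noteq> None"
        using r raise[OF T(1) i] key_word_raise[OF CV[OF T(1)] i] T(2) by auto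
      obtain v where v: "word_lower i (?w T) = Some v"
        using word_transport_lower_None[OF hp wC[OF T(1)] i] y T(2) unfolding \<Phi>_def by fastforce
      then have yv: "y = ?t v" using word_transport_lower[OF hp wC[OF T(1)] i v] y T(2) unfolding \<Phi>_def by simp
      \<comment> \<open>Raising \<open>T'\<close> is only known to give the word of
        \<open>T\<close>; injectivity of \<open>key_word\<close> makes it give \<open>T\<close>
        itself.\<close>
      obtain T' where T': "T' \<in> ?V" "word_raise i (?w T') = Some (?w T)"
        by (rule tabloid.key_lower_word[OF SSKD_tabloid[OF CV[OF T(1)]] i r' v])
      then obtain T2 where T2: "key_raise n a i T' = Some T2" "?w T2 = ?w T"
        using key_word_raise[OF T'(1) i] by auto
      then have "T2 = T" using key_word_inject key_raise_closed[OF T'(1) i] CV[OF T(1)] by blast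
      then have "T' \<in> C"
        using component_lower[of T ?V ?I "key_raise n a" T0 T' i] T(1) CV[OF T(1)] T'(1) i T2(1) unfolding C by blast
      moreover have "v = ?w T'" using v T'(2) by (simp add: word_lower_raise[symmetric])
      ultimately have "y \<in> \<Phi> ` C" unfolding yv \<Phi>_def by blast
      then show False using y by blast
    qed
  qed
  have wt: "word_wt (\<Phi> T) m = key_wt n a T m" if "T \<in> C" "m \<in> {1..n}" for T m
  proof -
    have "count_list h m = count_list ?h' m" using count_highest_word[OF that(2), of lam] by (simp add: lam_def)
    then show ?thesis
      using word_transport_count[OF hp wC[OF that(1)]] tabloid.key_word_count[OF SSKD_tabloid[OF CV[OF that(1)]] that(2)]
      unfolding word_wt_def \<Phi>_def by simp
  qed
  have iff: "key_raise n a i T = Some T' \<longleftrightarrow> word_raise i (\<Phi> T) = Some (\<Phi> T')"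
    if "T \<in> C" "T' \<in> C" "i \<in> ?I" for T T' i
  proof
    assume "key_raise n a i T = Some T'"
    then show "word_raise i (\<Phi> T) = Some (\<Phi> T')" using raise that by simp
  next
    assume "word_raise i (\<Phi> T) = Some (\<Phi> T')"
    then have "map_option \<Phi> (key_raise n a i T) = Some (\<Phi> T')" using raise[OF that(1,3)] by simp
    then obtain T2 where T2: "key_raise n a i T = Some T2" "\<Phi> T2 = \<Phi> T'"
      unfolding map_option_eq_Some by blast
    then have "T2 = T'" using inj_onD[OF inj] Craise[OF that(1,3)] that(2) by blast
    then show "key_raise n a i T = Some T'" using T2 by simp
  qed
  show ?thesis
    by (rule exI[of _ lam], rule exI[of _ "\<Phi> ` C"], rule exI[of _ \<Phi>])
      (use part ext inj wt iff in \<open>auto simp: bij_betw_def\<close>)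
qed

end
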